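(* The correspondence which associates to a strongly polarized symplectic Lie algebra $(\mathfrak g,\omega,\mathfrak a,N)$ its extension triple $(\mathfrak h,\nabla,\alpha)$ induces a bijection between the set of isomorphism classes of strongly polarized symplectic Lie algebras and the set of isomorphism classes of flat Lie algebras with symplectic extension cocycle.
   Context: All Lie algebras are finite-dimensional over a fixed field $k$ of characteristic $0$. A symplectic Lie algebra $(\mathfrak g,\omega)$ is a Lie algebra with a non-degenerate alternating form $\omega$ satisfying $\omega([u,v],w)+\omega([w,u],v)+\omega([v,w],u)=0$. A subspace is Lagrangian if it equals its $\omega$-orthogonal; a Lagrangian ideal (which is automatically abelian) is an ideal that is a Lagrangian subspace. A strongly polarized symplectic Lie algebra $(\mathfrak g,\omega,\mathfrak a,N)$ is a symplectic Lie algebra $(\mathfrak g,\omega)$ with a Lagrangian ideal $\mathfrak a$ and a Lagrangian subspace $N$ with $\mathfrak g=\mathfrak a\oplus N$. An isomorphism $(\mathfrak g,\omega,\mathfrak a,N)\to(\mathfrak g',\omega',\mathfrak a',N')$ is a Lie algebra isomorphism $\Phi$ with $\Phi^*\omega'=\omega$, $\Phi(\mathfrak a)=\mathfrak a'$, $\Phi(N)=N'$. A flat Lie algebra $(\mathfrak h,\nabla)$ is a Lie algebra with a bilinear map $\nabla:\mathfrak h\times\mathfrak h\to\mathfrak h$, $(u,v)\mapsto\nabla_uv$, with $\nabla_uv-\nabla_vu=[u,v]$ and $\nabla_u\nabla_v-\nabla_v\nabla_u=\nabla_{[u,v]}$. Let $\rho:\mathfrak h\to\mathrm{End}(\mathfrak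 h^* )$, $\rho(u)\xi=-\xi\circ\nabla_u$, be the dual representation, and $Z^2_\nabla(\mathfrak h,\mathfrak h^* )$ the space of Chevalley–Eilenberg two-cocycles $\alpha\in\mathrm{Hom}(\bigwedge^2\mathfrak h,\mathfrak h^* )$ with respect to $\rho$. A flat Lie algebra with symplectic extension cocycle is a triple $(\mathfrak h,\nabla,\alpha)$, where $(\mathfrak h,\nabla)$ is a flat Lie algebra and $\alpha\in Z^2_\nabla(\mathfrak h,\mathfrak h^* )$ satisfies $\alpha(u,v)(w)+\alpha(w,u)(v)+\alpha(v,w)(u)=0$ for all $u,v,w\in\mathfrak h$. An isomorphism $(\mathfrak h,\nabla,\alpha)\to(\mathfrak h',\nabla',\alpha')$ is a Lie algebra isomorphism $\varphi:\mathfrak h\to\mathfrak h'$ with $\varphi(\nabla_uv)=\nabla'_{\varphi u}\varphi v$ and $\alpha'(\varphi u,\varphi v)(\varphi w)=\alpha(u,v)(w)$ for all $u,v,w\in\mathfrak h$. The extension triple of $(\mathfrak g,\omega,\mathfrak a,N)$: $\mathfrak h=\mathfrak g/\mathfrak a$; for $u\in\mathfrak h$ let $\tilde u\in N$ be its unique lift in $N$. The connection $\nabla$ on $\mathfrak h$ is determined by $\omega(\widetilde{\nabla_uv},a)=-\omega(\tilde v,[\tilde u,a])$ for all $a\in\mathfrak a$; it is flat and torsion-free. With $\pi_{\mathfrak a}:\mathfrak g=\mathfrak a\oplus N\to\mathfrak a$ the projection, $\alpha(u,v)(w)=\omega(\pi_{\mathfrak a}([\tilde u,\tilde v]),\tilde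 w)$. *)

theory Defs
  imports "Jordan_Normal_Form.Missing_VectorSpace" "HOL-Algebra.QuotRing"
begin

text \<open>
  Vector spaces are the \<open>vectorspace\<close> structures over a field \<open>K\<close> with explicit carriers. The
  record fields \<open>mult\<close> and \<open>one\<close> that \<open>module\<close> inherits from \<open>ring\<close> have no
  meaning here, and all operations are only relevant on the carriers.
\<close>

section \<open>Linear algebra\<close>

locale field_char_zero = field K for K (structure) +
  assumes char_zero: "0 < (n :: nat) \<Longrightarrow> [n] \<cdot> \<one> \<noteq> \<zero>"

definition ground_space :: "('k, 'm) ring_scheme \<Rightarrow> ('k, 'k) module" where
  "ground_space K =
     \<lparr>carrier = carrier K, mult = mult K, one = one K, zero = zero K, add = add K,
      smult = mult K\<rparr>"

text \<open>Functionals are represented by their extensional extension from \<open>carrier V\<close>.\<close>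

definition dual_space ::
    "('k, 'm) ring_scheme \<Rightarrow> ('k, 'a, 'x) module_scheme \<Rightarrow> ('k, 'a \<Rightarrow> 'k) module" where
  "dual_space K V =
     (ring.func_space K (carrier V))
       \<lparr>carrier := module_hom K V (ground_space K) \<inter> extensional (carrier V)\<rparr>"

definition bilinear_map ::
    "('k, 'm) ring_scheme \<Rightarrow> ('k, 'a, 'x) module_scheme \<Rightarrow> ('k, 'b, 'y) module_scheme
       \<Rightarrow> ('k, 'c, 'z) module_scheme \<Rightarrow> ('a \<Rightarrow> 'b \<Rightarrow> 'c) \<Rightarrow> bool" where
  "bilinear_map K U V W f \<longleftrightarrow>
     (\<forall>u\<in>carrier U. f u \<in> module_hom K V W) \<and>
     (\<forall>v\<in>carrier V. (\<lambda>u. f u v) \<in> module_hom K U W)"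


section \<open>Lie algebras\<close>

record ('k, 'a) lie_alg = "('k, 'a) module" +
  bracket :: "'a \<Rightarrow> 'a \<Rightarrow> 'a"

locale lie_algebra = vectorspace K L
  for K :: "('k, 'm) ring_scheme" and L :: "('k, 'a, 'x) lie_alg_scheme" +
  assumes finite_dimensional: "fin_dim"
    and bracket_bilinear: "bilinear_map K L L L (bracket L)"
    and bracket_alternating: "x \<in> carrier L \<Longrightarrow> bracket L x x = \<zero>\<^bsub>L\<^esub>"
    and jacobi: "\<lbrakk>x \<in> carrier L; y \<in> carrier L; z \<in> carrier L\<rbrakk> \<Longrightarrow>
      bracket L x (bracket L y z) \<oplus>\<^bsub>L\<^esub> bracket L y (bracket L z x)
        \<oplus>\<^bsub>L\<^esub> bracket L z (bracket L x y) = \<zero>\<^bsub>L\<^esub>"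

definition lie_ideal ::
    "('k, 'm) ring_scheme \<Rightarrow> 'a set \<Rightarrow> ('k, 'a, 'x) lie_alg_scheme \<Rightarrow> bool" where
  "lie_ideal K I L \<longleftrightarrow>
     subspace K I L \<and> (\<forall>x\<in>carrier L. \<forall>a\<in>I. bracket L x a \<in> I)"

definition lie_iso ::
    "('k, 'm) ring_scheme \<Rightarrow> ('k, 'a, 'x) lie_alg_scheme \<Rightarrow> ('k, 'b, 'y) lie_alg_scheme
       \<Rightarrow> ('a \<Rightarrow> 'b) set" where
  "lie_iso K L M =
     {f \<in> module_hom K L M. bij_betw f (carrier L) (carrier M) \<and>
        (\<forall>x\<in>carrier L. \<forall>y\<in>carrier L. f (bracket L x y) = bracket M (f x) (f y))}"

text \<open>Chevalley--Eilenberg two-cocycles of \<open>L\<close> with values in \<open>M\<close>, on which \<open>L\<close> acts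
  by \<open>\<rho>\<close>.\<close>

definition ce_two_cocycles ::
    "('k, 'm) ring_scheme \<Rightarrow> ('k, 'a, 'x) lie_alg_scheme \<Rightarrow> ('k, 'b, 'y) module_scheme
       \<Rightarrow> ('a \<Rightarrow> 'b \<Rightarrow> 'b) \<Rightarrow> ('a \<Rightarrow> 'a \<Rightarrow> 'b) set" where
  "ce_two_cocycles K L M \<rho> =
     {\<alpha>. bilinear_map K L L M \<alpha> \<and>
         (\<forall>u\<in>carrier L. \<alpha> u u = \<zero>\<^bsub>M\<^esub>) \<and>
         (\<forall>u\<in>carrier L. \<forall>v\<in>carrier L. \<forall>w\<in>carrier L.
            \<rho> u (\<alpha> v w) \<ominus>\<^bsub>M\<^esub> \<rho> v (\<alpha> u w) \<oplus>\<^bsub>M\<^esub> \<rho> w (\<alpha> u v)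
              \<ominus>\<^bsub>M\<^esub> \<alpha> (bracket L u v) w \<oplus>\<^bsub>M\<^esub> \<alpha> (bracket L u w) v
              \<ominus>\<^bsub>M\<^esub> \<alpha> (bracket L v w) u = \<zero>\<^bsub>M\<^esub>)}"

text \<open>The additive group of the quotient is that of \<open>FactRing\<close>, and the bracket is
  formed like \<open>rcoset_mult\<close>.\<close>

definition lie_quotient :: "('k, 'a, 'x) lie_alg_scheme \<Rightarrow> 'a set \<Rightarrow> ('k, 'a set) lie_alg" where
  "lie_quotient L I =
     \<lparr>carrier = a_rcosets\<^bsub>L\<^esub> I, mult = rcoset_mult L I, one = I +>\<^bsub>L\<^esub> \<one>\<^bsub>L\<^esub>,
      zero = I, add = set_add L,
      smult = (\<lambda>c X. \<Union>x\<in>X. I +>\<^bsub>L\<^esub> (c \<odot>\<^bsub>L\<^esub> x)),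
      bracket = (\<lambda>X Y. \<Union>x\<in>X. \<Union>y\<in>Y. I +>\<^bsub>L\<^esub> bracket L x y)\<rparr>"


section \<open>Strongly polarized symplectic Lie algebras\<close>

record ('k, 'a) symplectic_alg = "('k, 'a) lie_alg" +
  form :: "'a \<Rightarrow> 'a \<Rightarrow> 'k"

locale symplectic_lie_algebra = lie_algebra K G
  for K :: "('k, 'm) ring_scheme" and G :: "('k, 'a, 'x) symplectic_alg_scheme" +
  assumes form_bilinear: "bilinear_map K G G (ground_space K) (form G)"
    and form_alternating: "u \<in> carrier G \<Longrightarrow> form G u u = \<zero>\<^bsub>K\<^esub>"
    and form_nondegenerate:
      "\<lbrakk>u \<in> carrier G; \<And>v. v \<in> carrier G \<Longrightarrow> form G u v = \<zero>\<^bsub>K\<^esub>\<rbrakk> \<Longrightarrow> u = \<zero>\<^bsub>G\<^esub>"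
    and form_closed: "\<lbrakk>u \<in> carrier G; v \<in> carrier G; w \<in> carrier G\<rbrakk> \<Longrightarrow>
      form G (bracket G u v) w \<oplus>\<^bsub>K\<^esub> form G (bracket G w u) v
        \<oplus>\<^bsub>K\<^esub> form G (bracket G v w) u = \<zero>\<^bsub>K\<^esub>"

definition form_orthogonal ::
    "('k, 'm) ring_scheme \<Rightarrow> ('k, 'a, 'x) symplectic_alg_scheme \<Rightarrow> 'a set \<Rightarrow> 'a set" where
  "form_orthogonal K G W = {u \<in> carrier G. \<forall>w\<in>W. form G u w = \<zero>\<^bsub>K\<^esub>}"

definition lagrangian ::
    "('k, 'm) ring_scheme \<Rightarrow> 'a set \<Rightarrow> ('k, 'a, 'x) symplectic_alg_scheme \<Rightarrow> bool" where
  "lagrangian K W G \<longleftrightarrow> subspace K W G \<and> form_orthogonal K G W = W"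

record ('k, 'a) polarized_alg = "('k, 'a) symplectic_alg" +
  lag_ideal :: "'a set"
  lag_complement :: "'a set"

locale strongly_polarized = symplectic_lie_algebra K G
  for K :: "('k, 'm) ring_scheme" and G :: "('k, 'a, 'x) polarized_alg_scheme" +
  assumes ideal: "lie_ideal K (lag_ideal G) G"
    and ideal_lagrangian: "lagrangian K (lag_ideal G) G"
    and complement_lagrangian: "lagrangian K (lag_complement G) G"
    and sum_carrier: "lag_ideal G <+>\<^bsub>G\<^esub> lag_complement G = carrier G"
    and sum_direct: "lag_ideal G \<inter> lag_complement G = {\<zero>\<^bsub>G\<^esub>}"

definition polarized_isomorphic ::
    "('k, 'm) ring_scheme \<Rightarrow> ('k, 'a) polarized_alg \<Rightarrow> ('k, 'b) polarized_alg \<Rightarrow> bool" where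
  "polarized_isomorphic K G G' \<longleftrightarrow>
     (\<exists>\<Phi>\<in>lie_iso K G G'.
        (\<forall>u\<in>carrier G. \<forall>v\<in>carrier G. form G' (\<Phi> u) (\<Phi> v) = form G u v) \<and>
        \<Phi> ` lag_ideal G = lag_ideal G' \<and>
        \<Phi> ` lag_complement G = lag_complement G')"


section \<open>Flat Lie algebras with symplectic extension cocycle\<close>

record ('k, 'a) flat_alg = "('k, 'a) lie_alg" +
  conn :: "'a \<Rightarrow> 'a \<Rightarrow> 'a"

locale flat_lie_algebra = lie_algebra K H
  for K :: "('k, 'm) ring_scheme" and H :: "('k, 'a, 'x) flat_alg_scheme" +
  assumes conn_bilinear: "bilinear_map K H H H (conn H)"
    and conn_torsion_free: "\<lbrakk>u \<in> carrier H; v \<in> carrier H\<rbrakk> \<Longrightarrow>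
      conn H u v \<ominus>\<^bsub>H\<^esub> conn H v u = bracket H u v"
    and conn_flat: "\<lbrakk>u \<in> carrier H; v \<in> carrier H; w \<in> carrier H\<rbrakk> \<Longrightarrow>
      conn H u (conn H v w) \<ominus>\<^bsub>H\<^esub> conn H v (conn H u w) = conn H (bracket H u v) w"

definition dual_representation ::
    "('k, 'm) ring_scheme \<Rightarrow> ('k, 'a, 'x) flat_alg_scheme \<Rightarrow> 'a \<Rightarrow> ('a \<Rightarrow> 'k) \<Rightarrow> ('a \<Rightarrow> 'k)" where
  "dual_representation K H u \<xi> = (\<lambda>w\<in>carrier H. \<ominus>\<^bsub>K\<^esub> \<xi> (conn H u w))"

record ('k, 'a) flat_cocycle_alg = "('k, 'a) flat_alg" +
  cocycle :: "'a \<Rightarrow> 'a \<Rightarrow> 'a \<Rightarrow> 'k"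

locale flat_with_symplectic_cocycle = flat_lie_algebra K H
  for K :: "('k, 'm) ring_scheme" and H :: "('k, 'a, 'x) flat_cocycle_alg_scheme" +
  assumes cocycle:
      "cocycle H \<in> ce_two_cocycles K H (dual_space K H) (dual_representation K H)"
    and cocycle_symplectic: "\<lbrakk>u \<in> carrier H; v \<in> carrier H; w \<in> carrier H\<rbrakk> \<Longrightarrow>
      cocycle H u v w \<oplus>\<^bsub>K\<^esub> cocycle H w u v \<oplus>\<^bsub>K\<^esub> cocycle H v w u = \<zero>\<^bsub>K\<^esub>"

definition flat_cocycle_isomorphic ::
    "('k, 'm) ring_scheme \<Rightarrow> ('k, 'a) flat_cocycle_alg \<Rightarrow> ('k, 'b) flat_cocycle_alg \<Rightarrow> bool"
  where
  "flat_cocycle_isomorphic K H H' \<longleftrightarrow>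
     (\<exists>\<phi>\<in>lie_iso K H H'.
        (\<forall>u\<in>carrier H. \<forall>v\<in>carrier H. \<phi> (conn H u v) = conn H' (\<phi> u) (\<phi> v)) \<and>
        (\<forall>u\<in>carrier H. \<forall>v\<in>carrier H. \<forall>w\<in>carrier H.
           cocycle H' (\<phi> u) (\<phi> v) (\<phi> w) = cocycle H u v w))"


section \<open>The extension triple\<close>

definition lift :: "('k, 'a) polarized_alg \<Rightarrow> 'a set \<Rightarrow> 'a" where
  "lift G u = (THE x. x \<in> lag_complement G \<and> x \<in> u)"

definition ideal_proj :: "('k, 'a) polarized_alg \<Rightarrow> 'a \<Rightarrow> 'a" where
  "ideal_proj G x = (THE a. a \<in> lag_ideal G \<and> (\<exists>n\<in>lag_complement G. x = a \<oplus>\<^bsub>G\<^esub> n))"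

definition ext_conn ::
    "('k, 'm) ring_scheme \<Rightarrow> ('k, 'a) polarized_alg \<Rightarrow> 'a set \<Rightarrow> 'a set \<Rightarrow> 'a set" where
  "ext_conn K G u v =
     (THE w. w \<in> carrier (lie_quotient G (lag_ideal G)) \<and>
        (\<forall>a\<in>lag_ideal G.
           form G (lift G w) a = \<ominus>\<^bsub>K\<^esub> form G (lift G v) (bracket G (lift G u) a)))"

definition ext_cocycle :: "('k, 'a) polarized_alg \<Rightarrow> 'a set \<Rightarrow> 'a set \<Rightarrow> 'a set \<Rightarrow> 'k" where
  "ext_cocycle G u v =
     (\<lambda>w\<in>carrier (lie_quotient G (lag_ideal G)).
        form G (ideal_proj G (bracket G (lift G u) (lift G v))) (lift G w))"

definition extension_triple ::
    "('k, 'm) ring_scheme \<Rightarrow> ('k, 'a) polarized_alg \<Rightarrow> ('k, 'a set) flat_cocycle_alg" where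
  "extension_triple K G =
     lie_alg.extend (lie_quotient G (lag_ideal G))
       \<lparr>conn = ext_conn K G, cocycle = ext_cocycle G\<rparr>"


section \<open>Isomorphism classes\<close>

text \<open>
  Isomorphism classes are taken among the structures whose carrier is a subset of a type
  \<open>'u\<close>. If the underlying set of \<open>K\<close> embeds into \<open>'u\<close>, then every finite-dimensional vector
  space over \<open>K\<close> (an infinite field), in whatever type its carrier lives, has an isomorphic
  copy in \<open>'u\<close>, so that no isomorphism class is missing. The extension triple of a structure
  in \<open>'u\<close> lives in \<open>'u set\<close>; for this reason isomorphism is a relation between structures over
  possibly different types.
\<close>

definition polarized_algs :: "('k, 'm) ring_scheme \<Rightarrow> ('k, 'u) polarized_alg set" where
  "polarized_algs K = {G. strongly_polarized K G}"

definition polarized_iso_rel ::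
    "('k, 'm) ring_scheme \<Rightarrow> ('k, 'u) polarized_alg rel" where
  "polarized_iso_rel K =
     {(G, G'). G \<in> polarized_algs K \<and> G' \<in> polarized_algs K \<and> polarized_isomorphic K G G'}"

definition flat_cocycle_algs :: "('k, 'm) ring_scheme \<Rightarrow> ('k, 'u) flat_cocycle_alg set" where
  "flat_cocycle_algs K = {H. flat_with_symplectic_cocycle K H}"

definition flat_cocycle_iso_rel ::
    "('k, 'm) ring_scheme \<Rightarrow> ('k, 'u) flat_cocycle_alg rel" where
  "flat_cocycle_iso_rel K =
     {(H, H'). H \<in> flat_cocycle_algs K \<and> H' \<in> flat_cocycle_algs K \<and>
        flat_cocycle_isomorphic K H H'}"

end

theory Submission
  imports Defs
begin

text \<open>
  The form \<open>\<omega>\<close> pairs the Lagrangian ideal \<open>\<aa>\<close> perfectly with the complement \<open>N \<cong> \<hh>\<close>, so the ideal is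
  \<open>\<hh>\<^sup>*\<close> and, through this pairing, the bracket of \<open>\<gg>\<close> is determined by the extension triple:
  the ideal is abelian, \<open>\<hh>\<close> acts on it by \<open>\<rho>\<close>, and the bracket of two elements of \<open>N\<close> is given by
  the bracket of \<open>\<hh>\<close> and by \<open>\<alpha>\<close>. Hence \<open>x \<mapsto> (\<omega>(x, \<cdot>), x + \<aa>)\<close> is an isomorphism from \<open>\<gg>\<close> onto an explicit
  symplectic Lie algebra on \<open>\<hh>\<^sup>* \<oplus> \<hh>\<close>. Under this dictionary flatness of \<open>\<nabla>\<close> and the cocycle
  condition together are the Jacobi identity, and vanishing torsion and the cyclic condition on \<open>\<alpha>\<close>
  together say that \<open>\<omega>\<close> is closed.
\<close>

section \<open>Linear algebra\<close>

text \<open>The extension triple of a structure over \<open>'u\<close> consists of cosets and lives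
  in \<open>'u set\<close>, so it is not itself a member of the classes on the other side. The proof
  therefore works with a relation instead of a function: the locale \<open>extension_model\<close>
  says that \<open>H\<close>, in whatever type, together with an identification \<open>l\<close>
  with the complement, satisfies the equations that define the triple. The triple with
  \<open>lift\<close> is one instance; others live on the complement itself and on the second factor
  of \<open>symplectic_extension\<close>. Two facts carry the result: the models of a fixed
  \<open>G\<close> are closed under isomorphism and all isomorphic, and a model determines
  \<open>G\<close> up to isomorphism. Once the relation is total and onto, the bijection of classes
  is formal. Surjectivity is where the universe matters: the algebra on
  \<open>\<hh>\<^sup>* \<oplus> \<hh>\<close> has to be moved into \<open>'u\<close>. A
  finite-dimensional space over an infinite field injects into that field, and characteristic zero
  makes \<open>K\<close> infinite.\<close>

lemma ground_space_simps [simp]: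
  "carrier (ground_space K) = carrier K" "add (ground_space K) = add K"
  "smult (ground_space K) = mult K" "zero (ground_space K) = zero K"
  "a_minus (ground_space K) = a_minus K" "a_inv (ground_space K) = a_inv K"
  by (simp_all add: ground_space_def a_minus_def a_inv_def m_inv_def fun_eq_iff)

lemma module_homI:
  assumes "\<And>x. x \<in> carrier M \<Longrightarrow> f x \<in> carrier N"
    and "\<And>x y. \<lbrakk>x \<in> carrier M; y \<in> carrier M\<rbrakk> \<Longrightarrow> f (x \<oplus>\<^bsub>M\<^esub> y) = f x \<oplus>\<^bsub>N\<^esub> f y"
    and "\<And>c x. \<lbrakk>c \<in> carrier R; x \<in> carrier M\<rbrakk> \<Longrightarrow> f (c \<odot>\<^bsub>M\<^esub> x) = c \<odot>\<^bsub>N\<^esub> f x"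
  shows "f \<in> module_hom R M N"
  using assms by (auto simp: module_hom_def)

lemma module_hom_carrier: "\<lbrakk>f \<in> module_hom R M N; x \<in> carrier M\<rbrakk> \<Longrightarrow> f x \<in> carrier N"
  by (auto simp: module_hom_def)

lemma module_hom_comp:
  "\<lbrakk>f \<in> module_hom R L M; g \<in> module_hom R M N\<rbrakk> \<Longrightarrow> g \<circ> f \<in> module_hom R L N"
  by (auto simp: module_hom_def Pi_iff)

lemma module_hom_inv_into:
  assumes "module R M" and f: "f \<in> module_hom R M N" and bij: "bij_betw f (carrier M) (carrier N)"
  shows "inv_into (carrier M) f \<in> module_hom R N M"
proof -
  interpret module R M by fact
  let ?g = "inv_into (carrier M) f"
  have cl: "?g y \<in> carrier M" if "y \<in> carrier N" for y
    using that bij by (metis bij_betw_imp_surj_on inv_into_into)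
  have fg: "f (?g y) = y" if "y \<in> carrier N" for y
    using that bij by (simp add: bij_betw_inv_into_right)
  have gf: "?g (f x) = x" if "x \<in> carrier M" for x
    using that bij by (simp add: bij_betw_inv_into_left)
  show ?thesis
  proof (rule module_homI)
    fix x y assume "x \<in> carrier N" "y \<in> carrier N"
    then show "?g (x \<oplus>\<^bsub>N\<^esub> y) = ?g x \<oplus>\<^bsub>M\<^esub> ?g y"
      using gf[of "?g x \<oplus>\<^bsub>M\<^esub> ?g y"] by (simp add: module_hom_add[OF f] cl fg)
  next
    fix c x assume "c \<in> carrier R" "x \<in> carrier N"
    then show "?g (c \<odot>\<^bsub>N\<^esub> x) = c \<odot>\<^bsub>M\<^esub> ?g x"
      using gf[of "c \<odot>\<^bsub>M\<^esub> ?g x"] by (simp add: module_hom_smult[OF f] cl fg)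
  qed (fact cl)
qed

section \<open>Dual spaces and finite-dimensional duality\<close>

context vectorspace
begin

lemma ground_space_is_vs: "vectorspace K (ground_space K)"
  by (rule vs_criteria)
    (auto simp: field_axioms R.add.m_ac R.m_ac R.l_distr R.r_distr intro!: bexI[of _ "\<ominus>\<^bsub>K\<^esub> x" for x] R.r_neg)

lemma dual_space_simps [simp]:
  "carrier (dual_space K V) = module_hom K V (ground_space K) \<inter> extensional (carrier V)"
  "zero (dual_space K V) = (\<lambda>v\<in>carrier V. \<zero>\<^bsub>K\<^esub>)"
  "add (dual_space K V) f g = (\<lambda>v\<in>carrier V. f v \<oplus>\<^bsub>K\<^esub> g v)"
  "smult (dual_space K V) c f = (\<lambda>v\<in>carrier V. c \<otimes>\<^bsub>K\<^esub> f v)"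
  by (simp_all add: dual_space_def func_space_def)

text \<open>Inherited from the space of all extensional functions on \<open>carrier V\<close>, in
  which the functionals form a subspace.\<close>

lemma dual_space_is_vs: "vectorspace K (dual_space K V)"
proof -
  interpret F: vectorspace K "func_space (carrier V)" by (rule func_space_is_vs)
  have "submodule K (module_hom K V (ground_space K) \<inter> extensional (carrier V)) (func_space (carrier V))"
  proof (rule submodule.intro)
    show "module K (func_space (carrier V))" ..
  qed (auto simp: func_space_def module_hom_def PiE_def Pi_iff R.add.m_ac R.m_ac R.r_distr)
  then have "subspace K (module_hom K V (ground_space K) \<inter> extensional (carrier V)) (func_space (carrier V))"
    by (simp add: subspace_def F.vectorspace_axioms)
  from F.subspace_is_vs[OF this] show ?thesis
    unfolding dual_space_def .
qed

lemma module_hom_eqs: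
  assumes "f \<in> module_hom K V W" and "module K W"
  shows module_hom_zero: "f \<zero>\<^bsub>V\<^esub> = \<zero>\<^bsub>W\<^esub>"
    and module_hom_neg: "x \<in> carrier V \<Longrightarrow> f (\<ominus>\<^bsub>V\<^esub> x) = \<ominus>\<^bsub>W\<^esub> f x"
    and module_hom_minus: "\<lbrakk>x \<in> carrier V; y \<in> carrier V\<rbrakk> \<Longrightarrow> f (x \<ominus>\<^bsub>V\<^esub> y) = f x \<ominus>\<^bsub>W\<^esub> f y"
proof -
  interpret W: module K W by fact
  interpret mod_hom K V W f
    by unfold_locales (fact assms)
  show "f \<zero>\<^bsub>V\<^esub> = \<zero>\<^bsub>W\<^esub>" "x \<in> carrier V \<Longrightarrow> f (\<ominus>\<^bsub>V\<^esub> x) = \<ominus>\<^bsub>W\<^esub> f x"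
    "\<lbrakk>x \<in> carrier V; y \<in> carrier V\<rbrakk> \<Longrightarrow> f (x \<ominus>\<^bsub>V\<^esub> y) = f x \<ominus>\<^bsub>W\<^esub> f y"
    by simp_all
qed

lemma functional_eqs:
  assumes "f \<in> module_hom K V (ground_space K)"
  shows functional_zero: "f \<zero>\<^bsub>V\<^esub> = \<zero>\<^bsub>K\<^esub>"
    and functional_neg: "x \<in> carrier V \<Longrightarrow> f (\<ominus>\<^bsub>V\<^esub> x) = \<ominus>\<^bsub>K\<^esub> f x"
    and functional_minus: "\<lbrakk>x \<in> carrier V; y \<in> carrier V\<rbrakk> \<Longrightarrow> f (x \<ominus>\<^bsub>V\<^esub> y) = f x \<ominus>\<^bsub>K\<^esub> f y"
  using module_hom_eqs[OF assms vectorspace.axioms(1)[OF ground_space_is_vs]] by simp_all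

text \<open>In the induction step, if \<open>f\<close> is nonzero at some \<open>w\<close> in the joint kernel of \<open>S\<close>, normalised to
  \<open>f w = \<one>\<close>, then \<open>\<phi> - \<phi> w f\<close> vanishes on that kernel.\<close>

lemma functional_in_subspace:
  assumes "finite S" "submodule K P (dual_space K V)" "S \<subseteq> P" "\<phi> \<in> carrier (dual_space K V)"
    and "\<And>v. \<lbrakk>v \<in> carrier V; \<And>f. f \<in> S \<Longrightarrow> f v = \<zero>\<^bsub>K\<^esub>\<rbrakk> \<Longrightarrow> \<phi> v = \<zero>\<^bsub>K\<^esub>"
  shows "\<phi> \<in> P"
  using assms
proof (induction S arbitrary: \<phi> rule: finite_induct)
  case empty
  interpret P: submodule K P "dual_space K V" by fact
  have "\<phi> = \<zero>\<^bsub>dual_space K V\<^esub>"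
    using empty by (auto simp: fun_eq_iff extensional_def)
  then show ?case using P.zero_closed by (simp only:)
next
  case (insert f S)
  interpret P: submodule K P "dual_space K V" by fact
  interpret D: vectorspace K "dual_space K V" by (rule dual_space_is_vs)
  have f: "f \<in> P" "f \<in> carrier (dual_space K V)" using insert.prems P.subset by auto
  have fh: "f \<in> module_hom K V (ground_space K)" and ph: "\<phi> \<in> module_hom K V (ground_space K)"
    using f insert.prems by auto
  note cl = module_hom_carrier[OF fh, simplified] module_hom_carrier[OF ph, simplified]
  show ?case
  proof (cases "\<exists>w\<in>carrier V. (\<forall>g\<in>S. g w = \<zero>\<^bsub>K\<^esub>) \<and> f w \<noteq> \<zero>\<^bsub>K\<^esub>")
    case False
    show ?thesis
      proof (rule insert.IH)
      fix v assume v: "v \<in> carrier V" "\<And>g. g \<in> S \<Longrightarrow> g v = \<zero>\<^bsub>K\<^esub>"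
      then have "f v = \<zero>\<^bsub>K\<^esub>" using False by blast
      then show "\<phi> v = \<zero>\<^bsub>K\<^esub>" using v insert.prems(4) by blast
    qed (use insert.prems in auto)
  next
    case True
    then obtain w0 where w0: "w0 \<in> carrier V" "\<And>g. g \<in> S \<Longrightarrow> g w0 = \<zero>\<^bsub>K\<^esub>" "f w0 \<noteq> \<zero>\<^bsub>K\<^esub>" by blast
    have Sh: "g \<in> module_hom K V (ground_space K)" if "g \<in> S" for g
      using that insert.prems(2) P.subset by auto
    define k where "k = inv\<^bsub>K\<^esub> f w0"
    have fw0: "f w0 \<in> Units K" using w0 cl by (simp add: field_Units)
    then have k: "k \<in> carrier K" "k \<otimes>\<^bsub>K\<^esub> f w0 = \<one>\<^bsub>K\<^esub>" by (auto simp: k_def)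
    define w where "w = k \<odot>\<^bsub>V\<^esub> w0"
    have w: "w \<in> carrier V" "f w = \<one>\<^bsub>K\<^esub>" "\<And>g. g \<in> S \<Longrightarrow> g w = \<zero>\<^bsub>K\<^esub>"
      using w0 k R.r_null by (auto simp: w_def module_hom_smult[OF fh] module_hom_smult[OF Sh])
    define c where "c = \<ominus>\<^bsub>K\<^esub> \<phi> w"
    have c: "c \<in> carrier K" using w cl by (simp add: c_def)
    define \<psi> where "\<psi> = \<phi> \<oplus>\<^bsub>dual_space K V\<^esub> (c \<odot>\<^bsub>dual_space K V\<^esub> f)"
    have psi: "\<psi> v = \<phi> v \<oplus>\<^bsub>K\<^esub> (c \<otimes>\<^bsub>K\<^esub> f v)" if "v \<in> carrier V" for v
      using that by (simp add: \<psi>_def)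
    have "\<psi> \<in> P"
    proof (rule insert.IH)
      show "submodule K P (dual_space K V)" "S \<subseteq> P" using insert.prems by auto
      show "\<psi> \<in> carrier (dual_space K V)"
        unfolding \<psi>_def using insert.prems(3) f(2) c by (intro D.a_closed D.smult_closed)
      fix v assume v: "v \<in> carrier V" "\<And>g. g \<in> S \<Longrightarrow> g v = \<zero>\<^bsub>K\<^esub>"
      \<comment> \<open>Correcting \<open>v\<close> along \<open>w\<close> by \<open>f v\<close>
        kills \<open>f\<close> and, since \<open>w\<close> lies in the joint kernel of
        \<open>S\<close>, keeps every \<open>g\<close> in \<open>S\<close> zero. The hypothesis on
        \<open>\<phi>\<close> then applies to \<open>u\<close>.\<close>
      define u where "u = v \<oplus>\<^bsub>V\<^esub> (\<ominus>\<^bsub>K\<^esub> f v) \<odot>\<^bsub>V\<^esub> w"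
      have u: "u \<in> carrier V" using v w cl by (simp add: u_def)
      have "\<phi> u = \<zero>\<^bsub>K\<^esub>"
      proof (rule insert.prems(4)[OF u])
        fix g assume "g \<in> insert f S"
        then show "g u = \<zero>\<^bsub>K\<^esub>"
        proof
          assume "g = f"
          then show ?thesis using v w cl
            by (simp add: u_def module_hom_add[OF fh] module_hom_smult[OF fh] R.r_neg)
        next
          assume g: "g \<in> S"
          have "g v = \<zero>\<^bsub>K\<^esub>" "g w = \<zero>\<^bsub>K\<^esub>" by (rule v(2)[OF g], rule w(3)[OF g])
          then show ?thesis using v(1) w(1) cl
            by (simp add: u_def module_hom_add[OF Sh[OF g]] module_hom_smult[OF Sh[OF g]])
        qed
      qed
      then show "\<psi> v = \<zero>\<^bsub>K\<^esub>" using v(1) w(1) cl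
        by (simp add: psi u_def c_def module_hom_add[OF ph] module_hom_smult[OF ph] R.l_minus)
          (simp add: R.m_comm)
    qed
    then have "\<psi> \<oplus>\<^bsub>dual_space K V\<^esub> ((\<ominus>\<^bsub>K\<^esub> c) \<odot>\<^bsub>dual_space K V\<^esub> f) \<in> P"
      using f c by (intro P.m_closed P.smult_closed) auto
    also have "\<psi> \<oplus>\<^bsub>dual_space K V\<^esub> ((\<ominus>\<^bsub>K\<^esub> c) \<odot>\<^bsub>dual_space K V\<^esub> f) = \<phi>"
      using insert.prems(3) f(2) c cl
      by (auto simp: \<psi>_def fun_eq_iff extensional_def restrict_def R.a_assoc R.l_minus R.r_neg)
    finally show ?thesis .
  qed
qed

text \<open>The kernel of \<open>f\<close> is a submodule that contains \<open>S\<close>.\<close>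

lemma functional_eq_on_span:
  assumes "f \<in> module_hom K V (ground_space K)" "S \<subseteq> carrier V" "\<And>s. s \<in> S \<Longrightarrow> f s = \<zero>\<^bsub>K\<^esub>"
    and "v \<in> span S"
  shows "f v = \<zero>\<^bsub>K\<^esub>"
proof -
  have "submodule K {v \<in> carrier V. f v = \<zero>\<^bsub>K\<^esub>} V"
    by (rule submodule.intro)
      (auto simp: module_axioms module_hom_add[OF assms(1)] module_hom_smult[OF assms(1)] functional_zero[OF assms(1)])
  moreover have "S \<subseteq> {v \<in> carrier V. f v = \<zero>\<^bsub>K\<^esub>}" using assms by auto
  ultimately show ?thesis using span_is_subset assms(4) by blast
qed

text \<open>No dimensions are compared. The functionals \<open>\<beta> x\<close> form a subspace of
  the dual; the finitely many \<open>\<beta> b\<close> with \<open>b\<close> in a spanning set have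
  joint kernel zero by nondegeneracy, so \<open>functional_in_subspace\<close> puts every functional
  into that subspace.\<close>

lemma bilinear_form_represents:
  assumes "fin_dim" and \<beta>: "bilinear_map K V V (ground_space K) \<beta>"
    and nondeg: "\<And>v. \<lbrakk>v \<in> carrier V; \<And>u. u \<in> carrier V \<Longrightarrow> \<beta> u v = \<zero>\<^bsub>K\<^esub>\<rbrakk> \<Longrightarrow> v = \<zero>\<^bsub>V\<^esub>"
    and \<phi>: "\<phi> \<in> module_hom K V (ground_space K)"
  shows "\<exists>x\<in>carrier V. \<forall>v\<in>carrier V. \<beta> x v = \<phi> v"
proof -
  interpret D: vectorspace K "dual_space K V" by (rule dual_space_is_vs)
  obtain B where B: "finite B" "B \<subseteq> carrier V" "span B = carrier V"
    using assms(1) by (auto simp: fin_dim_def)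
  define r where "r x = (\<lambda>v\<in>carrier V. \<beta> x v)" for x
  have hom1: "\<beta> x \<in> module_hom K V (ground_space K)" if "x \<in> carrier V" for x
    using \<beta> that by (auto simp: bilinear_map_def)
  have hom2: "(\<lambda>u. \<beta> u v) \<in> module_hom K V (ground_space K)" if "v \<in> carrier V" for v
    using \<beta> that by (auto simp: bilinear_map_def)
  have r: "r x \<in> carrier (dual_space K V)" if "x \<in> carrier V" for x
    using hom1[OF that] by (auto simp: r_def module_hom_def)
  have "(\<lambda>v\<in>carrier V. \<phi> v) \<in> r ` carrier V"
  proof (rule functional_in_subspace[where S = "r ` B"])
    show "submodule K (r ` carrier V) (dual_space K V)"
    proof (rule submodule.intro)
      have "\<zero>\<^bsub>dual_space K V\<^esub> = r \<zero>\<^bsub>V\<^esub>"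
        by (auto simp: r_def fun_eq_iff functional_zero[OF hom2])
      then show "\<zero>\<^bsub>dual_space K V\<^esub> \<in> r ` carrier V" by blast
    next
      fix f g assume "f \<in> r ` carrier V" "g \<in> r ` carrier V"
      then obtain x y where xy: "f = r x" "g = r y" "x \<in> carrier V" "y \<in> carrier V" by blast
      then have "f \<oplus>\<^bsub>dual_space K V\<^esub> g = r (x \<oplus>\<^bsub>V\<^esub> y)"
        by (auto simp: r_def fun_eq_iff module_hom_add[OF hom2])
      then show "f \<oplus>\<^bsub>dual_space K V\<^esub> g \<in> r ` carrier V" using xy by blast
    next
      fix c f assume c: "c \<in> carrier K" and "f \<in> r ` carrier V"
      then obtain x where x: "f = r x" "x \<in> carrier V" by blast
      then have "c \<odot>\<^bsub>dual_space K V\<^esub> f = r (c \<odot>\<^bsub>V\<^esub> x)"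
        using c by (auto simp: r_def fun_eq_iff module_hom_smult[OF hom2])
      then show "c \<odot>\<^bsub>dual_space K V\<^esub> f \<in> r ` carrier V" using x c by blast
    qed (use r D.module_axioms in auto)
    show "(\<lambda>v\<in>carrier V. \<phi> v) \<in> carrier (dual_space K V)"
      using \<phi> by (auto simp: module_hom_def)
    fix v assume v: "v \<in> carrier V" and "\<And>f. f \<in> r ` B \<Longrightarrow> f v = \<zero>\<^bsub>K\<^esub>"
    then have "\<beta> b v = \<zero>\<^bsub>K\<^esub>" if "b \<in> B" for b
      using that v by (force simp: r_def)
    then have "\<beta> u v = \<zero>\<^bsub>K\<^esub>" if "u \<in> carrier V" for u
      using functional_eq_on_span[OF hom2[OF v] B(2)] that B(3) by simp
    then have "v = \<zero>\<^bsub>V\<^esub>" by (rule nondeg[OF v])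
    then show "(\<lambda>v\<in>carrier V. \<phi> v) v = \<zero>\<^bsub>K\<^esub>" by (simp add: functional_zero[OF \<phi>])
  qed (use B in auto)
  then show ?thesis
    by (force simp: r_def fun_eq_iff restrict_def split: if_splits)
qed

text \<open>The coordinates with respect to a basis. This finite separating family is the source of
  the finite dimension of the dual, of the injection of \<open>V\<close> into \<open>K\<close>, and
  of the separation of points by functionals.\<close>

lemma coordinate_functionals:
  assumes fin_dim
  obtains S where "finite S" "S \<subseteq> carrier (dual_space K V)"
    "\<And>v. \<lbrakk>v \<in> carrier V; \<And>f. f \<in> S \<Longrightarrow> f v = \<zero>\<^bsub>K\<^esub>\<rbrakk> \<Longrightarrow> v = \<zero>\<^bsub>V\<^esub>"
proof -
  obtain B where B: "finite B" "basis B" using finite_basis_exists[OF assms] by blast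
  then have BV: "B \<subseteq> carrier V" by (simp add: basis_def)
  \<comment> \<open>Requiring the coefficients to be extensional on \<open>B\<close> makes the
    family unique, so linearity of \<open>c\<close> follows by exhibiting families with the right
    linear combination.\<close>
  define c where "c v = (THE a. a \<in> B \<rightarrow>\<^sub>E carrier K \<and> lincomb a B = v)" for v
  have ex1: "\<exists>!a. a \<in> B \<rightarrow>\<^sub>E carrier K \<and> lincomb a B = v" if "v \<in> carrier V" for v
    using basis_criterion[OF B(1) BV] B(2) that by blast
  have c: "c v \<in> B \<rightarrow>\<^sub>E carrier K" "lincomb (c v) B = v" if "v \<in> carrier V" for v
    using theI'[OF ex1[OF that]] by (auto simp: c_def)
  have c_eq: "c v = a" if "a \<in> B \<rightarrow>\<^sub>E carrier K" "lincomb a B = v" "v \<in> carrier V" for a v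
    unfolding c_def using that by (intro the1_equality[OF ex1]) auto
  interpret L: linear_map K "func_space B" V "\<lambda>a. lincomb a B"
    by (rule lincomb_is_linear[OF B(1) BV])
  have c_add: "c (v \<oplus>\<^bsub>V\<^esub> w) b = c v b \<oplus>\<^bsub>K\<^esub> c w b"
    if "v \<in> carrier V" "w \<in> carrier V" "b \<in> B" for v w b
  proof -
    have "c (v \<oplus>\<^bsub>V\<^esub> w) = (\<lambda>b\<in>B. c v b \<oplus>\<^bsub>K\<^esub> c w b)"
      using c[OF that(1)] c[OF that(2)] that L.T_add[of "c v" "c w"]
      by (intro c_eq) (auto simp: func_space_def PiE_def Pi_iff)
    then show ?thesis using that by simp
  qed
  have c_smult: "c (k \<odot>\<^bsub>V\<^esub> v) b = k \<otimes>\<^bsub>K\<^esub> c v b"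
    if "v \<in> carrier V" "k \<in> carrier K" "b \<in> B" for v k b
  proof -
    have "c (k \<odot>\<^bsub>V\<^esub> v) = (\<lambda>b\<in>B. k \<otimes>\<^bsub>K\<^esub> c v b)"
      using c[OF that(1)] that L.T_smult[of k "c v"]
      by (intro c_eq) (auto simp: func_space_def PiE_def Pi_iff)
    then show ?thesis using that by simp
  qed
  show thesis
  proof (rule that[of "(\<lambda>b. \<lambda>v\<in>carrier V. c v b) ` B"])
    show "(\<lambda>b. \<lambda>v\<in>carrier V. c v b) ` B \<subseteq> carrier (dual_space K V)"
      using c(1) c_add c_smult by (auto intro!: module_homI simp: PiE_iff)
    fix v assume v: "v \<in> carrier V" and "\<And>f. f \<in> (\<lambda>b. \<lambda>v\<in>carrier V. c v b) ` B \<Longrightarrow> f v = \<zero>\<^bsub>K\<^esub>"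
    then have "c v b = \<zero>\<^bsub>K\<^esub>" if "b \<in> B" for b using that v by force
    then have "lincomb (c v) B = \<zero>\<^bsub>V\<^esub>" using BV by (intro lincomb_zero) auto
    then show "v = \<zero>\<^bsub>V\<^esub>" using c[OF v] by simp
  qed (use B in simp)
qed

text \<open>A finite separating family spans the dual: its joint kernel is zero, so
  \<open>functional_in_subspace\<close> applies with the span as the subspace.\<close>

lemma dual_space_fin_dim:
  assumes fin_dim
  shows "vectorspace.fin_dim K (dual_space K V)"
proof -
  interpret D: vectorspace K "dual_space K V" by (rule dual_space_is_vs)
  obtain S where S: "finite S" "S \<subseteq> carrier (dual_space K V)"
    "\<And>v. \<lbrakk>v \<in> carrier V; \<And>f. f \<in> S \<Longrightarrow> f v = \<zero>\<^bsub>K\<^esub>\<rbrakk> \<Longrightarrow> v = \<zero>\<^bsub>V\<^esub>"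
    using coordinate_functionals[OF assms] by blast
  have "\<phi> \<in> D.span S" if "\<phi> \<in> carrier (dual_space K V)" for \<phi>
  proof (rule functional_in_subspace[OF S(1) D.span_is_submodule[OF S(2)] D.in_own_span[OF S(2)] that])
    fix v assume "v \<in> carrier V" "\<And>f. f \<in> S \<Longrightarrow> f v = \<zero>\<^bsub>K\<^esub>"
    then have "v = \<zero>\<^bsub>V\<^esub>" by (rule S(3))
    then show "\<phi> v = \<zero>\<^bsub>K\<^esub>" using that by (simp add: functional_zero)
  qed
  then show ?thesis unfolding D.fin_dim_def
    using S D.span_is_subset2[OF S(2)] by blast
qed

end

text \<open>Induction on \<open>B\<close>: a function on \<open>insert b B\<close> is its value at
  \<open>b\<close> together with its restriction to \<open>B\<close>, and a bijection of
  \<open>A \<times> A\<close> with \<open>A\<close>, which exists as \<open>A\<close> is infinite,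
  codes the pair in \<open>A\<close>.\<close>

lemma PiE_embeds:
  assumes "finite B" and inf: "infinite A"
  shows "\<exists>f. inj_on f (B \<rightarrow>\<^sub>E A) \<and> f ` (B \<rightarrow>\<^sub>E A) \<subseteq> A"
  using assms(1)
proof (induction B rule: finite_induct)
  case empty
  from inf obtain a where "a \<in> A" by fastforce
  then show ?case by (auto intro!: exI[of _ "\<lambda>_. a"])
next
  case (insert b B)
  then obtain f where f: "inj_on f (B \<rightarrow>\<^sub>E A)" "f ` (B \<rightarrow>\<^sub>E A) \<subseteq> A" by blast
  obtain p where p: "bij_betw p (A \<times> A) A"
    using card_of_Times_same_infinite[OF inf] card_of_ordIso by blast
  have sub: "restrict h B \<in> B \<rightarrow>\<^sub>E A" if "h \<in> insert b B \<rightarrow>\<^sub>E A" for h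
    using that by (auto simp: PiE_iff)
  have "inj_on (\<lambda>h. p (h b, f (restrict h B))) (insert b B \<rightarrow>\<^sub>E A)"
  proof (rule inj_onI)
    fix h k assume h: "h \<in> insert b B \<rightarrow>\<^sub>E A" and k: "k \<in> insert b B \<rightarrow>\<^sub>E A"
      and eq: "p (h b, f (restrict h B)) = p (k b, f (restrict k B))"
    have "h b \<in> A" "k b \<in> A" using h k by (auto simp: PiE_iff)
    moreover have "f (restrict h B) \<in> A" "f (restrict k B) \<in> A"
      using f(2) sub[OF h] sub[OF k] by auto
    ultimately have *: "(h b, f (restrict h B)) = (k b, f (restrict k B))"
      by (intro inj_onD[OF bij_betw_imp_inj_on[OF p] eq]) simp_all
    then have "restrict h B = restrict k B"
      by (intro inj_onD[OF f(1) _ sub[OF h] sub[OF k]]) simp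
    then have "h x = k x" if "x \<in> insert b B" for x
      using * that by (cases "x = b") (auto dest: fun_cong[of _ _ x])
    then show "h = k" using h k by (intro PiE_ext)
  qed
  moreover have "(\<lambda>h. p (h b, f (restrict h B))) ` (insert b B \<rightarrow>\<^sub>E A) \<subseteq> A"
  proof (rule image_subsetI)
    fix h assume h: "h \<in> insert b B \<rightarrow>\<^sub>E A"
    have "(h b, f (restrict h B)) \<in> A \<times> A"
      using h sub[OF h] f(2) by (auto simp: PiE_iff)
    then show "p (h b, f (restrict h B)) \<in> A" by (rule bij_betwE[OF p, rule_format])
  qed
  ultimately show ?case
    by (intro exI[of _ "\<lambda>h. p (h b, f (restrict h B))"] conjI)
qed

text \<open>Evaluating a finite separating family of functionals injects \<open>V\<close> into a
  finite power of \<open>K\<close>, which \<open>PiE_embeds\<close> injects into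
  \<open>K\<close>.\<close>

lemma (in vectorspace) carrier_embeds:
  assumes fin_dim and "infinite (carrier K)"
  shows "\<exists>f. inj_on f (carrier V) \<and> f ` carrier V \<subseteq> carrier K"
proof -
  obtain S where S: "finite S" "S \<subseteq> carrier (dual_space K V)"
    "\<And>v. \<lbrakk>v \<in> carrier V; \<And>f. f \<in> S \<Longrightarrow> f v = \<zero>\<^bsub>K\<^esub>\<rbrakk> \<Longrightarrow> v = \<zero>\<^bsub>V\<^esub>"
    using coordinate_functionals[OF assms(1)] by blast
  obtain g where g: "inj_on g (S \<rightarrow>\<^sub>E carrier K)" "g ` (S \<rightarrow>\<^sub>E carrier K) \<subseteq> carrier K"
    using PiE_embeds[OF S(1) assms(2)] by blast
  define e where "e v = (\<lambda>f\<in>S. f v)" for v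
  have e: "e v \<in> S \<rightarrow>\<^sub>E carrier K" if "v \<in> carrier V" for v
    using that S(2) by (auto simp: e_def module_hom_def)
  have "inj_on e (carrier V)"
  proof (rule inj_onI)
    fix v w assume vw: "v \<in> carrier V" "w \<in> carrier V" and eq: "e v = e w"
    have "v \<ominus>\<^bsub>V\<^esub> w = \<zero>\<^bsub>V\<^esub>"
    proof (rule S(3))
      fix f assume f: "f \<in> S"
      then have h: "f \<in> module_hom K V (ground_space K)" using S(2) by auto
      have "f v = f w" using fun_cong[OF eq, of f] f by (simp add: e_def)
      then show "f (v \<ominus>\<^bsub>V\<^esub> w) = \<zero>\<^bsub>K\<^esub>"
        using vw module_hom_carrier[OF h] by (simp add: functional_minus[OF h] R.minus_eq R.r_neg)
    qed (use vw in simp)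
    then show "v = w" using vw by simp
  qed
  then have "inj_on (g \<circ> e) (carrier V)"
    using g e by (intro comp_inj_on inj_on_subset[OF g(1)]) auto
  then show ?thesis using g(2) e by (intro exI[of _ "g \<circ> e"]) (auto simp: image_subset_iff)
qed

text \<open>\<open>W\<close> is just a record: that \<open>f\<close> preserves its operations and
  its zero is enough to carry the axioms over. The zero is a separate hypothesis because
  \<open>module_hom\<close> yields it only between modules. With \<open>f = id\<close> this changes
  the record around an unchanged space.\<close>

lemma vectorspace_transport:
  assumes "vectorspace K V" and bij: "bij_betw f (carrier V) (carrier W)"
    and f: "f \<in> module_hom K V W" and zero: "f \<zero>\<^bsub>V\<^esub> = \<zero>\<^bsub>W\<^esub>"
  shows "vectorspace K W"
proof -
  interpret vectorspace K V by fact
  have im: "carrier W = f ` carrier V" using bij by (simp add: bij_betw_def)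
  show ?thesis
  proof (rule vs_criteria, goal_cases)
    case 1 then show ?case by (fact field_axioms)
  next
    \<comment> \<open>The goal on additive inverses; the inverse of \<open>f x\<close> is
      \<open>f (\<ominus> x)\<close>.\<close>
    case 4
    show ?case unfolding im
      by (auto simp flip: module_hom_add[OF f] zero intro!: bexI[of _ "\<ominus>\<^bsub>V\<^esub> x" for x] arg_cong[of _ _ f] M.r_neg)
  qed (auto simp: im smult_assoc1 smult_l_distr smult_r_distr M.a_ac
      simp flip: module_hom_add[OF f] module_hom_smult[OF f] zero)
qed

lemma fin_dim_image:
  assumes "vectorspace K V" "vectorspace.fin_dim K V" "vectorspace K W"
    and "f \<in> module_hom K V W" "f ` carrier V = carrier W"
  shows "vectorspace.fin_dim K W"
proof -
  interpret V: vectorspace K V by fact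
  interpret W: vectorspace K W by fact
  interpret linear_map K V W f by unfold_locales (fact assms)
  show ?thesis using assms surj_fin_dim by blast
qed

text \<open>A collision between the multiples of one at \<open>m < n\<close> would make the multiple
  at \<open>n - m\<close> vanish, against characteristic zero.\<close>

lemma (in field_char_zero) infinite_carrier: "infinite (carrier K)"
proof
  assume "finite (carrier K)"
  moreover have "range (\<lambda>n :: nat. [n] \<cdot> \<one>) \<subseteq> carrier K" by auto
  ultimately have "\<not> inj (\<lambda>n :: nat. [n] \<cdot> \<one>)"
    using finite_imageD finite_subset infinite_UNIV_nat by blast
  then obtain m n :: nat where mn: "m < n" "[m] \<cdot> \<one> = [n] \<cdot> \<one>"
    unfolding inj_def by (metis linorder_neqE_nat)
  have "[n] \<cdot> \<one> = ([m] \<cdot> \<one>) \<oplus> ([(n - m)] \<cdot> \<one>)"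
    using mn(1) by (simp add: add.nat_pow_mult)
  then have "[(n - m)] \<cdot> \<one> = \<zero>"
    using mn(2) by simp
  then show False using char_zero[of "n - m"] mn(1) by simp
qed

section \<open>Strongly polarized symplectic Lie algebras\<close>

lemma bilinear_mapI:
  assumes "\<And>u v. \<lbrakk>u \<in> carrier U; v \<in> carrier V\<rbrakk> \<Longrightarrow> f u v \<in> carrier W"
    and "\<And>u v v'. \<lbrakk>u \<in> carrier U; v \<in> carrier V; v' \<in> carrier V\<rbrakk> \<Longrightarrow>
      f u (v \<oplus>\<^bsub>V\<^esub> v') = f u v \<oplus>\<^bsub>W\<^esub> f u v'"
    and "\<And>c u v. \<lbrakk>c \<in> carrier K; u \<in> carrier U; v \<in> carrier V\<rbrakk> \<Longrightarrow>
      f u (c \<odot>\<^bsub>V\<^esub> v) = c \<odot>\<^bsub>W\<^esub> f u v"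
    and "\<And>u u' v. \<lbrakk>u \<in> carrier U; u' \<in> carrier U; v \<in> carrier V\<rbrakk> \<Longrightarrow>
      f (u \<oplus>\<^bsub>U\<^esub> u') v = f u v \<oplus>\<^bsub>W\<^esub> f u' v"
    and "\<And>c u v. \<lbrakk>c \<in> carrier K; u \<in> carrier U; v \<in> carrier V\<rbrakk> \<Longrightarrow>
      f (c \<odot>\<^bsub>U\<^esub> u) v = c \<odot>\<^bsub>W\<^esub> f u v"
  shows "bilinear_map K U V W f"
  unfolding bilinear_map_def using assms by (auto intro!: module_homI)

lemma bilinear_map_homs:
  assumes "bilinear_map K U V W f"
  shows bilinear_map_right: "u \<in> carrier U \<Longrightarrow> f u \<in> module_hom K V W"
    and bilinear_map_left: "v \<in> carrier V \<Longrightarrow> (\<lambda>u. f u v) \<in> module_hom K U W"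
  using assms by (auto simp: bilinear_map_def)

section \<open>Brackets and closed forms\<close>

context lie_algebra
begin

lemmas bracket_right_hom = bilinear_map_right[OF bracket_bilinear]
  and bracket_left_hom = bilinear_map_left[OF bracket_bilinear]

lemma bracket_closed [simp, intro]:
  "\<lbrakk>x \<in> carrier L; y \<in> carrier L\<rbrakk> \<Longrightarrow> bracket L x y \<in> carrier L"
  by (rule module_hom_carrier[OF bracket_right_hom])

lemmas bracket_linear =
  module_hom_add[OF bracket_right_hom] module_hom_add[OF bracket_left_hom]
  module_hom_smult[OF bracket_right_hom] module_hom_smult[OF bracket_left_hom]
  module_hom_neg[OF bracket_right_hom module_axioms] module_hom_neg[OF bracket_left_hom module_axioms]
  module_hom_minus[OF bracket_right_hom module_axioms] module_hom_minus[OF bracket_left_hom module_axioms]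
  module_hom_zero[OF bracket_right_hom module_axioms] module_hom_zero[OF bracket_left_hom module_axioms]

lemma bracket_antisym:
  assumes "x \<in> carrier L" "y \<in> carrier L"
  shows "bracket L y x = \<ominus>\<^bsub>L\<^esub> bracket L x y"
proof -
  have "\<zero>\<^bsub>L\<^esub> = bracket L (x \<oplus>\<^bsub>L\<^esub> y) (x \<oplus>\<^bsub>L\<^esub> y)"
    using assms bracket_alternating by simp
  also have "\<dots> = bracket L x y \<oplus>\<^bsub>L\<^esub> bracket L y x"
    using assms by (simp add: bracket_linear) (simp add: bracket_alternating M.a_comm)
  finally show ?thesis using assms by (intro M.minus_equality[symmetric]) (simp_all add: M.a_comm)
qed

text \<open>The shape of the Jacobi identity that matches flatness of the connection.\<close>

lemma jacobi_derivation:
  assumes "x \<in> carrier L" "y \<in> carrier L" "z \<in> carrier L"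
  shows "bracket L (bracket L x y) z
    = bracket L x (bracket L y z) \<ominus>\<^bsub>L\<^esub> bracket L y (bracket L x z)"
proof -
  have "bracket L (bracket L x y) z = \<ominus>\<^bsub>L\<^esub> bracket L z (bracket L x y)"
    using assms by (simp add: bracket_antisym[of z])
  also have "\<dots> = bracket L x (bracket L y z) \<oplus>\<^bsub>L\<^esub> bracket L y (bracket L z x)"
    using jacobi[OF assms] assms by (intro M.minus_equality) simp_all
  also have "bracket L y (bracket L z x) = \<ominus>\<^bsub>L\<^esub> bracket L y (bracket L x z)"
    using assms by (simp add: bracket_antisym[of x z] bracket_linear)
  finally show ?thesis by (simp add: a_minus_def)
qed

end

context symplectic_lie_algebra
begin

lemmas form_right_hom = bilinear_map_right[OF form_bilinear]
  and form_left_hom = bilinear_map_left[OF form_bilinear]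

lemma form_carrier [simp, intro]:
  "\<lbrakk>x \<in> carrier G; y \<in> carrier G\<rbrakk> \<Longrightarrow> form G x y \<in> carrier K"
  using module_hom_carrier[OF form_right_hom] by simp

lemmas form_linear =
  module_hom_add[OF form_right_hom, simplified] module_hom_add[OF form_left_hom, simplified]
  module_hom_smult[OF form_right_hom, simplified] module_hom_smult[OF form_left_hom, simplified]
  functional_neg[OF form_right_hom] functional_neg[OF form_left_hom]
  functional_minus[OF form_right_hom] functional_minus[OF form_left_hom]
  functional_zero[OF form_right_hom] functional_zero[OF form_left_hom]

lemma form_antisym:
  assumes "x \<in> carrier G" "y \<in> carrier G"
  shows "form G y x = \<ominus>\<^bsub>K\<^esub> form G x y"
proof -
  have "\<zero>\<^bsub>K\<^esub> = form G (x \<oplus>\<^bsub>G\<^esub> y) (x \<oplus>\<^bsub>G\<^esub> y)"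
    using assms form_alternating by simp
  also have "\<dots> = form G x y \<oplus>\<^bsub>K\<^esub> form G y x"
    using assms by (simp add: form_linear) (simp add: form_alternating R.a_comm)
  finally show ?thesis using assms by (intro R.minus_equality[symmetric]) (simp_all add: R.a_comm)
qed

lemma form_eqI:
  assumes "x \<in> carrier G" "y \<in> carrier G" "\<And>z. z \<in> carrier G \<Longrightarrow> form G x z = form G y z"
  shows "x = y"
proof -
  have "x \<ominus>\<^bsub>G\<^esub> y = \<zero>\<^bsub>G\<^esub>"
    using assms by (intro form_nondegenerate) (simp_all add: form_linear R.minus_eq R.r_neg)
  then show ?thesis using assms by simp
qed

text \<open>Nondegeneracy is assumed in the left argument; antisymmetry supplies the version in the
  right argument that \<open>bilinear_form_represents\<close> asks for.\<close>

lemma form_represents: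
  assumes "\<phi> \<in> module_hom K G (ground_space K)"
  shows "\<exists>x\<in>carrier G. \<forall>y\<in>carrier G. form G x y = \<phi> y"
proof -
  have "v = \<zero>\<^bsub>G\<^esub>" if v: "v \<in> carrier G" and 0: "\<And>u. u \<in> carrier G \<Longrightarrow> form G u v = \<zero>\<^bsub>K\<^esub>" for v
    using form_nondegenerate[OF v] form_antisym[OF _ v] 0 by simp
  from bilinear_form_represents[OF finite_dimensional form_bilinear this assms]
  show ?thesis .
qed

text \<open>Closedness solved for one term, with the other two brought to the form \<omega>(x,
  [y, z]). From this shape one reads off that the ideal is abelian and that the connection has no
  torsion.\<close>

lemma form_closed_bracket:
  assumes "u \<in> carrier G" "v \<in> carrier G" "w \<in> carrier G"
  shows "form G (bracket G u v) w
    = form G u (bracket G v w) \<ominus>\<^bsub>K\<^esub> form G v (bracket G u w)"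
proof -
  have 1: "form G (bracket G w u) v = form G v (bracket G u w)"
    using assms by (simp add: bracket_antisym[of u w] form_linear form_antisym[of "bracket G u w" v])
  have 2: "form G (bracket G v w) u = \<ominus>\<^bsub>K\<^esub> form G u (bracket G v w)"
    using assms by (simp add: form_antisym[of u])
  let ?p = "form G (bracket G u v) w" and ?q = "form G v (bracket G u w)"
    and ?r = "form G u (bracket G v w)"
  \<comment> \<open>The first parenthesis is the closedness sum, rewritten by \<open>1\<close> and
    \<open>2\<close>, hence zero.\<close>
  have "?p = (?p \<oplus>\<^bsub>K\<^esub> ?q \<oplus>\<^bsub>K\<^esub> \<ominus>\<^bsub>K\<^esub> ?r) \<oplus>\<^bsub>K\<^esub> (?r \<ominus>\<^bsub>K\<^esub> ?q)"
    using assms form_carrier[of "bracket G u v" w] form_carrier[of v "bracket G u w"]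
      form_carrier[of u "bracket G v w"] by (simp del: form_carrier) algebra
  then show ?thesis
    using form_closed[OF assms] assms unfolding 1 2 by simp
qed

end

section \<open>Pairing with the two Lagrangian summands\<close>

context strongly_polarized
begin

lemma ideal_closed: "a \<in> lag_ideal G \<Longrightarrow> a \<in> carrier G"
  and complement_closed: "n \<in> lag_complement G \<Longrightarrow> n \<in> carrier G"
  using ideal_lagrangian complement_lagrangian
  by (auto simp: lagrangian_def form_orthogonal_def)

lemma submodule_lag_ideal: "submodule K (lag_ideal G) G"
  and submodule_lag_complement: "submodule K (lag_complement G) G"
  using ideal_lagrangian complement_lagrangian by (auto simp: lagrangian_def subspace_def)

lemmas ideal_submodule_closed = submodule.m_closed[OF submodule_lag_ideal]
  submodule.smult_closed[OF submodule_lag_ideal] submodule.zero_closed[OF submodule_lag_ideal]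
lemmas complement_submodule_closed = submodule.m_closed[OF submodule_lag_complement]
  submodule.smult_closed[OF submodule_lag_complement] submodule.zero_closed[OF submodule_lag_complement]

lemma form_ideal_ideal: "\<lbrakk>a \<in> lag_ideal G; b \<in> lag_ideal G\<rbrakk> \<Longrightarrow> form G a b = \<zero>\<^bsub>K\<^esub>"
  and form_complement_complement:
    "\<lbrakk>m \<in> lag_complement G; n \<in> lag_complement G\<rbrakk> \<Longrightarrow> form G m n = \<zero>\<^bsub>K\<^esub>"
  using ideal_lagrangian complement_lagrangian
  by (auto simp: lagrangian_def form_orthogonal_def)

lemma in_idealI:
  "\<lbrakk>x \<in> carrier G; \<And>a. a \<in> lag_ideal G \<Longrightarrow> form G x a = \<zero>\<^bsub>K\<^esub>\<rbrakk> \<Longrightarrow> x \<in> lag_ideal G"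
  and in_complementI:
    "\<lbrakk>x \<in> carrier G; \<And>n. n \<in> lag_complement G \<Longrightarrow> form G x n = \<zero>\<^bsub>K\<^esub>\<rbrakk> \<Longrightarrow> x \<in> lag_complement G"
  using ideal_lagrangian complement_lagrangian
  by (auto simp: lagrangian_def form_orthogonal_def)

lemma decomposition:
  assumes "x \<in> carrier G"
  obtains a n where "a \<in> lag_ideal G" "n \<in> lag_complement G" "x = a \<oplus>\<^bsub>G\<^esub> n"
  using assms sum_carrier that unfolding set_add_def' by blast

text \<open>As the two summands span \<open>G\<close>, nondegeneracy may be tested on each of them
  separately. For vectors of the isotropic complement the second test is void, which gives
  \<open>complement_eqI\<close>.\<close>

lemma form_eqI_polarized:
  assumes x: "x \<in> carrier G" and y: "y \<in> carrier G"
    and a: "\<And>a. a \<in> lag_ideal G \<Longrightarrow> form G x a = form G y a"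
    and n: "\<And>n. n \<in> lag_complement G \<Longrightarrow> form G x n = form G y n"
  shows "x = y"
proof (rule form_eqI[OF x y])
  fix z assume "z \<in> carrier G"
  then obtain b m where "b \<in> lag_ideal G" "m \<in> lag_complement G" "z = b \<oplus>\<^bsub>G\<^esub> m"
    by (rule decomposition)
  then show "form G x z = form G y z"
    using x y by (simp add: form_linear ideal_closed complement_closed a n)
qed

lemma complement_eqI:
  assumes "m \<in> lag_complement G" "n \<in> lag_complement G"
    and "\<And>a. a \<in> lag_ideal G \<Longrightarrow> form G m a = form G n a"
  shows "m = n"
  using assms by (intro form_eqI_polarized) (simp_all add: complement_closed form_complement_complement)

text \<open>The vector \<open>n\<close> is the complement component of \<open>x\<close>: the ideal
  component is invisible to the ideal, which is isotropic.\<close>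

lemma complement_part:
  assumes "x \<in> carrier G"
  shows "\<exists>n\<in>lag_complement G. \<forall>a\<in>lag_ideal G. form G n a = form G x a"
proof -
  obtain b n where "b \<in> lag_ideal G" "n \<in> lag_complement G" "x = b \<oplus>\<^bsub>G\<^esub> n"
    using assms by (rule decomposition)
  then show ?thesis
    by (intro bexI[of _ n]) (simp_all add: form_linear ideal_closed complement_closed form_ideal_ideal)
qed

lemma bracket_ideal_right: "\<lbrakk>x \<in> carrier G; a \<in> lag_ideal G\<rbrakk> \<Longrightarrow> bracket G x a \<in> lag_ideal G"
  using ideal by (auto simp: lie_ideal_def)

lemma bracket_ideal_left: "\<lbrakk>a \<in> lag_ideal G; x \<in> carrier G\<rbrakk> \<Longrightarrow> bracket G a x \<in> lag_ideal G"
  using bracket_ideal_right[of x a] bracket_antisym[of x a] ideal_submodule_closed(2)[of "\<ominus>\<^bsub>K\<^esub> \<one>\<^bsub>K\<^esub>"]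
    ideal_closed by (simp add: smult_minus_1)

text \<open>\<open>form_closed_bracket\<close> turns \<omega>([a, b], z) into values of \<omega> on
  pairs of ideal elements, and these vanish.\<close>

lemma ideal_abelian:
  assumes "a \<in> lag_ideal G" "b \<in> lag_ideal G"
  shows "bracket G a b = \<zero>\<^bsub>G\<^esub>"
proof (rule form_eqI)
  fix z assume "z \<in> carrier G"
  then show "form G (bracket G a b) z = form G \<zero>\<^bsub>G\<^esub> z"
    using assms
    by (simp add: ideal_closed form_linear form_closed_bracket form_ideal_ideal bracket_ideal_left R.minus_eq)
qed (use assms ideal_closed in auto)

text \<open>With the converse \<open>form_ideal_congD\<close>, the pairings with the ideal become a
  complete invariant of the class modulo the ideal: one direction is isotropy, the other that the
  ideal contains its orthogonal.\<close>

lemma form_ideal_cong: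
  assumes "x \<in> carrier G" "y \<in> carrier G" "x \<ominus>\<^bsub>G\<^esub> y \<in> lag_ideal G" "a \<in> lag_ideal G"
  shows "form G x a = form G y a"
proof -
  have "form G x a \<ominus>\<^bsub>K\<^esub> form G y a = \<zero>\<^bsub>K\<^esub>"
    using assms form_ideal_ideal[OF assms(3,4)] by (simp add: form_linear ideal_closed)
  then show ?thesis using assms by (simp add: ideal_closed)
qed

lemma form_ideal_congD:
  assumes "x \<in> carrier G" "y \<in> carrier G" "\<And>a. a \<in> lag_ideal G \<Longrightarrow> form G x a = form G y a"
  shows "x \<ominus>\<^bsub>G\<^esub> y \<in> lag_ideal G"
  using assms by (intro in_idealI) (simp_all add: form_linear ideal_closed R.minus_eq R.r_neg)

end

text \<open>Subtraction is not a field of the record \<open>dual_space\<close>; writing it with the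
  scalar minus one makes it computable pointwise.\<close>

lemma (in vectorspace) dual_space_minus:
  assumes "f \<in> carrier (dual_space K V)" "g \<in> carrier (dual_space K V)" "v \<in> carrier V"
  shows "(f \<ominus>\<^bsub>dual_space K V\<^esub> g) v = f v \<ominus>\<^bsub>K\<^esub> g v"
proof -
  interpret D: vectorspace K "dual_space K V" by (rule dual_space_is_vs)
  have "f \<ominus>\<^bsub>dual_space K V\<^esub> g = f \<oplus>\<^bsub>dual_space K V\<^esub> (\<ominus>\<^bsub>K\<^esub> \<one>\<^bsub>K\<^esub>) \<odot>\<^bsub>dual_space K V\<^esub> g"
    using assms(2) by (simp only: D.minus_eq D.smult_minus_1)
  then show ?thesis
    using assms module_hom_carrier[of f K V "ground_space K" v]
      module_hom_carrier[of g K V "ground_space K" v]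
    by (simp add: R.minus_eq R.l_minus)
qed

lemma dual_representation_apply:
  "w \<in> carrier H \<Longrightarrow> dual_representation K H u \<xi> w = \<ominus>\<^bsub>K\<^esub> \<xi> (conn H u w)"
  by (simp add: dual_representation_def)

text \<open>Both cocycle conditions are equations in the dual. Once \<rho> is known to preserve the
  dual, all terms are extensional functionals and can be compared value by value, which leaves
  identities between scalars.\<close>

lemma ce_two_cocycles_dual_iff:
  fixes H :: "('k, 'b, 'x) flat_alg_scheme"
  assumes "vectorspace K H"
    and br: "\<And>u v. \<lbrakk>u \<in> carrier H; v \<in> carrier H\<rbrakk> \<Longrightarrow> bracket H u v \<in> carrier H"
    and conn: "bilinear_map K H H H (conn H)"
    and \<alpha>: "bilinear_map K H H (dual_space K H) \<alpha>"
  shows "\<alpha> \<in> ce_two_cocycles K H (dual_space K H) (dual_representation K H) \<longleftrightarrow>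
    (\<forall>u\<in>carrier H. \<forall>w\<in>carrier H. \<alpha> u u w = \<zero>\<^bsub>K\<^esub>) \<and>
    (\<forall>u\<in>carrier H. \<forall>v\<in>carrier H. \<forall>w\<in>carrier H. \<forall>t\<in>carrier H.
      (\<ominus>\<^bsub>K\<^esub> \<alpha> v w (conn H u t)) \<ominus>\<^bsub>K\<^esub> (\<ominus>\<^bsub>K\<^esub> \<alpha> u w (conn H v t)) \<oplus>\<^bsub>K\<^esub> (\<ominus>\<^bsub>K\<^esub> \<alpha> u v (conn H w t))
        \<ominus>\<^bsub>K\<^esub> \<alpha> (bracket H u v) w t \<oplus>\<^bsub>K\<^esub> \<alpha> (bracket H u w) v t \<ominus>\<^bsub>K\<^esub> \<alpha> (bracket H v w) u t = \<zero>\<^bsub>K\<^esub>)"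
proof -
  interpret H: vectorspace K H by fact
  interpret D: vectorspace K "dual_space K H" by (rule H.dual_space_is_vs)
  let ?D = "dual_space K H" and ?\<rho> = "dual_representation K H"
  have mem: "\<alpha> u v \<in> carrier ?D" if "u \<in> carrier H" "v \<in> carrier H" for u v
    by (rule module_hom_carrier[OF bilinear_map_right[OF \<alpha> that(1)] that(2)])
  have rho: "?\<rho> u \<xi> \<in> carrier ?D" if u: "u \<in> carrier H" and "\<xi> \<in> carrier ?D" for u \<xi>
  proof -
    have \<xi>: "\<xi> \<in> module_hom K H (ground_space K)" using that by simp
    note c = bilinear_map_right[OF conn u]
    show ?thesis
      using module_hom_carrier[OF c] module_hom_carrier[OF \<xi>]
      by (auto intro!: module_homI simp: dual_representation_def module_hom_add[OF c]
          module_hom_add[OF \<xi>] module_hom_smult[OF c] module_hom_smult[OF \<xi>]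
          H.R.minus_add H.R.r_minus)
  qed
  have ev: "f = \<zero>\<^bsub>?D\<^esub> \<longleftrightarrow> (\<forall>t\<in>carrier H. f t = \<zero>\<^bsub>K\<^esub>)" if "f \<in> carrier ?D" for f
    using that by (auto simp: fun_eq_iff extensional_def)
  have 1: "\<alpha> u u = \<zero>\<^bsub>?D\<^esub> \<longleftrightarrow> (\<forall>w\<in>carrier H. \<alpha> u u w = \<zero>\<^bsub>K\<^esub>)" if "u \<in> carrier H" for u
    using ev mem that by blast
  have add: "(f \<oplus>\<^bsub>?D\<^esub> g) t = f t \<oplus>\<^bsub>K\<^esub> g t" if "t \<in> carrier H" for f g t
    using that by simp
  note mems = mem rho br D.a_closed D.minus_closed
  have 2: "?\<rho> u (\<alpha> v w) \<ominus>\<^bsub>?D\<^esub> ?\<rho> v (\<alpha> u w) \<oplus>\<^bsub>?D\<^esub> ?\<rho> w (\<alpha> u v)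
        \<ominus>\<^bsub>?D\<^esub> \<alpha> (bracket H u v) w \<oplus>\<^bsub>?D\<^esub> \<alpha> (bracket H u w) v
        \<ominus>\<^bsub>?D\<^esub> \<alpha> (bracket H v w) u = \<zero>\<^bsub>?D\<^esub> \<longleftrightarrow>
    (\<forall>t\<in>carrier H.
      (\<ominus>\<^bsub>K\<^esub> \<alpha> v w (conn H u t)) \<ominus>\<^bsub>K\<^esub> (\<ominus>\<^bsub>K\<^esub> \<alpha> u w (conn H v t)) \<oplus>\<^bsub>K\<^esub> (\<ominus>\<^bsub>K\<^esub> \<alpha> u v (conn H w t))
        \<ominus>\<^bsub>K\<^esub> \<alpha> (bracket H u v) w t \<oplus>\<^bsub>K\<^esub> \<alpha> (bracket H u w) v t \<ominus>\<^bsub>K\<^esub> \<alpha> (bracket H v w) u t = \<zero>\<^bsub>K\<^esub>)"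
    if uvw: "u \<in> carrier H" "v \<in> carrier H" "w \<in> carrier H" for u v w
  proof (subst ev)
    show "?\<rho> u (\<alpha> v w) \<ominus>\<^bsub>?D\<^esub> ?\<rho> v (\<alpha> u w) \<oplus>\<^bsub>?D\<^esub> ?\<rho> w (\<alpha> u v)
        \<ominus>\<^bsub>?D\<^esub> \<alpha> (bracket H u v) w \<oplus>\<^bsub>?D\<^esub> \<alpha> (bracket H u w) v
        \<ominus>\<^bsub>?D\<^esub> \<alpha> (bracket H v w) u \<in> carrier ?D"
      by (intro mems uvw)
  qed (intro ball_cong refl, simp only: mems uvw H.dual_space_minus add dual_representation_apply)
  show ?thesis
    unfolding ce_two_cocycles_def using \<alpha> 1 2 by (simp cong: ball_cong)
qed

text \<open>\<open>l\<close> identifies \<open>H\<close> with the Lagrangian complement, and the structure of \<open>H\<close> is that of the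
  extension triple. Instead of projecting a bracket to the two summands of \<open>G\<close>, one pairs it with
  the complementary summand.\<close>

locale extension_model = strongly_polarized K G + H: vectorspace K H
  for K :: "('k, 'm) ring_scheme" and G :: "('k, 'a) polarized_alg"
    and H :: "('k, 'b) flat_cocycle_alg" +
  fixes l :: "'b \<Rightarrow> 'a"
  assumes l_hom: "l \<in> module_hom K H G"
    and l_bij: "bij_betw l (carrier H) (lag_complement G)"
    and model_bracket_closed:
      "\<lbrakk>u \<in> carrier H; v \<in> carrier H\<rbrakk> \<Longrightarrow> bracket H u v \<in> carrier H"
    and model_conn_closed:
      "\<lbrakk>u \<in> carrier H; v \<in> carrier H\<rbrakk> \<Longrightarrow> conn H u v \<in> carrier H"
    and model_bracket: "\<lbrakk>u \<in> carrier H; v \<in> carrier H; a \<in> lag_ideal G\<rbrakk> \<Longrightarrow>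
      form G (l (bracket H u v)) a = form G (bracket G (l u) (l v)) a"
    and model_conn: "\<lbrakk>u \<in> carrier H; v \<in> carrier H; a \<in> lag_ideal G\<rbrakk> \<Longrightarrow>
      form G (l (conn H u v)) a = \<ominus>\<^bsub>K\<^esub> form G (l v) (bracket G (l u) a)"
    and model_cocycle: "\<lbrakk>u \<in> carrier H; v \<in> carrier H; w \<in> carrier H\<rbrakk> \<Longrightarrow>
      cocycle H u v w = form G (bracket G (l u) (l v)) (l w)"
    and model_cocycle_extensional:
      "\<lbrakk>u \<in> carrier H; v \<in> carrier H\<rbrakk> \<Longrightarrow> cocycle H u v \<in> extensional (carrier H)"
begin

section \<open>The structure induced on \<open>H\<close> is flat with a symplectic cocycle\<close>

lemma l_complement: "u \<in> carrier H \<Longrightarrow> l u \<in> lag_complement G"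
  using l_bij by (auto simp: bij_betw_def)

lemma l_closed: "u \<in> carrier H \<Longrightarrow> l u \<in> carrier G"
  by (simp add: l_complement complement_closed)

lemma l_surj:
  assumes "n \<in> lag_complement G"
  obtains u where "u \<in> carrier H" "n = l u"
  using assms l_bij by (auto simp: bij_betw_def)

lemmas l_linear = module_hom_add[OF l_hom] module_hom_smult[OF l_hom]
  H.module_hom_zero[OF l_hom module_axioms] H.module_hom_neg[OF l_hom module_axioms]
  H.module_hom_minus[OF l_hom module_axioms]

lemma model_eqI:
  assumes "u \<in> carrier H" "v \<in> carrier H"
    and "\<And>a. a \<in> lag_ideal G \<Longrightarrow> form G (l u) a = form G (l v) a"
  shows "u = v"
proof -
  have "l u = l v" by (rule complement_eqI) (use assms l_complement in auto)
  then show ?thesis using l_bij assms by (auto simp: bij_betw_def dest: inj_onD)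
qed

lemma form_l_l: "\<lbrakk>u \<in> carrier H; v \<in> carrier H\<rbrakk> \<Longrightarrow> form G (l u) (l v) = \<zero>\<^bsub>K\<^esub>"
  by (simp add: form_complement_complement l_complement)

lemma G_decomposition:
  assumes "x \<in> carrier G"
  obtains a u where "a \<in> lag_ideal G" "u \<in> carrier H" "x = a \<oplus>\<^bsub>G\<^esub> l u"
  using decomposition[OF assms] l_surj by metis

text \<open>The quotient map of \<open>G\<close> by the ideal, read in \<open>H\<close>. Describing
  it by pairings rather than through a decomposition of \<open>x\<close> makes linearity a matter of
  uniqueness.\<close>

definition proj :: "'a \<Rightarrow> 'b" where
  "proj x = (THE u. u \<in> carrier H \<and> (\<forall>a\<in>lag_ideal G. form G (l u) a = form G x a))"

lemma proj:
  assumes "x \<in> carrier G"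
  shows proj_closed: "proj x \<in> carrier H"
    and form_proj: "a \<in> lag_ideal G \<Longrightarrow> form G (l (proj x)) a = form G x a"
proof -
  obtain n where "n \<in> lag_complement G" "\<And>a. a \<in> lag_ideal G \<Longrightarrow> form G n a = form G x a"
    using complement_part[OF assms] by blast
  then have "\<exists>!u. u \<in> carrier H \<and> (\<forall>a\<in>lag_ideal G. form G (l u) a = form G x a)"
    by (metis l_surj model_eqI)
  from theI'[OF this] show "proj x \<in> carrier H"
    "a \<in> lag_ideal G \<Longrightarrow> form G (l (proj x)) a = form G x a"
    by (auto simp: proj_def)
qed

lemma proj_eqI:
  assumes "x \<in> carrier G" "u \<in> carrier H"
    and "\<And>a. a \<in> lag_ideal G \<Longrightarrow> form G (l u) a = form G x a"
  shows "proj x = u"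
  by (rule model_eqI) (use assms proj in auto)

lemma proj_l: "u \<in> carrier H \<Longrightarrow> proj (l u) = u"
  by (rule proj_eqI) (auto simp: l_closed)

lemma proj_hom: "proj \<in> module_hom K G H"
  by (rule module_homI)
    (auto intro!: proj_eqI simp: proj_closed l_linear form_linear l_closed ideal_closed form_proj)

text \<open>\<open>proj\<close> maps the finite-dimensional \<open>G\<close> onto \<open>H\<close>,
  because \<open>proj (l u) = u\<close>.\<close>

lemma model_fin_dim: "H.fin_dim"
  by (rule fin_dim_image[OF vectorspace_axioms finite_dimensional H.vectorspace_axioms proj_hom])
    (force simp: proj_closed l_closed proj_l intro: rev_image_eqI[OF l_closed])

text \<open>\<open>l\<close> preserves brackets only modulo the ideal. Since the ideal is stable
  under brackets and isotropic, such an error stays invisible to pairings with the ideal, so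
  \<open>l (bracket H v w)\<close> may be replaced by the bracket in \<open>G\<close> inside another
  bracket.\<close>

lemma bracket_ideal_cong:
  assumes "x \<in> carrier G" "y \<in> carrier G" "z \<in> carrier G" "a \<in> lag_ideal G"
    and "\<And>a. a \<in> lag_ideal G \<Longrightarrow> form G y a = form G z a"
  shows "form G (bracket G x y) a = form G (bracket G x z) a"
    and "form G (bracket G y x) a = form G (bracket G z x) a"
proof -
  have "y \<ominus>\<^bsub>G\<^esub> z \<in> lag_ideal G" using assms by (intro form_ideal_congD) auto
  then have "bracket G x y \<ominus>\<^bsub>G\<^esub> bracket G x z \<in> lag_ideal G"
    "bracket G y x \<ominus>\<^bsub>G\<^esub> bracket G z x \<in> lag_ideal G"
    using assms bracket_ideal_right[of x "y \<ominus>\<^bsub>G\<^esub> z"] bracket_ideal_left[of "y \<ominus>\<^bsub>G\<^esub> z" x]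
    by (simp_all add: bracket_linear)
  then show "form G (bracket G x y) a = form G (bracket G x z) a"
    "form G (bracket G y x) a = form G (bracket G z x) a"
    using assms by (auto intro!: form_ideal_cong)
qed

lemmas model_closed = model_bracket_closed model_conn_closed l_closed ideal_closed
lemmas model_simps = model_closed model_bracket model_conn l_linear form_linear bracket_linear

lemma model_bracket_bilinear: "bilinear_map K H H H (bracket H)"
  by (rule bilinear_mapI) (auto intro!: model_eqI simp: model_simps)

lemma model_conn_bilinear: "bilinear_map K H H H (conn H)"
  by (rule bilinear_mapI)
    (auto intro!: model_eqI simp: model_simps R.minus_add R.r_minus)

lemma model_lie_algebra: "lie_algebra K H"
proof (unfold_locales)
  show "H.fin_dim" by (rule model_fin_dim)
  show "bilinear_map K H H H (bracket H)" by (rule model_bracket_bilinear)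
  fix x assume "x \<in> carrier H"
  then show "bracket H x x = \<zero>\<^bsub>H\<^esub>"
    by (intro model_eqI) (simp_all add: model_simps bracket_alternating)
next
  fix x y z assume xyz: "x \<in> carrier H" "y \<in> carrier H" "z \<in> carrier H"
  have nested: "form G (l (bracket H u (bracket H v w))) a
      = form G (bracket G (l u) (bracket G (l v) (l w))) a"
    if "u \<in> carrier H" "v \<in> carrier H" "w \<in> carrier H" "a \<in> lag_ideal G" for u v w a
    using that bracket_ideal_cong(1)[of "l u" "l (bracket H v w)" "bracket G (l v) (l w)" a]
    by (simp add: model_closed model_bracket)
  show "bracket H x (bracket H y z) \<oplus>\<^bsub>H\<^esub> bracket H y (bracket H z x)
      \<oplus>\<^bsub>H\<^esub> bracket H z (bracket H x y) = \<zero>\<^bsub>H\<^esub>"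
  proof (rule model_eqI)
    fix a assume a: "a \<in> lag_ideal G"
    have "form G (l (bracket H x (bracket H y z) \<oplus>\<^bsub>H\<^esub> bracket H y (bracket H z x)
      \<oplus>\<^bsub>H\<^esub> bracket H z (bracket H x y))) a
      = form G (bracket G (l x) (bracket G (l y) (l z)) \<oplus>\<^bsub>G\<^esub> bracket G (l y) (bracket G (l z) (l x))
      \<oplus>\<^bsub>G\<^esub> bracket G (l z) (bracket G (l x) (l y))) a"
      using xyz a by (simp add: model_closed l_linear form_linear nested)
    then show "form G (l (bracket H x (bracket H y z) \<oplus>\<^bsub>H\<^esub> bracket H y (bracket H z x)
      \<oplus>\<^bsub>H\<^esub> bracket H z (bracket H x y))) a = form G (l \<zero>\<^bsub>H\<^esub>) a"
      using xyz a jacobi by (simp add: l_closed l_linear)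
  qed (use xyz model_closed in auto)
qed

text \<open>Through the pairing the connection is the negative transpose of the action of the
  complement on the ideal. Vanishing torsion is then closedness of \<omega> with one argument in the
  ideal, and flatness is the Jacobi identity with one entry in the ideal.\<close>

lemma model_flat: "flat_lie_algebra K H"
proof -
  interpret H: lie_algebra K H by (rule model_lie_algebra)
  show ?thesis
  proof unfold_locales
    show "bilinear_map K H H H (conn H)" by (rule model_conn_bilinear)
    fix u v assume uv: "u \<in> carrier H" "v \<in> carrier H"
    show "conn H u v \<ominus>\<^bsub>H\<^esub> conn H v u = bracket H u v"
    proof (rule model_eqI)
      fix a assume "a \<in> lag_ideal G"
      then show "form G (l (conn H u v \<ominus>\<^bsub>H\<^esub> conn H v u)) a = form G (l (bracket H u v)) a"
        using uv form_carrier[of "l u" "bracket G (l v) a"] form_carrier[of "l v" "bracket G (l u) a"]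
        by (simp add: model_simps form_closed_bracket del: form_carrier)
          (simp add: R.minus_eq R.a_comm)
    qed (use uv model_closed in auto)
  next
    fix u v w assume uvw: "u \<in> carrier H" "v \<in> carrier H" "w \<in> carrier H"
    show "conn H u (conn H v w) \<ominus>\<^bsub>H\<^esub> conn H v (conn H u w) = conn H (bracket H u v) w"
    proof (rule model_eqI)
      fix a assume a: "a \<in> lag_ideal G"
      \<comment> \<open>Two transpositions reverse the order of \<open>x\<close> and
        \<open>y\<close>, and their signs cancel.\<close>
      have nested: "form G (l (conn H x (conn H y w))) a
          = form G (l w) (bracket G (l y) (bracket G (l x) a))"
        if "x \<in> carrier H" "y \<in> carrier H" for x y
        using that a uvw by (simp add: model_closed model_conn bracket_ideal_right)
      \<comment> \<open>\<open>l (bracket H u v)\<close> and the bracket in \<open>G\<close> differ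
        by an ideal element, which acts trivially on \<open>a\<close> because the ideal is
        abelian.\<close>
      have "bracket G (l u) (l v) \<ominus>\<^bsub>G\<^esub> l (bracket H u v) \<in> lag_ideal G"
        using uvw by (intro form_ideal_congD) (auto simp: model_closed model_bracket)
      from ideal_abelian[OF this a]
      have "bracket G (l (bracket H u v)) a = bracket G (bracket G (l u) (l v)) a"
        using uvw a by (simp add: bracket_linear model_closed)
      then show "form G (l (conn H u (conn H v w) \<ominus>\<^bsub>H\<^esub> conn H v (conn H u w))) a
          = form G (l (conn H (bracket H u v) w)) a"
        using uvw a
        by (simp add: l_linear model_closed form_linear nested model_conn[of "bracket H u v"]
            jacobi_derivation R.minus_eq R.minus_add)
          (simp add: R.a_comm model_closed)
    qed (use uvw model_closed in auto)
  qed
qed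

text \<open>The cocycle condition is the Jacobi identity of three complement elements, paired with a
  fourth; the symplectic condition is closedness on three complement elements.\<close>

lemma model_flat_with_symplectic_cocycle: "flat_with_symplectic_cocycle K H"
proof -
  interpret H: flat_lie_algebra K H by (rule model_flat)
  have "cocycle H u v \<in> carrier (dual_space K H)" if "u \<in> carrier H" "v \<in> carrier H" for u v
    using that by (auto intro!: module_homI model_cocycle_extensional
        simp: model_cocycle model_simps)
  then have bil: "bilinear_map K H H (dual_space K H) (cocycle H)"
    by (intro bilinear_mapI)
      (auto intro!: extensionalityI[OF model_cocycle_extensional restrict_extensional]
        simp: model_cocycle model_simps)
  \<comment> \<open>Each of the three terms with \<rho> is a nested bracket in \<open>G\<close> up
    to a value of the cocycle, and these extra values cancel the three terms of the condition that
    contain a bracket of \<open>H\<close>.\<close>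
  have key: "\<ominus>\<^bsub>K\<^esub> cocycle H v w (conn H u t)
      = form G (bracket G (l u) (bracket G (l v) (l w))) (l t) \<oplus>\<^bsub>K\<^esub> cocycle H (bracket H v w) u t"
    if "u \<in> carrier H" "v \<in> carrier H" "w \<in> carrier H" "t \<in> carrier H" for u v w t
  proof -
    let ?x = "bracket G (l v) (l w)" and ?y = "l (bracket H v w)"
    \<comment> \<open>The ideal component of the bracket; its complement component \<open>?y\<close>
      pairs to zero with the complement.\<close>
    define c where "c = ?x \<ominus>\<^bsub>G\<^esub> ?y"
    have c: "c \<in> lag_ideal G" unfolding c_def
      using that by (intro form_ideal_congD) (auto simp: model_closed model_bracket)
    have "\<ominus>\<^bsub>K\<^esub> cocycle H v w (conn H u t) = \<ominus>\<^bsub>K\<^esub> form G c (l (conn H u t))"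
      using that by (simp add: model_cocycle c_def form_linear model_closed form_l_l R.minus_eq)
    also have "\<dots> = form G (l (conn H u t)) c"
      using that c by (simp add: form_antisym[of c] model_closed)
    also have "\<dots> = form G (bracket G (l u) c) (l t)"
      using that c by (simp add: model_conn form_antisym[of "l t"] model_closed)
    also have "\<dots> = form G (bracket G (l u) ?x) (l t) \<oplus>\<^bsub>K\<^esub> form G (bracket G ?y (l u)) (l t)"
      using that by (simp add: c_def bracket_linear form_linear model_closed R.minus_eq
          bracket_antisym[of "l u" ?y])
    finally show ?thesis using that by (simp add: model_cocycle model_closed)
  qed
  have alt: "cocycle H u u w = \<zero>\<^bsub>K\<^esub>" if "u \<in> carrier H" "w \<in> carrier H" for u w
    using that by (simp add: model_cocycle bracket_alternating form_linear l_closed)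
  have "cocycle H \<in> ce_two_cocycles K H (dual_space K H) (dual_representation K H)"
  proof (rule iffD2[OF ce_two_cocycles_dual_iff], goal_cases)
    \<comment> \<open>The scalar identities; the other goals are the hypotheses of the
      criterion.\<close>
    case 5
    show ?case
    proof (intro conjI ballI)
    fix u v w t assume uvwt: "u \<in> carrier H" "v \<in> carrier H" "w \<in> carrier H" "t \<in> carrier H"
    let ?J = "\<lambda>x y z. form G (bracket G (l x) (bracket G (l y) (l z))) (l t)"
    let ?c = "\<lambda>x y z. cocycle H (bracket H x y) z t"
    have cl: "?J u v w \<in> carrier K" "?J v u w \<in> carrier K" "?J w u v \<in> carrier K"
      "?c v w u \<in> carrier K" "?c u w v \<in> carrier K" "?c u v w \<in> carrier K"
      using uvwt by (simp_all add: model_cocycle model_closed)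
    have "?J v w u = \<ominus>\<^bsub>K\<^esub> ?J v u w"
      using uvwt by (simp add: bracket_antisym[of "l u" "l w"] form_linear bracket_linear l_closed)
    then have J: "?J u v w \<oplus>\<^bsub>K\<^esub> (\<ominus>\<^bsub>K\<^esub> ?J v u w) \<oplus>\<^bsub>K\<^esub> ?J w u v = \<zero>\<^bsub>K\<^esub>"
      using arg_cong[OF jacobi[of "l u" "l v" "l w"], of "\<lambda>x. form G x (l t)"] uvwt
      by (simp add: form_linear l_closed)
    \<comment> \<open>The left side is the cocycle condition after rewriting with
      \<open>key\<close>; its six cocycle values cancel in pairs.\<close>
    have "(?J u v w \<oplus>\<^bsub>K\<^esub> ?c v w u) \<ominus>\<^bsub>K\<^esub> (?J v u w \<oplus>\<^bsub>K\<^esub> ?c u w v) \<oplus>\<^bsub>K\<^esub> (?J w u v \<oplus>\<^bsub>K\<^esub> ?c u v w)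
        \<ominus>\<^bsub>K\<^esub> ?c u v w \<oplus>\<^bsub>K\<^esub> ?c u w v \<ominus>\<^bsub>K\<^esub> ?c v w u
      = ?J u v w \<oplus>\<^bsub>K\<^esub> (\<ominus>\<^bsub>K\<^esub> ?J v u w) \<oplus>\<^bsub>K\<^esub> ?J w u v"
      using cl by algebra
    then show "(\<ominus>\<^bsub>K\<^esub> cocycle H v w (conn H u t)) \<ominus>\<^bsub>K\<^esub> (\<ominus>\<^bsub>K\<^esub> cocycle H u w (conn H v t))
        \<oplus>\<^bsub>K\<^esub> (\<ominus>\<^bsub>K\<^esub> cocycle H u v (conn H w t)) \<ominus>\<^bsub>K\<^esub> ?c u v w \<oplus>\<^bsub>K\<^esub> ?c u w v \<ominus>\<^bsub>K\<^esub> ?c v w u = \<zero>\<^bsub>K\<^esub>"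
      using uvwt J by (simp only: key)
    qed (use alt in auto)
  qed (use bil H.vectorspace_axioms model_bracket_closed model_conn_bilinear in auto)
  moreover have "cocycle H u v w \<oplus>\<^bsub>K\<^esub> cocycle H w u v \<oplus>\<^bsub>K\<^esub> cocycle H v w u = \<zero>\<^bsub>K\<^esub>"
    if "u \<in> carrier H" "v \<in> carrier H" "w \<in> carrier H" for u v w
    using that form_closed[of "l u" "l v" "l w"] by (simp add: model_cocycle l_closed)
  ultimately show ?thesis by unfold_locales
qed

end

section \<open>Isomorphisms\<close>

lemma lie_isoD:
  assumes "f \<in> lie_iso K L M"
  shows lie_iso_hom: "f \<in> module_hom K L M"
    and lie_iso_bij: "bij_betw f (carrier L) (carrier M)"
    and lie_iso_bracket:
      "\<lbrakk>x \<in> carrier L; y \<in> carrier L\<rbrakk> \<Longrightarrow> f (bracket L x y) = bracket M (f x) (f y)"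
    and lie_iso_closed: "x \<in> carrier L \<Longrightarrow> f x \<in> carrier M"
  using assms bij_betwE unfolding lie_iso_def by blast+

lemma lie_isoI:
  assumes "f \<in> module_hom K L M" "bij_betw f (carrier L) (carrier M)"
    and "\<And>x y. \<lbrakk>x \<in> carrier L; y \<in> carrier L\<rbrakk> \<Longrightarrow> f (bracket L x y) = bracket M (f x) (f y)"
  shows "f \<in> lie_iso K L M"
  using assms unfolding lie_iso_def by blast

lemma lie_iso_id: "id \<in> lie_iso K L L"
  by (auto simp: lie_iso_def module_hom_def)

lemma lie_iso_comp:
  assumes f: "f \<in> lie_iso K L M" and g: "g \<in> lie_iso K M P"
  shows "g \<circ> f \<in> lie_iso K L P"
proof (rule lie_isoI)
  show "g \<circ> f \<in> module_hom K L P"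
    by (rule module_hom_comp[OF lie_iso_hom[OF f] lie_iso_hom[OF g]])
  show "bij_betw (g \<circ> f) (carrier L) (carrier P)"
    by (rule bij_betw_trans[OF lie_iso_bij[OF f] lie_iso_bij[OF g]])
qed (simp add: lie_iso_bracket[OF f] lie_iso_bracket[OF g] lie_iso_closed[OF f])

lemma (in lie_algebra) lie_iso_inv:
  assumes f: "f \<in> lie_iso K L M"
  shows "inv_into (carrier L) f \<in> lie_iso K M L"
proof (rule lie_isoI)
  let ?g = "inv_into (carrier L) f"
  note bij = lie_iso_bij[OF f]
  show "?g \<in> module_hom K M L"
    by (rule module_hom_inv_into[OF module_axioms lie_iso_hom[OF f] bij])
  show "bij_betw ?g (carrier M) (carrier L)"
    by (rule bij_betw_inv_into[OF bij])
  fix x y assume "x \<in> carrier M" "y \<in> carrier M"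
  then obtain x' y' where x': "x' \<in> carrier L" "x = f x'" and y': "y' \<in> carrier L" "y = f y'"
    using bij unfolding bij_betw_def by blast
  then show "?g (bracket M x y) = bracket L (?g x) (?g y)"
    by (simp add: bij_betw_inv_into_left[OF bij] flip: lie_iso_bracket[OF f])
qed

lemma polarized_isomorphic_refl: "polarized_isomorphic K G G"
  unfolding polarized_isomorphic_def by (intro bexI[OF _ lie_iso_id]) simp

lemma polarized_isomorphic_trans:
  assumes "polarized_isomorphic K G G'" "polarized_isomorphic K G' G''"
  shows "polarized_isomorphic K G G''"
proof -
  from assms(1) obtain \<Phi> where \<Phi>: "\<Phi> \<in> lie_iso K G G'"
      "\<forall>u\<in>carrier G. \<forall>v\<in>carrier G. form G' (\<Phi> u) (\<Phi> v) = form G u v"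
      "\<Phi> ` lag_ideal G = lag_ideal G'" "\<Phi> ` lag_complement G = lag_complement G'"
    unfolding polarized_isomorphic_def by blast
  from assms(2) obtain \<Psi> where \<Psi>: "\<Psi> \<in> lie_iso K G' G''"
      "\<forall>u\<in>carrier G'. \<forall>v\<in>carrier G'. form G'' (\<Psi> u) (\<Psi> v) = form G' u v"
      "\<Psi> ` lag_ideal G' = lag_ideal G''" "\<Psi> ` lag_complement G' = lag_complement G''"
    unfolding polarized_isomorphic_def by blast
  have "(\<Psi> \<circ> \<Phi>) ` lag_ideal G = lag_ideal G''" "(\<Psi> \<circ> \<Phi>) ` lag_complement G = lag_complement G''"
    by (simp_all only: image_comp[symmetric] \<Phi>(3,4) \<Psi>(3,4))
  then show ?thesis
    unfolding polarized_isomorphic_def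
    using \<Phi>(2) \<Psi>(2) lie_iso_closed[OF \<Phi>(1)]
    by (intro bexI[OF _ lie_iso_comp[OF \<Phi>(1) \<Psi>(1)]]) simp
qed

text \<open>The axioms of \<open>G\<close> give linearity of the inverse map and put the two
  summands inside the carrier, where \<open>\<Phi>\<close> is injective.\<close>

lemma polarized_isomorphic_sym:
  assumes "strongly_polarized K G" "polarized_isomorphic K G G'"
  shows "polarized_isomorphic K G' G"
proof -
  interpret strongly_polarized K G by fact
  from assms obtain \<Phi> where \<Phi>: "\<Phi> \<in> lie_iso K G G'"
      "\<forall>u\<in>carrier G. \<forall>v\<in>carrier G. form G' (\<Phi> u) (\<Phi> v) = form G u v"
      "\<Phi> ` lag_ideal G = lag_ideal G'" "\<Phi> ` lag_complement G = lag_complement G'"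
    unfolding polarized_isomorphic_def by blast
  let ?g = "inv_into (carrier G) \<Phi>"
  have bij: "bij_betw \<Phi> (carrier G) (carrier G')" by (rule lie_iso_bij[OF \<Phi>(1)])
  have g: "?g u \<in> carrier G" "\<Phi> (?g u) = u" if "u \<in> carrier G'" for u
    using that bij by (auto simp: bij_betw_def f_inv_into_f inv_into_into)
  have "\<forall>u\<in>carrier G'. \<forall>v\<in>carrier G'. form G (?g u) (?g v) = form G' u v"
  proof (intro ballI)
    fix u v assume "u \<in> carrier G'" "v \<in> carrier G'"
    then show "form G (?g u) (?g v) = form G' u v"
      using \<Phi>(2)[rule_format, of "?g u" "?g v"] by (simp add: g)
  qed
  moreover have "?g ` lag_ideal G' = lag_ideal G" "?g ` lag_complement G' = lag_complement G"
    unfolding \<Phi>(3,4)[symmetric]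
    by (intro inv_into_image_cancel bij_betw_imp_inj_on[OF bij] subsetI ideal_closed complement_closed;
        assumption)+
  ultimately show ?thesis
    unfolding polarized_isomorphic_def by (intro bexI[OF _ lie_iso_inv[OF \<Phi>(1)]]) simp
qed

lemma flat_cocycle_isomorphic_refl: "flat_cocycle_isomorphic K H H"
  unfolding flat_cocycle_isomorphic_def by (intro bexI[OF _ lie_iso_id]) simp

lemma flat_cocycle_isomorphic_trans:
  assumes "flat_cocycle_isomorphic K H H'" "flat_cocycle_isomorphic K H' H''"
  shows "flat_cocycle_isomorphic K H H''"
proof -
  from assms(1) obtain \<phi> where \<phi>: "\<phi> \<in> lie_iso K H H'"
      "\<forall>u\<in>carrier H. \<forall>v\<in>carrier H. \<phi> (conn H u v) = conn H' (\<phi> u) (\<phi> v)"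
      "\<forall>u\<in>carrier H. \<forall>v\<in>carrier H. \<forall>w\<in>carrier H. cocycle H' (\<phi> u) (\<phi> v) (\<phi> w) = cocycle H u v w"
    unfolding flat_cocycle_isomorphic_def by blast
  from assms(2) obtain \<psi> where \<psi>: "\<psi> \<in> lie_iso K H' H''"
      "\<forall>u\<in>carrier H'. \<forall>v\<in>carrier H'. \<psi> (conn H' u v) = conn H'' (\<psi> u) (\<psi> v)"
      "\<forall>u\<in>carrier H'. \<forall>v\<in>carrier H'. \<forall>w\<in>carrier H'.
        cocycle H'' (\<psi> u) (\<psi> v) (\<psi> w) = cocycle H' u v w"
    unfolding flat_cocycle_isomorphic_def by blast
  show ?thesis
    unfolding flat_cocycle_isomorphic_def
    using \<phi> \<psi> lie_iso_closed[OF \<phi>(1)]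
    by (intro bexI[OF _ lie_iso_comp[OF \<phi>(1) \<psi>(1)]]) simp
qed

lemma (in flat_lie_algebra) conn_closed:
  "\<lbrakk>u \<in> carrier H; v \<in> carrier H\<rbrakk> \<Longrightarrow> conn H u v \<in> carrier H"
  by (rule module_hom_carrier[OF bilinear_map_right[OF conn_bilinear]])

lemma flat_cocycle_isomorphic_sym:
  assumes "flat_with_symplectic_cocycle K H" "flat_cocycle_isomorphic K H H'"
  shows "flat_cocycle_isomorphic K H' H"
proof -
  interpret H: flat_with_symplectic_cocycle K H by fact
  from assms obtain \<phi> where \<phi>: "\<phi> \<in> lie_iso K H H'"
      "\<forall>u\<in>carrier H. \<forall>v\<in>carrier H. \<phi> (conn H u v) = conn H' (\<phi> u) (\<phi> v)"
      "\<forall>u\<in>carrier H. \<forall>v\<in>carrier H. \<forall>w\<in>carrier H. cocycle H' (\<phi> u) (\<phi> v) (\<phi> w) = cocycle H u v w"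
    unfolding flat_cocycle_isomorphic_def by blast
  let ?g = "inv_into (carrier H) \<phi>"
  have bij: "bij_betw \<phi> (carrier H) (carrier H')" by (rule lie_iso_bij[OF \<phi>(1)])
  have g: "?g u \<in> carrier H" "\<phi> (?g u) = u" if "u \<in> carrier H'" for u
    using that bij by (auto simp: bij_betw_def f_inv_into_f inv_into_into)
  have "?g (conn H' u v) = conn H (?g u) (?g v)" if "u \<in> carrier H'" "v \<in> carrier H'" for u v
  proof -
    have "conn H' u v = \<phi> (conn H (?g u) (?g v))" using \<phi>(2) that by (simp add: g)
    then show ?thesis using bij that by (simp add: g H.conn_closed bij_betw_inv_into_left)
  qed
  moreover have "cocycle H (?g u) (?g v) (?g w) = cocycle H' u v w"
    if "u \<in> carrier H'" "v \<in> carrier H'" "w \<in> carrier H'" for u v w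
    using \<phi>(3)[rule_format, of "?g u" "?g v" "?g w"] that by (simp add: g)
  ultimately show ?thesis
    unfolding flat_cocycle_isomorphic_def by (intro bexI[OF _ H.lie_iso_inv[OF \<phi>(1)]]) simp
qed

text \<open>Symmetry is asked on \<open>A\<close> alone, since inverting an isomorphism uses the
  axioms of its source.\<close>

lemma equiv_Collect:
  assumes "\<And>x. x \<in> A \<Longrightarrow> R x x"
    and "\<And>x y. \<lbrakk>x \<in> A; y \<in> A; R x y\<rbrakk> \<Longrightarrow> R y x"
    and "\<And>x y z. \<lbrakk>R x y; R y z\<rbrakk> \<Longrightarrow> R x z"
  shows "equiv A {(x, y). x \<in> A \<and> y \<in> A \<and> R x y}"
proof (rule equivI)
  show "refl_on A {(x, y). x \<in> A \<and> y \<in> A \<and> R x y}" using assms(1) by (auto intro: refl_onI)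
  show "sym {(x, y). x \<in> A \<and> y \<in> A \<and> R x y}" using assms(2) by (auto intro: symI)
  show "trans {(x, y). x \<in> A \<and> y \<in> A \<and> R x y}" using assms(3) by (auto intro!: transI)
qed auto

lemma equiv_polarized_iso_rel: "equiv (polarized_algs K) (polarized_iso_rel K)"
  unfolding polarized_iso_rel_def
  by (rule equiv_Collect[OF polarized_isomorphic_refl polarized_isomorphic_sym polarized_isomorphic_trans])
    (simp_all add: polarized_algs_def)

lemma equiv_flat_cocycle_iso_rel: "equiv (flat_cocycle_algs K) (flat_cocycle_iso_rel K)"
  unfolding flat_cocycle_iso_rel_def
  by (rule equiv_Collect[OF flat_cocycle_isomorphic_refl flat_cocycle_isomorphic_sym
        flat_cocycle_isomorphic_trans])
    (simp_all add: flat_cocycle_algs_def)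

section \<open>Uniqueness and transport of models\<close>

text \<open>Both identifications are bijections onto the same complement, so going along
  \<open>l\<close> and back along \<open>l'\<close> is a bijection. It respects all operations
  because these are fixed by values of \<omega> on the images.\<close>

lemma extension_model_unique:
  assumes "extension_model K G H l" "extension_model K G H' l'"
  shows "flat_cocycle_isomorphic K H H'"
proof -
  interpret M: extension_model K G H l by fact
  interpret M': extension_model K G H' l' by fact
  define \<phi> where "\<phi> = M'.proj \<circ> l"
  have cl: "\<phi> u \<in> carrier H'" if "u \<in> carrier H" for u
    using that by (simp add: \<phi>_def M'.proj_closed M.l_closed)
  \<comment> \<open>Under this equation the defining equations of the two models coincide.\<close>
  have l: "l' (\<phi> u) = l u" if u: "u \<in> carrier H" for u
  proof -
    obtain u' where "u' \<in> carrier H'" "l u = l' u'" using M'.l_surj[OF M.l_complement[OF u]] .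
    then show ?thesis by (simp add: \<phi>_def M'.proj_l)
  qed
  have eqI: "u = v" if "u \<in> carrier H'" "v \<in> carrier H'"
    "\<And>a. a \<in> lag_ideal G \<Longrightarrow> form G (l' u) a = form G (l' v) a" for u v
    using that by (rule M'.model_eqI)
  have "\<phi> \<in> lie_iso K H H'"
  proof (rule lie_isoI)
    show "\<phi> \<in> module_hom K H H'"
      unfolding \<phi>_def by (rule module_hom_comp[OF M.l_hom M'.proj_hom])
    show "bij_betw \<phi> (carrier H) (carrier H')"
    proof (rule bij_betwI[where g = "M.proj \<circ> l'"])
      show "\<phi> \<in> carrier H \<rightarrow> carrier H'" using cl by auto
      show "M.proj \<circ> l' \<in> carrier H' \<rightarrow> carrier H" by (auto simp: M.proj_closed M'.l_closed)
      show "(M.proj \<circ> l') (\<phi> u) = u" if "u \<in> carrier H" for u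
        using that by (simp add: l M.proj_l)
      show "\<phi> ((M.proj \<circ> l') v) = v" if v: "v \<in> carrier H'" for v
      proof -
        obtain v' where "v' \<in> carrier H" "l' v = l v'" using M.l_surj[OF M'.l_complement[OF v]] .
        then show ?thesis by (metis M.proj_l M'.proj_l \<phi>_def comp_apply v)
      qed
    qed
    show "\<phi> (bracket H u v) = bracket H' (\<phi> u) (\<phi> v)" if "u \<in> carrier H" "v \<in> carrier H" for u v
      by (rule eqI) (use that in \<open>simp_all add: cl l M.model_closed M'.model_closed M.model_bracket M'.model_bracket\<close>)
  qed
  moreover have "\<phi> (conn H u v) = conn H' (\<phi> u) (\<phi> v)" if "u \<in> carrier H" "v \<in> carrier H" for u v
    by (rule eqI) (use that in \<open>simp_all add: cl l M.model_closed M'.model_closed M.model_conn M'.model_conn\<close>)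
  ultimately show ?thesis
    unfolding flat_cocycle_isomorphic_def
    by (intro bexI[of _ \<phi>]) (simp_all add: cl l M.model_cocycle M'.model_cocycle)
qed

text \<open>The identification is pulled back along the isomorphism. With
  \<open>extension_model_unique\<close> it describes all models of a fixed \<open>G\<close>:
  whatever is isomorphic to one of them, and nothing else.\<close>

lemma extension_model_precomp:
  assumes "extension_model K G H l" "flat_with_symplectic_cocycle K H'" "flat_cocycle_isomorphic K H' H"
  shows "\<exists>l'. extension_model K G H' l'"
proof -
  interpret M: extension_model K G H l by fact
  interpret H': flat_with_symplectic_cocycle K H' by fact
  obtain \<phi> where \<phi>: "\<phi> \<in> lie_iso K H' H"
      "\<forall>u\<in>carrier H'. \<forall>v\<in>carrier H'. \<phi> (conn H' u v) = conn H (\<phi> u) (\<phi> v)"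
      "\<forall>u\<in>carrier H'. \<forall>v\<in>carrier H'. \<forall>w\<in>carrier H'. cocycle H (\<phi> u) (\<phi> v) (\<phi> w) = cocycle H' u v w"
    using assms(3) unfolding flat_cocycle_isomorphic_def by blast
  have "bilinear_map K H' H' (dual_space K H') (cocycle H')"
    using H'.cocycle by (simp add: ce_two_cocycles_def)
  then have ext: "cocycle H' u v \<in> extensional (carrier H')" if "u \<in> carrier H'" "v \<in> carrier H'" for u v
    using module_hom_carrier[OF bilinear_map_right] that by fastforce
  have "extension_model K G H' (l \<circ> \<phi>)"
  proof unfold_locales
    show "l \<circ> \<phi> \<in> module_hom K H' G"
      by (rule module_hom_comp[OF lie_iso_hom[OF \<phi>(1)] M.l_hom])
    show "bij_betw (l \<circ> \<phi>) (carrier H') (lag_complement G)"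
      by (rule bij_betw_trans[OF lie_iso_bij[OF \<phi>(1)] M.l_bij])
  qed (simp_all add: ext H'.conn_closed lie_iso_closed[OF \<phi>(1)] lie_iso_bracket[OF \<phi>(1)]
      M.model_bracket M.model_conn M.model_cocycle \<phi>(2) flip: \<phi>(3)[rule_format])
  then show ?thesis by blast
qed

text \<open>Composing \<open>l\<close> with the isomorphism leaves \<open>H\<close> unchanged, which
  is why isomorphic polarized algebras have isomorphic triples.\<close>

lemma extension_model_postcomp:
  assumes "extension_model K G H l" "strongly_polarized K G'" "polarized_isomorphic K G G'"
  shows "\<exists>l'. extension_model K G' H l'"
proof -
  interpret M: extension_model K G H l by fact
  interpret G': strongly_polarized K G' by fact
  obtain \<Phi> where \<Phi>: "\<Phi> \<in> lie_iso K G G'"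
      "\<forall>u\<in>carrier G. \<forall>v\<in>carrier G. form G' (\<Phi> u) (\<Phi> v) = form G u v"
      "\<Phi> ` lag_ideal G = lag_ideal G'" "\<Phi> ` lag_complement G = lag_complement G'"
    using assms(3) unfolding polarized_isomorphic_def by blast
  have bij: "bij_betw \<Phi> (lag_complement G) (lag_complement G')"
    using lie_iso_bij[OF \<Phi>(1)] \<Phi>(4) M.complement_closed
    by (auto simp: bij_betw_def intro: inj_on_subset)
  have "extension_model K G' H (\<Phi> \<circ> l)"
  proof unfold_locales
    show "\<Phi> \<circ> l \<in> module_hom K H G'"
      by (rule module_hom_comp[OF M.l_hom lie_iso_hom[OF \<Phi>(1)]])
    show "bij_betw (\<Phi> \<circ> l) (carrier H) (lag_complement G')"
      by (rule bij_betw_trans[OF M.l_bij bij])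
    fix u v a' assume "u \<in> carrier H" "v \<in> carrier H" "a' \<in> lag_ideal G'"
    moreover from this obtain a where "a' = \<Phi> a" "a \<in> lag_ideal G" using \<Phi>(3) by blast
    ultimately show "form G' ((\<Phi> \<circ> l) (bracket H u v)) a' = form G' (bracket G' ((\<Phi> \<circ> l) u) ((\<Phi> \<circ> l) v)) a'"
      "form G' ((\<Phi> \<circ> l) (conn H u v)) a' = \<ominus>\<^bsub>K\<^esub> form G' ((\<Phi> \<circ> l) v) (bracket G' ((\<Phi> \<circ> l) u) a')"
      using \<Phi>(2) by (simp_all add: M.model_closed M.model_bracket M.model_conn flip: lie_iso_bracket[OF \<Phi>(1)])
  qed (use \<Phi>(2) in \<open>simp_all add: M.model_closed M.model_cocycle M.model_cocycle_extensional
      flip: lie_iso_bracket[OF \<Phi>(1)]\<close>)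
  then show ?thesis by blast
qed

context strongly_polarized
begin

text \<open>The right side is linear in \<open>a\<close> on all of \<open>G\<close>; nondegeneracy
  represents it by a vector, whose complement component has the same pairings with the
  ideal.\<close>

lemma connection_vector:
  assumes "x \<in> carrier G" "y \<in> carrier G"
  shows "\<exists>n\<in>lag_complement G. \<forall>a\<in>lag_ideal G. form G n a = \<ominus>\<^bsub>K\<^esub> form G y (bracket G x a)"
proof -
  have "(\<lambda>z. \<ominus>\<^bsub>K\<^esub> form G y (bracket G x z)) \<in> module_hom K G (ground_space K)"
    using assms by (intro module_homI)
      (simp_all add: bracket_linear form_linear R.minus_add R.r_minus)
  then obtain x0 where x0: "x0 \<in> carrier G"
    "\<And>z. z \<in> carrier G \<Longrightarrow> form G x0 z = \<ominus>\<^bsub>K\<^esub> form G y (bracket G x z)"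
    using form_represents by blast
  then show ?thesis using complement_part[OF x0(1)] ideal_closed by simp
qed

end

text \<open>Unlike the extension triple, which lives in \<open>'a set\<close>, this model has its carrier in the type
  of \<open>G\<close>.\<close>

lemma extension_model_in_complement:
  fixes G :: "('k, 'a) polarized_alg"
  assumes "strongly_polarized K G"
  shows "\<exists>H :: ('k, 'a) flat_cocycle_alg. extension_model K G H id"
proof -
  interpret strongly_polarized K G by fact
  let ?N = "lag_complement G"
  \<comment> \<open>The component in \<open>?N\<close> of the bracket of \<open>G\<close>, since
    \<open>?N\<close> need not be a subalgebra.\<close>
  define br where "br u v = (THE n. n \<in> ?N \<and>
    (\<forall>a\<in>lag_ideal G. form G n a = form G (bracket G u v) a))" for u v
  define cn where "cn u v = (THE n. n \<in> ?N \<and>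
    (\<forall>a\<in>lag_ideal G. form G n a = \<ominus>\<^bsub>K\<^esub> form G v (bracket G u a)))" for u v
  have br: "br u v \<in> ?N" "a \<in> lag_ideal G \<Longrightarrow> form G (br u v) a = form G (bracket G u v) a"
    if "u \<in> ?N" "v \<in> ?N" for u v a
  proof -
    have "bracket G u v \<in> carrier G" using that by (simp add: complement_closed)
    then obtain n where "n \<in> ?N" "\<And>a. a \<in> lag_ideal G \<Longrightarrow> form G n a = form G (bracket G u v) a"
      using complement_part[of "bracket G u v"] by blast
    then have "\<exists>!n. n \<in> ?N \<and> (\<forall>a\<in>lag_ideal G. form G n a = form G (bracket G u v) a)"
      by (metis complement_eqI)
    from theI'[OF this] show "br u v \<in> ?N"
      "a \<in> lag_ideal G \<Longrightarrow> form G (br u v) a = form G (bracket G u v) a"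
      by (auto simp: br_def)
  qed
  have cn: "cn u v \<in> ?N" "a \<in> lag_ideal G \<Longrightarrow> form G (cn u v) a = \<ominus>\<^bsub>K\<^esub> form G v (bracket G u a)"
    if uv: "u \<in> ?N" "v \<in> ?N" for u v a
  proof -
    obtain n where "n \<in> ?N" "\<And>a. a \<in> lag_ideal G \<Longrightarrow> form G n a = \<ominus>\<^bsub>K\<^esub> form G v (bracket G u a)"
      using connection_vector[OF complement_closed[OF uv(1)] complement_closed[OF uv(2)]] by blast
    then have "\<exists>!n. n \<in> ?N \<and> (\<forall>a\<in>lag_ideal G. form G n a = \<ominus>\<^bsub>K\<^esub> form G v (bracket G u a))"
      by (metis complement_eqI)
    from theI'[OF this] show "cn u v \<in> ?N"
      "a \<in> lag_ideal G \<Longrightarrow> form G (cn u v) a = \<ominus>\<^bsub>K\<^esub> form G v (bracket G u a)"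
      by (auto simp: cn_def)
  qed
  define H :: "('k, 'a) flat_cocycle_alg" where
    "H = \<lparr>carrier = ?N, mult = mult G, one = one G, zero = zero G, add = add G, smult = smult G,
      bracket = br, conn = cn,
      cocycle = (\<lambda>u v. \<lambda>w\<in>?N. form G (bracket G u v) w)\<rparr>"
  have "vectorspace K (G\<lparr>carrier := ?N\<rparr>)"
    using complement_lagrangian by (intro subspace_is_vs) (simp add: lagrangian_def)
  then have "vectorspace K H"
    by (rule vectorspace_transport[where f = id]) (auto simp: H_def intro!: module_homI)
  then interpret H: vectorspace K H .
  have "extension_model K G H id"
    by unfold_locales (auto simp: H_def br cn complement_closed intro!: module_homI)
  then show ?thesis by blast
qed

section \<open>The extension triple as a model\<close>

context strongly_polarized
begin

definition coset where
  "coset x = lag_ideal G +>\<^bsub>G\<^esub> x"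

text \<open>A class modulo the ideal is the set of vectors with given pairings with the ideal, by
  the two lemmas on \<open>form_ideal_cong\<close>. Computations with cosets thereby become
  computations with \<omega>.\<close>

lemma mem_coset:
  assumes "x \<in> carrier G"
  shows "y \<in> coset x \<longleftrightarrow> y \<in> carrier G \<and> (\<forall>a\<in>lag_ideal G. form G y a = form G x a)"
proof
  assume "y \<in> coset x"
  then obtain b where "b \<in> lag_ideal G" "y = b \<oplus>\<^bsub>G\<^esub> x" by (auto simp: coset_def a_r_coset_def')
  then show "y \<in> carrier G \<and> (\<forall>a\<in>lag_ideal G. form G y a = form G x a)"
    using assms by (simp add: ideal_closed form_linear form_ideal_ideal)
next
  assume y: "y \<in> carrier G \<and> (\<forall>a\<in>lag_ideal G. form G y a = form G x a)"
  then have "y \<ominus>\<^bsub>G\<^esub> x \<in> lag_ideal G" using assms by (intro form_ideal_congD) auto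
  moreover have "y = (y \<ominus>\<^bsub>G\<^esub> x) \<oplus>\<^bsub>G\<^esub> x" using y assms by (simp add: M.minus_eq M.a_assoc M.l_neg)
  ultimately show "y \<in> coset x" by (auto simp: coset_def a_r_coset_def')
qed

lemma coset_eq_iff:
  "\<lbrakk>x \<in> carrier G; y \<in> carrier G\<rbrakk> \<Longrightarrow>
    coset x = coset y \<longleftrightarrow> (\<forall>a\<in>lag_ideal G. form G x a = form G y a)"
  using mem_coset[of x] mem_coset[of y] by (auto simp: set_eq_iff)

lemma coset_self: "x \<in> carrier G \<Longrightarrow> x \<in> coset x"
  by (simp add: mem_coset)

lemma coset_zero: "coset \<zero>\<^bsub>G\<^esub> = lag_ideal G"
  using in_idealI by (auto simp: set_eq_iff mem_coset ideal_closed form_linear form_ideal_ideal)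

lemma coset_add:
  assumes "x \<in> carrier G" "y \<in> carrier G"
  shows "coset x <+>\<^bsub>G\<^esub> coset y = coset (x \<oplus>\<^bsub>G\<^esub> y)"
proof
  show "coset x <+>\<^bsub>G\<^esub> coset y \<subseteq> coset (x \<oplus>\<^bsub>G\<^esub> y)"
    using assms by (auto simp: set_add_def' mem_coset form_linear ideal_closed)
  show "coset (x \<oplus>\<^bsub>G\<^esub> y) \<subseteq> coset x <+>\<^bsub>G\<^esub> coset y"
  proof
    fix z assume z: "z \<in> coset (x \<oplus>\<^bsub>G\<^esub> y)"
    then have zG: "z \<in> carrier G" using assms by (simp add: mem_coset)
    have "form G (z \<ominus>\<^bsub>G\<^esub> x) a = form G y a" if a: "a \<in> lag_ideal G" for a
    proof -
      have "form G x a \<in> carrier K" "form G y a \<in> carrier K" using assms a ideal_closed by auto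
      then have "(form G x a \<oplus>\<^bsub>K\<^esub> form G y a) \<ominus>\<^bsub>K\<^esub> form G x a = form G y a" by algebra
      then show ?thesis using z assms zG a by (simp add: mem_coset form_linear ideal_closed)
    qed
    then have "z \<ominus>\<^bsub>G\<^esub> x \<in> coset y" using assms zG by (simp add: mem_coset)
    moreover have "z = x \<oplus>\<^bsub>G\<^esub> (z \<ominus>\<^bsub>G\<^esub> x)"
      using assms zG by (simp add: M.minus_eq M.a_lcomm[of x] M.r_neg)
    ultimately show "z \<in> coset x <+>\<^bsub>G\<^esub> coset y"
      using coset_self[OF assms(1)] unfolding set_add_def' by blast
  qed
qed

text \<open>The scalar multiplication of \<open>lie_quotient\<close> is a union over all
  representatives; such a union collapses once the value does not depend on the
  representative.\<close>

lemma coset_UN: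
  assumes "x \<in> carrier G" "\<And>y. y \<in> coset x \<Longrightarrow> f y = f x"
  shows "(\<Union>y\<in>coset x. f y) = f x"
  using assms coset_self by blast

lemma lie_quotient_simps:
  "carrier (lie_quotient G (lag_ideal G)) = coset ` carrier G"
  "zero (lie_quotient G (lag_ideal G)) = coset \<zero>\<^bsub>G\<^esub>"
  "\<lbrakk>x \<in> carrier G; y \<in> carrier G\<rbrakk> \<Longrightarrow>
    coset x \<oplus>\<^bsub>lie_quotient G (lag_ideal G)\<^esub> coset y = coset (x \<oplus>\<^bsub>G\<^esub> y)"
  "\<lbrakk>c \<in> carrier K; x \<in> carrier G\<rbrakk> \<Longrightarrow>
    c \<odot>\<^bsub>lie_quotient G (lag_ideal G)\<^esub> coset x = coset (c \<odot>\<^bsub>G\<^esub> x)"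
  "\<lbrakk>x \<in> carrier G; y \<in> carrier G\<rbrakk> \<Longrightarrow>
    bracket (lie_quotient G (lag_ideal G)) (coset x) (coset y) = coset (bracket G x y)"
proof -
  show "carrier (lie_quotient G (lag_ideal G)) = coset ` carrier G"
    by (auto simp: lie_quotient_def A_RCOSETS_def' coset_def)
  show "zero (lie_quotient G (lag_ideal G)) = coset \<zero>\<^bsub>G\<^esub>"
    by (simp add: lie_quotient_def coset_zero)
  show "coset x \<oplus>\<^bsub>lie_quotient G (lag_ideal G)\<^esub> coset y = coset (x \<oplus>\<^bsub>G\<^esub> y)"
    if "x \<in> carrier G" "y \<in> carrier G"
    using that by (simp add: lie_quotient_def coset_add)
  show "c \<odot>\<^bsub>lie_quotient G (lag_ideal G)\<^esub> coset x = coset (c \<odot>\<^bsub>G\<^esub> x)"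
    if "c \<in> carrier K" "x \<in> carrier G"
    using that unfolding lie_quotient_def
    by (simp flip: coset_def)
      (subst coset_UN, simp_all add: coset_eq_iff mem_coset form_linear ideal_closed)
  show "bracket (lie_quotient G (lag_ideal G)) (coset x) (coset y) = coset (bracket G x y)"
    if xy: "x \<in> carrier G" "y \<in> carrier G"
  proof -
    \<comment> \<open>One representative is changed at a time, and each change moves the bracket by
      an ideal element.\<close>
    have eq: "coset (bracket G x' y') = coset (bracket G x y)" if "x' \<in> coset x" "y' \<in> coset y" for x' y'
    proof -
      have x': "x' \<in> carrier G" "x' \<ominus>\<^bsub>G\<^esub> x \<in> lag_ideal G"
        and y': "y' \<in> carrier G" "y' \<ominus>\<^bsub>G\<^esub> y \<in> lag_ideal G"
        using that xy form_ideal_congD by (auto simp: mem_coset)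
      have "bracket G x' y' \<ominus>\<^bsub>G\<^esub> bracket G x y' \<in> lag_ideal G"
        "bracket G x y' \<ominus>\<^bsub>G\<^esub> bracket G x y \<in> lag_ideal G"
        using bracket_ideal_left[OF x'(2) y'(1)] bracket_ideal_right[OF xy(1) y'(2)] x' y' xy
        by (simp_all add: bracket_linear)
      then have "form G (bracket G x' y') a = form G (bracket G x y) a" if "a \<in> lag_ideal G" for a
        using that x' y' xy form_ideal_cong[of "bracket G x' y'" "bracket G x y'" a]
          form_ideal_cong[of "bracket G x y'" "bracket G x y" a] by simp
      then show ?thesis using x' y' xy by (simp add: coset_eq_iff)
    qed
    have "bracket (lie_quotient G (lag_ideal G)) (coset x) (coset y)
        = (\<Union>x'\<in>coset x. \<Union>y'\<in>coset y. coset (bracket G x' y'))"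
      by (simp add: lie_quotient_def coset_def)
    also have "\<dots> = coset (bracket G x y)"
      using eq coset_self[OF xy(1)] coset_self[OF xy(2)] by blast
    finally show ?thesis .
  qed
qed

text \<open>Classes and complement vectors are both determined by their pairings with the
  ideal.\<close>

lemma coset_bij: "bij_betw coset (lag_complement G) (coset ` carrier G)"
  unfolding bij_betw_def
proof
  show "inj_on coset (lag_complement G)"
    by (auto intro!: inj_onI complement_eqI simp: coset_eq_iff complement_closed)
  show "coset ` lag_complement G = coset ` carrier G"
  proof (intro equalityI image_subsetI)
    fix x assume x: "x \<in> carrier G"
    then obtain n where "n \<in> lag_complement G" "\<And>a. a \<in> lag_ideal G \<Longrightarrow> form G n a = form G x a"
      using complement_part by blast
    then have "coset x = coset n" "n \<in> lag_complement G"
      using x by (simp_all add: coset_eq_iff complement_closed)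
    then show "coset x \<in> coset ` lag_complement G" by blast
  qed (use complement_closed in blast)
qed

text \<open>The axioms are carried over from the complement, a set of representatives by
  \<open>coset_bij\<close>, instead of being checked on cosets.\<close>

lemma lie_quotient_vectorspace: "vectorspace K (lie_quotient G (lag_ideal G))"
proof (rule vectorspace_transport)
  show "vectorspace K (G\<lparr>carrier := lag_complement G\<rparr>)"
    using complement_lagrangian by (intro subspace_is_vs) (simp add: lagrangian_def)
  show "bij_betw coset (carrier (G\<lparr>carrier := lag_complement G\<rparr>))
      (carrier (lie_quotient G (lag_ideal G)))"
    using coset_bij by (simp add: lie_quotient_simps)
  show "coset \<in> module_hom K (G\<lparr>carrier := lag_complement G\<rparr>) (lie_quotient G (lag_ideal G))"
    by (rule module_homI) (auto simp: lie_quotient_simps complement_closed)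
qed (simp add: lie_quotient_simps)

end

lemma extension_triple_simps:
  "carrier (extension_triple K G) = carrier (lie_quotient G (lag_ideal G))"
  "zero (extension_triple K G) = zero (lie_quotient G (lag_ideal G))"
  "add (extension_triple K G) = add (lie_quotient G (lag_ideal G))"
  "smult (extension_triple K G) = smult (lie_quotient G (lag_ideal G))"
  "bracket (extension_triple K G) = bracket (lie_quotient G (lag_ideal G))"
  "conn (extension_triple K G) = ext_conn K G"
  "cocycle (extension_triple K G) = ext_cocycle G"
  by (simp_all add: extension_triple_def lie_alg.defs)

text \<open>Each definite description in the triple is resolved by uniqueness of a vector or class
  with given pairings with the ideal or the complement.\<close>

lemma extension_model_extension_triple:
  assumes "strongly_polarized K G"
  shows "extension_model K G (extension_triple K G) (lift G)"
proof -
  interpret strongly_polarized K G by fact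
  let ?N = "lag_complement G" and ?Q = "lie_quotient G (lag_ideal G)"
  have Q: "carrier ?Q = coset ` ?N"
    using coset_bij by (simp add: lie_quotient_simps bij_betw_def)
  have lift: "lift G (coset n) = n" if "n \<in> ?N" for n
    unfolding lift_def
    by (rule the_equality)
      (use that in \<open>auto simp: coset_self mem_coset complement_closed intro!: complement_eqI\<close>)
  have lift_coset: "lift G (coset x) \<in> ?N" "coset (lift G (coset x)) = coset x"
    "a \<in> lag_ideal G \<Longrightarrow> form G (lift G (coset x)) a = form G x a"
    if x: "x \<in> carrier G" for x a
  proof -
    have "coset x \<in> coset ` ?N" using x Q by (auto simp: lie_quotient_simps)
    then obtain n where n: "n \<in> ?N" "coset x = coset n" by blast
    then have "lift G (coset x) = n" by (simp add: lift)
    moreover have "\<forall>a\<in>lag_ideal G. form G x a = form G n a"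
      using n x coset_eq_iff complement_closed by blast
    ultimately show "lift G (coset x) \<in> ?N" "coset (lift G (coset x)) = coset x"
      "a \<in> lag_ideal G \<Longrightarrow> form G (lift G (coset x)) a = form G x a"
      using n by simp_all
  qed
  have conn: "ext_conn K G u v \<in> carrier ?Q \<and> (\<forall>a\<in>lag_ideal G.
      form G (lift G (ext_conn K G u v)) a = \<ominus>\<^bsub>K\<^esub> form G (lift G v) (bracket G (lift G u) a))"
    if "u \<in> carrier ?Q" "v \<in> carrier ?Q" for u v
    unfolding ext_conn_def
  proof (rule theI')
    have uv: "lift G u \<in> carrier G" "lift G v \<in> carrier G"
      using that by (auto simp: Q lift complement_closed)
    obtain n where n: "n \<in> ?N"
      "\<And>a. a \<in> lag_ideal G \<Longrightarrow> form G n a = \<ominus>\<^bsub>K\<^esub> form G (lift G v) (bracket G (lift G u) a)"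
      using connection_vector[OF uv] by blast
    show "\<exists>!w. w \<in> carrier ?Q \<and> (\<forall>a\<in>lag_ideal G.
        form G (lift G w) a = \<ominus>\<^bsub>K\<^esub> form G (lift G v) (bracket G (lift G u) a))"
    proof (rule ex1I[of _ "coset n"])
      fix w assume "w \<in> carrier ?Q \<and> (\<forall>a\<in>lag_ideal G.
        form G (lift G w) a = \<ominus>\<^bsub>K\<^esub> form G (lift G v) (bracket G (lift G u) a))"
      then obtain m where "w = coset m" "m \<in> ?N"
        "\<forall>a\<in>lag_ideal G. form G m a = \<ominus>\<^bsub>K\<^esub> form G (lift G v) (bracket G (lift G u) a)"
        by (auto simp: Q lift)
      then show "w = coset n" using n by (simp add: coset_eq_iff complement_closed)
    qed (use n in \<open>auto simp: Q lift\<close>)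
  qed
  \<comment> \<open>Dropping the complement component of \<open>x\<close> does not change its
    pairing with the isotropic complement, so the cocycle agrees with the unprojected formula of
    \<open>extension_model\<close>.\<close>
  have proj: "form G (ideal_proj G x) n = form G x n" if x: "x \<in> carrier G" and n: "n \<in> ?N" for x n
  proof -
    obtain a m where am: "a \<in> lag_ideal G" "m \<in> ?N" "x = a \<oplus>\<^bsub>G\<^esub> m" using decomposition[OF x] .
    have "ideal_proj G x = a"
      unfolding ideal_proj_def
    proof (rule the_equality)
      fix b assume "b \<in> lag_ideal G \<and> (\<exists>n\<in>?N. x = b \<oplus>\<^bsub>G\<^esub> n)"
      then obtain n where b: "b \<in> lag_ideal G" "n \<in> ?N" "x = b \<oplus>\<^bsub>G\<^esub> n" by blast
      have eq: "form G c k = form G x k"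
        if "c \<in> lag_ideal G" "m' \<in> ?N" "x = c \<oplus>\<^bsub>G\<^esub> m'" "k \<in> ?N" for c m' k
        using that by (simp add: form_linear ideal_closed complement_closed form_complement_complement)
      show "b = a"
      proof (rule form_eqI_polarized)
        fix k assume "k \<in> ?N"
        then show "form G b k = form G a k" using eq[OF b] eq[OF am] by simp
      qed (use am b in \<open>simp_all add: ideal_closed form_ideal_ideal\<close>)
    qed (use am in blast)
    then show ?thesis
      using am n by (simp add: form_linear ideal_closed complement_closed form_complement_complement)
  qed
  interpret Q: vectorspace K ?Q by (rule lie_quotient_vectorspace)
  have "vectorspace K (extension_triple K G)"
    by (rule vectorspace_transport[OF Q.vectorspace_axioms, where f = id])
      (auto simp: extension_triple_simps intro!: module_homI)
  then interpret H: vectorspace K "extension_triple K G" .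
  show ?thesis
  proof unfold_locales
    show "lift G \<in> module_hom K (extension_triple K G) G"
      by (rule module_homI)
        (auto simp: extension_triple_simps Q lift lie_quotient_simps complement_closed complement_submodule_closed)
    show "bij_betw (lift G) (carrier (extension_triple K G)) ?N"
      by (rule bij_betwI[where g = coset]) (auto simp: extension_triple_simps Q lift)
    fix u v assume uv: "u \<in> carrier (extension_triple K G)" "v \<in> carrier (extension_triple K G)"
    then show "conn (extension_triple K G) u v \<in> carrier (extension_triple K G)"
      using conn by (simp add: extension_triple_simps)
    show "bracket (extension_triple K G) u v \<in> carrier (extension_triple K G)"
      using uv by (auto simp: extension_triple_simps lie_quotient_simps)
  qed (auto simp: extension_triple_simps conn ext_cocycle_def Q lift proj lie_quotient_simps
      complement_closed lift_coset)
qed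

section \<open>The symplectic extension of a flat Lie algebra\<close>

text \<open>The connection terms of the Jacobi identity in the symplectic extension cancel by this identity.
  It is stated for variables because the method \<open>algebra\<close> does not finish on the actual terms.\<close>

lemma (in cring) cyclic_sum_cancel:
  assumes "a \<in> carrier R" "a' \<in> carrier R" "b \<in> carrier R" "b' \<in> carrier R" "c \<in> carrier R" "c' \<in> carrier R"
    "p \<in> carrier R" "q \<in> carrier R" "r \<in> carrier R" "p' \<in> carrier R" "q' \<in> carrier R" "r' \<in> carrier R"
  shows "(\<ominus> (\<ominus> a \<oplus> b \<oplus> p) \<oplus> (c \<ominus> c') \<oplus> (\<ominus> p')) \<oplus> (\<ominus> (\<ominus> c' \<oplus> a' \<oplus> (\<ominus> q)) \<oplus> (b \<ominus> b') \<oplus> q')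
     \<oplus> (\<ominus> (\<ominus> b' \<oplus> c \<oplus> r) \<oplus> (a' \<ominus> a) \<oplus> (\<ominus> r'))
    = (\<ominus> p) \<ominus> (\<ominus> q) \<oplus> (\<ominus> r) \<ominus> r' \<oplus> q' \<ominus> p'"
  using assms by algebra

lemma span_image_subset:
  assumes "module K V" "module K W" "f \<in> module_hom K V W" "S \<subseteq> carrier V"
    and P: "submodule K P W" and "f ` S \<subseteq> P"
  shows "f ` module.span K V S \<subseteq> P"
proof -
  interpret V: module K V by fact
  interpret W: module K W by fact
  interpret mod_hom K V W f by unfold_locales fact
  interpret P: submodule K P W by fact
  have "submodule K {v \<in> carrier V. f v \<in> P} V"
    by (rule submodule.intro) (auto simp: V.module_axioms)
  from V.span_is_subset[OF _ this, of S] show ?thesis using assms by blast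
qed

text \<open>The images of two spanning sets together span. \<open>E\<close> is described by its
  carrier and the two inclusions, so that the lemma fits a record with further fields such as
  \<open>symplectic_extension\<close>.\<close>

lemma fin_dim_Times:
  assumes V: "vectorspace K V" "vectorspace.fin_dim K V"
    and W: "vectorspace K W" "vectorspace.fin_dim K W"
    and E: "vectorspace K E" "carrier E = carrier V \<times> carrier W"
    and i: "(\<lambda>v. (v, \<zero>\<^bsub>W\<^esub>)) \<in> module_hom K V E" and j: "(\<lambda>w. (\<zero>\<^bsub>V\<^esub>, w)) \<in> module_hom K W E"
    and add: "\<And>v w. \<lbrakk>v \<in> carrier V; w \<in> carrier W\<rbrakk> \<Longrightarrow> (v, \<zero>\<^bsub>W\<^esub>) \<oplus>\<^bsub>E\<^esub> (\<zero>\<^bsub>V\<^esub>, w) = (v, w)"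
  shows "vectorspace.fin_dim K E"
proof -
  interpret V: vectorspace K V by fact
  interpret W: vectorspace K W by fact
  interpret E: vectorspace K E by fact
  obtain S T where S: "finite S" "S \<subseteq> carrier V" "V.span S = carrier V"
    and T: "finite T" "T \<subseteq> carrier W" "W.span T = carrier W"
    using V(2) W(2) unfolding V.fin_dim_def W.fin_dim_def by blast
  let ?U = "(\<lambda>v. (v, \<zero>\<^bsub>W\<^esub>)) ` S \<union> (\<lambda>w. (\<zero>\<^bsub>V\<^esub>, w)) ` T"
  have U: "?U \<subseteq> carrier E" using S T by (auto simp: E)
  note sub = E.span_is_submodule[OF U] and own = E.in_own_span[OF U]
  have 1: "(v, \<zero>\<^bsub>W\<^esub>) \<in> E.span ?U" if "v \<in> carrier V" for v
    using span_image_subset[OF V.module_axioms E.module_axioms i S(2) sub] own S(3) that by blast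
  have 2: "(\<zero>\<^bsub>V\<^esub>, w) \<in> E.span ?U" if "w \<in> carrier W" for w
    using span_image_subset[OF W.module_axioms E.module_axioms j T(2) sub] own T(3) that by blast
  have "(v, w) \<in> E.span ?U" if "v \<in> carrier V" "w \<in> carrier W" for v w
    using submodule.m_closed[OF sub 1[OF that(1)] 2[OF that(2)]] add[OF that] by simp
  then have "E.span ?U = carrier E"
    using E.span_is_subset2[OF U] by (auto simp: E)
  then show ?thesis
    unfolding E.fin_dim_def using S T U by (intro exI[of _ ?U]) simp
qed

text \<open>On \<open>\<hh>\<^sup>* \<oplus> \<hh>\<close> the first component of the bracket of \<open>(\<xi>, u)\<close> and \<open>(\<eta>, v)\<close> is
  \<open>\<rho>(u)\<eta> - \<rho>(v)\<xi> + \<alpha>(u, v)\<close>.\<close>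

definition symplectic_extension ::
    "('k, 'm) ring_scheme \<Rightarrow> ('k, 'b, 'x) flat_cocycle_alg_scheme \<Rightarrow> ('k, ('b \<Rightarrow> 'k) \<times> 'b) polarized_alg" where
  "symplectic_extension K H =
     \<lparr>carrier = carrier (dual_space K H) \<times> carrier H,
      mult = (\<lambda>x y. (\<zero>\<^bsub>dual_space K H\<^esub>, \<zero>\<^bsub>H\<^esub>)), one = (\<zero>\<^bsub>dual_space K H\<^esub>, \<zero>\<^bsub>H\<^esub>),
      zero = (\<zero>\<^bsub>dual_space K H\<^esub>, \<zero>\<^bsub>H\<^esub>),
      add = (\<lambda>x y. (fst x \<oplus>\<^bsub>dual_space K H\<^esub> fst y, snd x \<oplus>\<^bsub>H\<^esub> snd y)),
      smult = (\<lambda>c x. (c \<odot>\<^bsub>dual_space K H\<^esub> fst x, c \<odot>\<^bsub>H\<^esub> snd x)),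
      bracket = (\<lambda>x y.
        (\<lambda>w\<in>carrier H. \<ominus>\<^bsub>K\<^esub> fst y (conn H (snd x) w) \<oplus>\<^bsub>K\<^esub> fst x (conn H (snd y) w)
           \<oplus>\<^bsub>K\<^esub> cocycle H (snd x) (snd y) w,
         bracket H (snd x) (snd y))),
      form = (\<lambda>x y. fst x (snd y) \<ominus>\<^bsub>K\<^esub> fst y (snd x)),
      lag_ideal = carrier (dual_space K H) \<times> {\<zero>\<^bsub>H\<^esub>},
      lag_complement = {\<zero>\<^bsub>dual_space K H\<^esub>} \<times> carrier H\<rparr>"

section \<open>The axioms of the symplectic extension\<close>

context flat_with_symplectic_cocycle
begin

abbreviation E where "E \<equiv> symplectic_extension K H"

lemma cocycle_bilinear: "bilinear_map K H H (dual_space K H) (cocycle H)"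
  using cocycle by (simp add: ce_two_cocycles_def)

lemma cocycle_dual: "\<lbrakk>u \<in> carrier H; v \<in> carrier H\<rbrakk> \<Longrightarrow> cocycle H u v \<in> carrier (dual_space K H)"
  by (rule module_hom_carrier[OF bilinear_map_right[OF cocycle_bilinear]])

lemma cocycle_hom: "\<lbrakk>u \<in> carrier H; v \<in> carrier H\<rbrakk> \<Longrightarrow> cocycle H u v \<in> module_hom K H (ground_space K)"
  using cocycle_dual by simp

lemma functional_closed:
  "\<lbrakk>\<xi> \<in> module_hom K H (ground_space K); u \<in> carrier H\<rbrakk> \<Longrightarrow> \<xi> u \<in> carrier K"
  using module_hom_carrier[of \<xi> K H "ground_space K" u] by simp

lemma cocycle_closed:
  "\<lbrakk>u \<in> carrier H; v \<in> carrier H; w \<in> carrier H\<rbrakk> \<Longrightarrow> cocycle H u v w \<in> carrier K"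
  by (rule functional_closed[OF cocycle_hom])

lemma functional_linear:
  assumes "\<xi> \<in> module_hom K H (ground_space K)"
  shows "\<lbrakk>u \<in> carrier H; v \<in> carrier H\<rbrakk> \<Longrightarrow> \<xi> (u \<oplus>\<^bsub>H\<^esub> v) = \<xi> u \<oplus>\<^bsub>K\<^esub> \<xi> v"
    and "\<lbrakk>u \<in> carrier H; v \<in> carrier H\<rbrakk> \<Longrightarrow> \<xi> (u \<ominus>\<^bsub>H\<^esub> v) = \<xi> u \<ominus>\<^bsub>K\<^esub> \<xi> v"
    and "\<lbrakk>c \<in> carrier K; u \<in> carrier H\<rbrakk> \<Longrightarrow> \<xi> (c \<odot>\<^bsub>H\<^esub> u) = c \<otimes>\<^bsub>K\<^esub> \<xi> u"
    and "\<xi> \<zero>\<^bsub>H\<^esub> = \<zero>\<^bsub>K\<^esub>"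
  using module_hom_add[OF assms] module_hom_smult[OF assms] functional_minus[OF assms]
    functional_zero[OF assms] by simp_all

lemma cocycle_linear:
  "\<lbrakk>u \<in> carrier H; u' \<in> carrier H; v \<in> carrier H; w \<in> carrier H\<rbrakk> \<Longrightarrow>
    cocycle H (u \<oplus>\<^bsub>H\<^esub> u') v w = cocycle H u v w \<oplus>\<^bsub>K\<^esub> cocycle H u' v w"
  "\<lbrakk>u \<in> carrier H; v \<in> carrier H; v' \<in> carrier H; w \<in> carrier H\<rbrakk> \<Longrightarrow>
    cocycle H u (v \<oplus>\<^bsub>H\<^esub> v') w = cocycle H u v w \<oplus>\<^bsub>K\<^esub> cocycle H u v' w"
  "\<lbrakk>c \<in> carrier K; u \<in> carrier H; v \<in> carrier H; w \<in> carrier H\<rbrakk> \<Longrightarrow>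
    cocycle H (c \<odot>\<^bsub>H\<^esub> u) v w = c \<otimes>\<^bsub>K\<^esub> cocycle H u v w"
  "\<lbrakk>c \<in> carrier K; u \<in> carrier H; v \<in> carrier H; w \<in> carrier H\<rbrakk> \<Longrightarrow>
    cocycle H u (c \<odot>\<^bsub>H\<^esub> v) w = c \<otimes>\<^bsub>K\<^esub> cocycle H u v w"
  using module_hom_add[OF bilinear_map_left[OF cocycle_bilinear]]
    module_hom_add[OF bilinear_map_right[OF cocycle_bilinear]]
    module_hom_smult[OF bilinear_map_left[OF cocycle_bilinear]]
    module_hom_smult[OF bilinear_map_right[OF cocycle_bilinear]]
  by simp_all

lemma cocycle_alternating: "\<lbrakk>u \<in> carrier H; w \<in> carrier H\<rbrakk> \<Longrightarrow> cocycle H u u w = \<zero>\<^bsub>K\<^esub>"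
  using cocycle by (simp add: ce_two_cocycles_def)

lemma cocycle_antisym:
  assumes "u \<in> carrier H" "v \<in> carrier H" "w \<in> carrier H"
  shows "cocycle H v u w = \<ominus>\<^bsub>K\<^esub> cocycle H u v w"
proof -
  have "\<zero>\<^bsub>K\<^esub> = cocycle H (u \<oplus>\<^bsub>H\<^esub> v) (u \<oplus>\<^bsub>H\<^esub> v) w"
    using assms cocycle_alternating by simp
  also have "\<dots> = cocycle H u v w \<oplus>\<^bsub>K\<^esub> cocycle H v u w"
    using assms by (simp add: cocycle_linear) (simp add: cocycle_alternating cocycle_closed R.a_comm)
  finally show ?thesis
    using assms by (intro R.minus_equality[symmetric]) (simp_all add: R.a_comm cocycle_closed)
qed

lemma cocycle_identity:
  assumes "u \<in> carrier H" "v \<in> carrier H" "w \<in> carrier H" "t \<in> carrier H"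
  shows "(\<ominus>\<^bsub>K\<^esub> cocycle H v w (conn H u t)) \<ominus>\<^bsub>K\<^esub> (\<ominus>\<^bsub>K\<^esub> cocycle H u w (conn H v t))
    \<oplus>\<^bsub>K\<^esub> (\<ominus>\<^bsub>K\<^esub> cocycle H u v (conn H w t)) \<ominus>\<^bsub>K\<^esub> cocycle H (bracket H u v) w t
    \<oplus>\<^bsub>K\<^esub> cocycle H (bracket H u w) v t \<ominus>\<^bsub>K\<^esub> cocycle H (bracket H v w) u t = \<zero>\<^bsub>K\<^esub>"
  using iffD1[OF ce_two_cocycles_dual_iff[OF vectorspace_axioms _ conn_bilinear cocycle_bilinear] cocycle]
    assms by auto

lemmas conn_linear =
  module_hom_add[OF bilinear_map_right[OF conn_bilinear]] module_hom_add[OF bilinear_map_left[OF conn_bilinear]]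
  module_hom_smult[OF bilinear_map_right[OF conn_bilinear]] module_hom_smult[OF bilinear_map_left[OF conn_bilinear]]
  module_hom_zero[OF bilinear_map_right[OF conn_bilinear] module_axioms]
  module_hom_zero[OF bilinear_map_left[OF conn_bilinear] module_axioms]

lemma extension_simps [simp]:
  "carrier E = carrier (dual_space K H) \<times> carrier H"
  "\<zero>\<^bsub>E\<^esub> = (\<zero>\<^bsub>dual_space K H\<^esub>, \<zero>\<^bsub>H\<^esub>)"
  "(\<xi>, u) \<oplus>\<^bsub>E\<^esub> (\<eta>, v) = (\<xi> \<oplus>\<^bsub>dual_space K H\<^esub> \<eta>, u \<oplus>\<^bsub>H\<^esub> v)"
  "c \<odot>\<^bsub>E\<^esub> (\<xi>, u) = (c \<odot>\<^bsub>dual_space K H\<^esub> \<xi>, c \<odot>\<^bsub>H\<^esub> u)"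
  "bracket E (\<xi>, u) (\<eta>, v) =
    (\<lambda>w\<in>carrier H. \<ominus>\<^bsub>K\<^esub> \<eta> (conn H u w) \<oplus>\<^bsub>K\<^esub> \<xi> (conn H v w) \<oplus>\<^bsub>K\<^esub> cocycle H u v w, bracket H u v)"
  "form E (\<xi>, u) (\<eta>, v) = \<xi> v \<ominus>\<^bsub>K\<^esub> \<eta> u"
  "lag_ideal E = carrier (dual_space K H) \<times> {\<zero>\<^bsub>H\<^esub>}"
  "lag_complement E = {\<zero>\<^bsub>dual_space K H\<^esub>} \<times> carrier H"
  by (simp_all add: symplectic_extension_def)

lemma fst_extension_add: "t \<in> carrier H \<Longrightarrow> fst (x \<oplus>\<^bsub>E\<^esub> y) t = fst x t \<oplus>\<^bsub>K\<^esub> fst y t"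
  by (cases x; cases y) simp

lemma extension_is_vs: "vectorspace K E"
proof -
  have "vectorspace K (direct_sum (dual_space K H) H)"
    by (rule direct_sum_is_vs[OF dual_space_is_vs vectorspace_axioms])
  then show ?thesis
    by (rule vectorspace_transport[where f = id])
      (auto simp: direct_sum_def symplectic_extension_def intro!: module_homI)
qed

lemma extension_fin_dim: "vectorspace.fin_dim K E"
proof (rule fin_dim_Times)
  show "vectorspace K (dual_space K H)" by (rule dual_space_is_vs)
  then interpret D: vectorspace K "dual_space K H" .
  show "vectorspace.fin_dim K (dual_space K H)" by (rule dual_space_fin_dim[OF finite_dimensional])
  show "(\<lambda>v. (v, \<zero>\<^bsub>H\<^esub>)) \<in> module_hom K (dual_space K H) E"
    by (rule module_homI) (simp_all del: dual_space_simps)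
  show "(\<lambda>w. (\<zero>\<^bsub>dual_space K H\<^esub>, w)) \<in> module_hom K H E"
    by (rule module_homI) (simp_all del: dual_space_simps)
  show "(v, \<zero>\<^bsub>H\<^esub>) \<oplus>\<^bsub>E\<^esub> (\<zero>\<^bsub>dual_space K H\<^esub>, w) = (v, w)"
    if "v \<in> carrier (dual_space K H)" "w \<in> carrier H" for v w
    using that by (simp del: dual_space_simps)
qed (simp_all add: vectorspace_axioms finite_dimensional extension_is_vs)

text \<open>First components are extensional functionals, so equations in \<open>E\<close> become
  scalar equations at each \<open>t\<close>.\<close>

lemma extension_eqI:
  assumes "x \<in> carrier E" "y \<in> carrier E" "\<And>t. t \<in> carrier H \<Longrightarrow> fst x t = fst y t" "snd x = snd y"
  shows "x = y"
  using assms by (auto simp: prod_eq_iff intro: extensionalityI)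

lemmas extension_closed = functional_closed cocycle_closed conn_closed

lemma extension_bracket_closed:
  assumes "x \<in> carrier E" "y \<in> carrier E"
  shows "bracket E x y \<in> carrier E"
proof -
  obtain \<xi> u \<eta> v where xy: "x = (\<xi>, u)" "y = (\<eta>, v)" by (metis surj_pair)
  have h: "\<xi> \<in> module_hom K H (ground_space K)" "\<eta> \<in> module_hom K H (ground_space K)"
    "u \<in> carrier H" "v \<in> carrier H" using assms by (auto simp: xy)
  have "(\<lambda>w\<in>carrier H. \<ominus>\<^bsub>K\<^esub> \<eta> (conn H u w) \<oplus>\<^bsub>K\<^esub> \<xi> (conn H v w) \<oplus>\<^bsub>K\<^esub> cocycle H u v w)
    \<in> module_hom K H (ground_space K)"
  proof (rule module_homI)
    fix s t assume st: "s \<in> carrier H" "t \<in> carrier H"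
    \<comment> \<open>\<open>algebra\<close> treats these values as atoms and has to know that they
      lie in \<open>K\<close>.\<close>
    have k: "\<eta> (conn H u s) \<in> carrier K" "\<eta> (conn H u t) \<in> carrier K" "\<xi> (conn H v s) \<in> carrier K"
      "\<xi> (conn H v t) \<in> carrier K" "cocycle H u v s \<in> carrier K" "cocycle H u v t \<in> carrier K"
      using h st by (simp_all add: extension_closed)
    show "(\<lambda>w\<in>carrier H. \<ominus>\<^bsub>K\<^esub> \<eta> (conn H u w) \<oplus>\<^bsub>K\<^esub> \<xi> (conn H v w) \<oplus>\<^bsub>K\<^esub> cocycle H u v w) (s \<oplus>\<^bsub>H\<^esub> t)
      = (\<lambda>w\<in>carrier H. \<ominus>\<^bsub>K\<^esub> \<eta> (conn H u w) \<oplus>\<^bsub>K\<^esub> \<xi> (conn H v w) \<oplus>\<^bsub>K\<^esub> cocycle H u v w) s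
      \<oplus>\<^bsub>ground_space K\<^esub> (\<lambda>w\<in>carrier H. \<ominus>\<^bsub>K\<^esub> \<eta> (conn H u w) \<oplus>\<^bsub>K\<^esub> \<xi> (conn H v w) \<oplus>\<^bsub>K\<^esub> cocycle H u v w) t"
      using h st k
      by (simp add: conn_linear conn_closed functional_linear[OF h(1)] functional_linear[OF h(2)]
          functional_linear[OF cocycle_hom]) algebra
  next
    fix c t assume st: "c \<in> carrier K" "t \<in> carrier H"
    have k: "\<eta> (conn H u t) \<in> carrier K" "\<xi> (conn H v t) \<in> carrier K" "cocycle H u v t \<in> carrier K"
      using h st by (simp_all add: extension_closed)
    show "(\<lambda>w\<in>carrier H. \<ominus>\<^bsub>K\<^esub> \<eta> (conn H u w) \<oplus>\<^bsub>K\<^esub> \<xi> (conn H v w) \<oplus>\<^bsub>K\<^esub> cocycle H u v w) (c \<odot>\<^bsub>H\<^esub> t)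
      = c \<odot>\<^bsub>ground_space K\<^esub> (\<lambda>w\<in>carrier H. \<ominus>\<^bsub>K\<^esub> \<eta> (conn H u w) \<oplus>\<^bsub>K\<^esub> \<xi> (conn H v w) \<oplus>\<^bsub>K\<^esub> cocycle H u v w) t"
      using h st k
      by (simp add: conn_linear conn_closed functional_linear[OF h(1)] functional_linear[OF h(2)]
          functional_linear[OF cocycle_hom]) algebra
  qed (use h in \<open>simp add: extension_closed\<close>)
  then show ?thesis using h by (simp add: xy)
qed

lemma extension_bracket_bilinear: "bilinear_map K E E E (bracket E)"
proof -
  interpret E: vectorspace K E by (rule extension_is_vs)
  show ?thesis
  proof (rule bilinear_mapI)
    fix x y z assume xyz: "x \<in> carrier E" "y \<in> carrier E" "z \<in> carrier E"
    obtain \<xi> u \<eta> v \<zeta> w where eqs: "x = (\<xi>, u)" "y = (\<eta>, v)" "z = (\<zeta>, w)" by (metis surj_pair)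
    have h: "\<xi> \<in> module_hom K H (ground_space K)" "\<eta> \<in> module_hom K H (ground_space K)"
      "\<zeta> \<in> module_hom K H (ground_space K)"
      "u \<in> carrier H" "v \<in> carrier H" "w \<in> carrier H" using xyz by (auto simp: eqs)
    show "bracket E x (y \<oplus>\<^bsub>E\<^esub> z) = bracket E x y \<oplus>\<^bsub>E\<^esub> bracket E x z" (is "?L = ?R")
    proof (rule extension_eqI)
      show "?L \<in> carrier E" "?R \<in> carrier E"
        by (intro extension_bracket_closed E.a_closed E.smult_closed xyz)+
      show "snd ?L = snd ?R"
        using h by (simp add: eqs bracket_linear)
      fix t assume t: "t \<in> carrier H"
      have k: "\<eta> (conn H u t) \<in> carrier K" "\<zeta> (conn H u t) \<in> carrier K" "\<xi> (conn H v t) \<in> carrier K"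
        "\<xi> (conn H w t) \<in> carrier K" "cocycle H u v t \<in> carrier K" "cocycle H u w t \<in> carrier K"
        using h t by (simp_all add: extension_closed)
      show "fst (bracket E x (y \<oplus>\<^bsub>E\<^esub> z)) t = fst (bracket E x y \<oplus>\<^bsub>E\<^esub> bracket E x z) t"
        using h t k by (simp add: eqs functional_linear[OF h(1)] conn_linear conn_closed cocycle_linear) algebra
    qed
    show "bracket E (x \<oplus>\<^bsub>E\<^esub> y) z = bracket E x z \<oplus>\<^bsub>E\<^esub> bracket E y z" (is "?L = ?R")
    proof (rule extension_eqI)
      show "?L \<in> carrier E" "?R \<in> carrier E"
        by (intro extension_bracket_closed E.a_closed E.smult_closed xyz)+
      show "snd ?L = snd ?R"
        using h by (simp add: eqs bracket_linear)
      fix t assume t: "t \<in> carrier H"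
      have k: "\<zeta> (conn H u t) \<in> carrier K" "\<zeta> (conn H v t) \<in> carrier K" "\<xi> (conn H w t) \<in> carrier K"
        "\<eta> (conn H w t) \<in> carrier K" "cocycle H u w t \<in> carrier K" "cocycle H v w t \<in> carrier K"
        using h t by (simp_all add: extension_closed)
      show "fst (bracket E (x \<oplus>\<^bsub>E\<^esub> y) z) t = fst (bracket E x z \<oplus>\<^bsub>E\<^esub> bracket E y z) t"
        using h t k by (simp add: eqs functional_linear[OF h(3)] conn_linear conn_closed cocycle_linear) algebra
    qed
  next
    fix c x y assume c: "c \<in> carrier K" and xy: "x \<in> carrier E" "y \<in> carrier E"
    obtain \<xi> u \<eta> v where eqs: "x = (\<xi>, u)" "y = (\<eta>, v)" by (metis surj_pair)
    have h: "\<xi> \<in> module_hom K H (ground_space K)" "\<eta> \<in> module_hom K H (ground_space K)"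
      "u \<in> carrier H" "v \<in> carrier H" using xy by (auto simp: eqs)
    have k: "\<eta> (conn H u t) \<in> carrier K" "\<xi> (conn H v t) \<in> carrier K" "cocycle H u v t \<in> carrier K"
      if "t \<in> carrier H" for t using h that by (simp_all add: extension_closed)
    show "bracket E x (c \<odot>\<^bsub>E\<^esub> y) = c \<odot>\<^bsub>E\<^esub> bracket E x y" (is "?L = ?R")
    proof (rule extension_eqI)
      show "?L \<in> carrier E" "?R \<in> carrier E"
        by (intro extension_bracket_closed E.a_closed E.smult_closed xy c)+
      show "snd ?L = snd ?R"
        using h c by (simp add: eqs bracket_linear)
      fix t assume t: "t \<in> carrier H"
      show "fst (bracket E x (c \<odot>\<^bsub>E\<^esub> y)) t = fst (c \<odot>\<^bsub>E\<^esub> bracket E x y) t"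
        using h c t k[OF t] by (simp add: eqs functional_linear[OF h(1)] conn_linear conn_closed cocycle_linear) algebra
    qed
    show "bracket E (c \<odot>\<^bsub>E\<^esub> x) y = c \<odot>\<^bsub>E\<^esub> bracket E x y" (is "?L = ?R")
    proof (rule extension_eqI)
      show "?L \<in> carrier E" "?R \<in> carrier E"
        by (intro extension_bracket_closed E.a_closed E.smult_closed xy c)+
      show "snd ?L = snd ?R"
        using h c by (simp add: eqs bracket_linear)
      fix t assume t: "t \<in> carrier H"
      show "fst (bracket E (c \<odot>\<^bsub>E\<^esub> x) y) t = fst (c \<odot>\<^bsub>E\<^esub> bracket E x y) t"
        using h c t k[OF t] by (simp add: eqs functional_linear[OF h(2)] conn_linear conn_closed cocycle_linear) algebra
    qed
  qed (rule extension_bracket_closed)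
qed

text \<open>The second component is the Jacobi identity of \<open>H\<close>. In the first, flatness
  expands each connection along a bracket into second derivatives that cancel the nested ones, and
  what remains is the cocycle identity at \<open>t\<close>.\<close>

lemma extension_jacobi:
  assumes "x \<in> carrier E" "y \<in> carrier E" "z \<in> carrier E"
  shows "bracket E x (bracket E y z) \<oplus>\<^bsub>E\<^esub> bracket E y (bracket E z x)
    \<oplus>\<^bsub>E\<^esub> bracket E z (bracket E x y) = \<zero>\<^bsub>E\<^esub>"
proof (rule extension_eqI)
  interpret E: vectorspace K E by (rule extension_is_vs)
  obtain \<xi> u \<eta> v \<zeta> w where eqs: "x = (\<xi>, u)" "y = (\<eta>, v)" "z = (\<zeta>, w)" by (metis surj_pair)
  have h: "\<xi> \<in> module_hom K H (ground_space K)" "\<eta> \<in> module_hom K H (ground_space K)"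
    "\<zeta> \<in> module_hom K H (ground_space K)"
    "u \<in> carrier H" "v \<in> carrier H" "w \<in> carrier H" using assms by (auto simp: eqs)
  show "bracket E x (bracket E y z) \<oplus>\<^bsub>E\<^esub> bracket E y (bracket E z x)
    \<oplus>\<^bsub>E\<^esub> bracket E z (bracket E x y) \<in> carrier E"
    using assms by (intro E.a_closed extension_bracket_closed)
  show "\<zero>\<^bsub>E\<^esub> \<in> carrier E" by (rule E.zero_closed)
  show "snd (bracket E x (bracket E y z) \<oplus>\<^bsub>E\<^esub> bracket E y (bracket E z x)
    \<oplus>\<^bsub>E\<^esub> bracket E z (bracket E x y)) = snd \<zero>\<^bsub>E\<^esub>"
    using h jacobi by (simp add: eqs)
  fix t assume t: "t \<in> carrier H"
  let ?n = "conn H"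
  have flat: "\<theta> (?n (bracket H p q) t) = \<theta> (?n p (?n q t)) \<ominus>\<^bsub>K\<^esub> \<theta> (?n q (?n p t))"
    if "\<theta> \<in> module_hom K H (ground_space K)" "p \<in> carrier H" "q \<in> carrier H" for \<theta> p q
    using that t by (simp add: functional_linear[OF that(1)] conn_closed flip: conn_flat)
  have k: "\<zeta> (?n v (?n u t)) \<in> carrier K" "\<zeta> (?n u (?n v t)) \<in> carrier K"
    "\<eta> (?n w (?n u t)) \<in> carrier K" "\<eta> (?n u (?n w t)) \<in> carrier K"
    "\<xi> (?n w (?n v t)) \<in> carrier K" "\<xi> (?n v (?n w t)) \<in> carrier K"
    "cocycle H v w (?n u t) \<in> carrier K" "cocycle H u w (?n v t) \<in> carrier K"
    "cocycle H u v (?n w t) \<in> carrier K" "cocycle H (bracket H u v) w t \<in> carrier K"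
    "cocycle H (bracket H u w) v t \<in> carrier K" "cocycle H (bracket H v w) u t \<in> carrier K"
    using h t by (simp_all add: extension_closed)
  \<comment> \<open>Arguments are brought to the order used in
    \<open>cocycle_identity\<close>.\<close>
  have c: "cocycle H w u (?n v t) = \<ominus>\<^bsub>K\<^esub> cocycle H u w (?n v t)"
    "cocycle H w (bracket H u v) t = \<ominus>\<^bsub>K\<^esub> cocycle H (bracket H u v) w t"
    "cocycle H u (bracket H v w) t = \<ominus>\<^bsub>K\<^esub> cocycle H (bracket H v w) u t"
    by (rule cocycle_antisym; simp add: h t conn_closed)+
  \<comment> \<open>Here two signs arise, one inside the bracket and one from swapping the
    arguments, so \<open>c'\<close> has no sign.\<close>
  have "bracket H w u = (\<ominus>\<^bsub>K\<^esub> \<one>\<^bsub>K\<^esub>) \<odot>\<^bsub>H\<^esub> bracket H u w"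
    using h by (simp add: bracket_antisym[of u w] smult_minus_1)
  then have "cocycle H (bracket H w u) v t = \<ominus>\<^bsub>K\<^esub> cocycle H (bracket H u w) v t"
    using h t by (simp add: cocycle_linear R.l_minus cocycle_closed)
  moreover have "cocycle H v (bracket H w u) t = \<ominus>\<^bsub>K\<^esub> cocycle H (bracket H w u) v t"
    by (rule cocycle_antisym; simp add: h t)
  ultimately have c': "cocycle H v (bracket H w u) t = cocycle H (bracket H u w) v t"
    using h t by (simp add: cocycle_closed)
  have 1: "fst (bracket E x (bracket E y z)) t
    = \<ominus>\<^bsub>K\<^esub> (\<ominus>\<^bsub>K\<^esub> \<zeta> (?n v (?n u t)) \<oplus>\<^bsub>K\<^esub> \<eta> (?n w (?n u t)) \<oplus>\<^bsub>K\<^esub> cocycle H v w (?n u t))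
      \<oplus>\<^bsub>K\<^esub> (\<xi> (?n v (?n w t)) \<ominus>\<^bsub>K\<^esub> \<xi> (?n w (?n v t))) \<oplus>\<^bsub>K\<^esub> (\<ominus>\<^bsub>K\<^esub> cocycle H (bracket H v w) u t)"
    using h t by (simp add: eqs flat[OF h(1)] flat[OF h(2)] flat[OF h(3)] conn_closed c)
  have 2: "fst (bracket E y (bracket E z x)) t
    = \<ominus>\<^bsub>K\<^esub> (\<ominus>\<^bsub>K\<^esub> \<xi> (?n w (?n v t)) \<oplus>\<^bsub>K\<^esub> \<zeta> (?n u (?n v t)) \<oplus>\<^bsub>K\<^esub> (\<ominus>\<^bsub>K\<^esub> cocycle H u w (?n v t)))
      \<oplus>\<^bsub>K\<^esub> (\<eta> (?n w (?n u t)) \<ominus>\<^bsub>K\<^esub> \<eta> (?n u (?n w t))) \<oplus>\<^bsub>K\<^esub> cocycle H (bracket H u w) v t"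
    using h t by (simp add: eqs flat[OF h(1)] flat[OF h(2)] flat[OF h(3)] conn_closed c c')
  have 3: "fst (bracket E z (bracket E x y)) t
    = \<ominus>\<^bsub>K\<^esub> (\<ominus>\<^bsub>K\<^esub> \<eta> (?n u (?n w t)) \<oplus>\<^bsub>K\<^esub> \<xi> (?n v (?n w t)) \<oplus>\<^bsub>K\<^esub> cocycle H u v (?n w t))
      \<oplus>\<^bsub>K\<^esub> (\<zeta> (?n u (?n v t)) \<ominus>\<^bsub>K\<^esub> \<zeta> (?n v (?n u t))) \<oplus>\<^bsub>K\<^esub> (\<ominus>\<^bsub>K\<^esub> cocycle H (bracket H u v) w t)"
    using h t by (simp add: eqs flat[OF h(1)] flat[OF h(2)] flat[OF h(3)] conn_closed c)
  have "fst (bracket E x (bracket E y z)) t \<oplus>\<^bsub>K\<^esub> fst (bracket E y (bracket E z x)) t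
      \<oplus>\<^bsub>K\<^esub> fst (bracket E z (bracket E x y)) t
    = (\<ominus>\<^bsub>K\<^esub> cocycle H v w (?n u t)) \<ominus>\<^bsub>K\<^esub> (\<ominus>\<^bsub>K\<^esub> cocycle H u w (?n v t))
      \<oplus>\<^bsub>K\<^esub> (\<ominus>\<^bsub>K\<^esub> cocycle H u v (?n w t)) \<ominus>\<^bsub>K\<^esub> cocycle H (bracket H u v) w t
      \<oplus>\<^bsub>K\<^esub> cocycle H (bracket H u w) v t \<ominus>\<^bsub>K\<^esub> cocycle H (bracket H v w) u t"
    unfolding 1 2 3 by (rule R.cyclic_sum_cancel) (rule k)+
  also have "\<dots> = \<zero>\<^bsub>K\<^esub>" using h t by (intro cocycle_identity)
  finally show "fst (bracket E x (bracket E y z) \<oplus>\<^bsub>E\<^esub> bracket E y (bracket E z x)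
    \<oplus>\<^bsub>E\<^esub> bracket E z (bracket E x y)) t = fst \<zero>\<^bsub>E\<^esub> t"
    using t by (simp only: fst_extension_add) simp
qed

lemma extension_lie_algebra: "lie_algebra K E"
proof -
  interpret E: vectorspace K E by (rule extension_is_vs)
  show ?thesis
  proof unfold_locales
    show "E.fin_dim" by (rule extension_fin_dim)
    show "bilinear_map K E E E (bracket E)" by (rule extension_bracket_bilinear)
    show "bracket E x x = \<zero>\<^bsub>E\<^esub>" if "x \<in> carrier E" for x
    proof (rule extension_eqI)
      obtain \<xi> u where x: "x = (\<xi>, u)" by (metis surj_pair)
      have h: "\<xi> \<in> module_hom K H (ground_space K)" "u \<in> carrier H" using that by (auto simp: x)
      show "fst (bracket E x x) t = fst \<zero>\<^bsub>E\<^esub> t" if "t \<in> carrier H" for t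
        using h that by (simp add: x cocycle_alternating extension_closed R.l_neg)
      show "snd (bracket E x x) = snd \<zero>\<^bsub>E\<^esub>"
        using h by (simp add: x bracket_alternating)
    next
      show "bracket E x x \<in> carrier E" "\<zero>\<^bsub>E\<^esub> \<in> carrier E"
        by (intro extension_bracket_closed E.zero_closed that)+
    qed
  qed (rule extension_jacobi)
qed

lemma dual_separates:
  assumes "u \<in> carrier H" "\<And>\<xi>. \<xi> \<in> carrier (dual_space K H) \<Longrightarrow> \<xi> u = \<zero>\<^bsub>K\<^esub>"
  shows "u = \<zero>\<^bsub>H\<^esub>"
proof -
  obtain S where S: "S \<subseteq> carrier (dual_space K H)"
    "\<And>v. \<lbrakk>v \<in> carrier H; \<And>f. f \<in> S \<Longrightarrow> f v = \<zero>\<^bsub>K\<^esub>\<rbrakk> \<Longrightarrow> v = \<zero>\<^bsub>H\<^esub>"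
    using coordinate_functionals[OF finite_dimensional] by metis
  show ?thesis
  proof (rule S(2)[OF assms(1)])
    show "f u = \<zero>\<^bsub>K\<^esub>" if "f \<in> S" for f
      using assms(2) S(1) that by blast
  qed
qed

lemma zero_functional: "(\<lambda>v\<in>carrier H. \<zero>\<^bsub>K\<^esub>) \<in> module_hom K H (ground_space K)"
  by (rule module_homI) simp_all

text \<open>The elements (0, t) and (\<eta>, 0) detect the two components, the latter because
  functionals separate points. In the closedness sum the connection terms cancel by vanishing
  torsion, which leaves the cyclic condition on the cocycle.\<close>

lemma extension_symplectic: "symplectic_lie_algebra K E"
proof -
  interpret E: lie_algebra K E by (rule extension_lie_algebra)
  show ?thesis
  proof unfold_locales
    show "bilinear_map K E E (ground_space K) (form E)"
    proof (rule bilinear_mapI)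
      fix x y z assume xyz: "x \<in> carrier E" "y \<in> carrier E" "z \<in> carrier E"
      obtain \<xi> u \<eta> v \<zeta> w where eqs: "x = (\<xi>, u)" "y = (\<eta>, v)" "z = (\<zeta>, w)" by (metis surj_pair)
      have h: "\<xi> \<in> module_hom K H (ground_space K)" "\<eta> \<in> module_hom K H (ground_space K)"
        "\<zeta> \<in> module_hom K H (ground_space K)"
        "u \<in> carrier H" "v \<in> carrier H" "w \<in> carrier H" using xyz by (auto simp: eqs)
      have k: "\<xi> v \<in> carrier K" "\<xi> w \<in> carrier K" "\<eta> u \<in> carrier K" "\<eta> w \<in> carrier K"
        "\<zeta> u \<in> carrier K" "\<zeta> v \<in> carrier K"
        using h functional_closed by auto
      show "form E x (y \<oplus>\<^bsub>E\<^esub> z) = form E x y \<oplus>\<^bsub>ground_space K\<^esub> form E x z"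
        using h k by (simp add: eqs functional_linear[OF h(1)]) algebra
      show "form E (x \<oplus>\<^bsub>E\<^esub> y) z = form E x z \<oplus>\<^bsub>ground_space K\<^esub> form E y z"
        using h k by (simp add: eqs functional_linear[OF h(3)]) algebra
    next
      fix c x y assume c: "c \<in> carrier K" and xy: "x \<in> carrier E" "y \<in> carrier E"
      obtain \<xi> u \<eta> v where eqs: "x = (\<xi>, u)" "y = (\<eta>, v)" by (metis surj_pair)
      have h: "\<xi> \<in> module_hom K H (ground_space K)" "\<eta> \<in> module_hom K H (ground_space K)"
        "u \<in> carrier H" "v \<in> carrier H" using xy by (auto simp: eqs)
      have k: "\<xi> v \<in> carrier K" "\<eta> u \<in> carrier K"
        using functional_closed[OF h(1)] functional_closed[OF h(2)] h by auto
      show "form E x (c \<odot>\<^bsub>E\<^esub> y) = c \<odot>\<^bsub>ground_space K\<^esub> form E x y"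
        using c h k by (simp add: eqs functional_linear[OF h(1)]) algebra
      show "form E (c \<odot>\<^bsub>E\<^esub> x) y = c \<odot>\<^bsub>ground_space K\<^esub> form E x y"
        using c h k by (simp add: eqs functional_linear[OF h(2)]) algebra
    next
      fix x y assume "x \<in> carrier E" "y \<in> carrier E"
      then show "form E x y \<in> carrier (ground_space K)"
        by (auto simp: functional_closed)
    qed
    show "form E x x = \<zero>\<^bsub>K\<^esub>" if "x \<in> carrier E" for x
      using that by (auto simp: functional_closed R.minus_eq R.r_neg)
    show "x = \<zero>\<^bsub>E\<^esub>" if x: "x \<in> carrier E" and 0: "\<And>y. y \<in> carrier E \<Longrightarrow> form E x y = \<zero>\<^bsub>K\<^esub>" for x
    proof (rule extension_eqI[OF x E.zero_closed])
      obtain \<xi> u where eq: "x = (\<xi>, u)" by (metis surj_pair)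
      have h: "\<xi> \<in> module_hom K H (ground_space K)" "u \<in> carrier H" using x by (auto simp: eq)
      show "fst x t = fst \<zero>\<^bsub>E\<^esub> t" if "t \<in> carrier H" for t
        using 0[of "(\<zero>\<^bsub>dual_space K H\<^esub>, t)"] that h
        by (simp add: eq zero_functional functional_closed R.minus_eq)
      show "snd x = snd \<zero>\<^bsub>E\<^esub>"
      proof -
        have "\<eta> u = \<zero>\<^bsub>K\<^esub>" if "\<eta> \<in> carrier (dual_space K H)" for \<eta>
        proof -
          have "\<eta> u \<in> carrier K" using that h by (simp add: functional_closed)
          moreover have "\<ominus>\<^bsub>K\<^esub> \<eta> u = \<zero>\<^bsub>K\<^esub>"
            using 0[of "(\<eta>, \<zero>\<^bsub>H\<^esub>)"] that h
            by (simp add: eq functional_linear(4)[OF h(1)] R.minus_eq functional_closed)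
          ultimately show ?thesis by (metis R.minus_minus R.minus_zero)
        qed
        then show ?thesis using dual_separates[OF h(2)] by (simp add: eq)
      qed
    qed
    fix x y z assume xyz: "x \<in> carrier E" "y \<in> carrier E" "z \<in> carrier E"
    obtain \<xi> u \<eta> v \<zeta> w where eqs: "x = (\<xi>, u)" "y = (\<eta>, v)" "z = (\<zeta>, w)" by (metis surj_pair)
    have h: "\<xi> \<in> module_hom K H (ground_space K)" "\<eta> \<in> module_hom K H (ground_space K)"
      "\<zeta> \<in> module_hom K H (ground_space K)"
      "u \<in> carrier H" "v \<in> carrier H" "w \<in> carrier H" using xyz by (auto simp: eqs)
    let ?n = "conn H"
    have tf: "\<theta> (bracket H p q) = \<theta> (?n p q) \<ominus>\<^bsub>K\<^esub> \<theta> (?n q p)"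
      if "\<theta> \<in> module_hom K H (ground_space K)" "p \<in> carrier H" "q \<in> carrier H" for \<theta> p q
      using that by (simp add: functional_linear[OF that(1)] conn_closed flip: conn_torsion_free)
    have k: "\<xi> (?n v w) \<in> carrier K" "\<xi> (?n w v) \<in> carrier K" "\<eta> (?n u w) \<in> carrier K"
      "\<eta> (?n w u) \<in> carrier K" "\<zeta> (?n u v) \<in> carrier K" "\<zeta> (?n v u) \<in> carrier K"
      "cocycle H u v w \<in> carrier K" "cocycle H w u v \<in> carrier K" "cocycle H v w u \<in> carrier K"
      using h by (simp_all add: extension_closed)
    have "form E (bracket E x y) z \<oplus>\<^bsub>K\<^esub> form E (bracket E z x) y \<oplus>\<^bsub>K\<^esub> form E (bracket E y z) x
      = cocycle H u v w \<oplus>\<^bsub>K\<^esub> cocycle H w u v \<oplus>\<^bsub>K\<^esub> cocycle H v w u"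
      using h k by (simp add: eqs tf[OF h(1)] tf[OF h(2)] tf[OF h(3)]) algebra
    also have "\<dots> = \<zero>\<^bsub>K\<^esub>" using h by (intro cocycle_symplectic)
    finally show "form E (bracket E x y) z \<oplus>\<^bsub>K\<^esub> form E (bracket E z x) y \<oplus>\<^bsub>K\<^esub> form E (bracket E y z) x = \<zero>\<^bsub>K\<^esub>" .
  qed
qed

text \<open>Each summand is isotropic because \<omega> pairs only opposite components, and it
  contains its orthogonal by testing against the same vectors that show nondegeneracy.\<close>

lemma extension_strongly_polarized: "strongly_polarized K E"
proof -
  interpret E: symplectic_lie_algebra K E by (rule extension_symplectic)
  interpret D: vectorspace K "dual_space K H" by (rule dual_space_is_vs)
  have A: "subspace K (lag_ideal E) E"
    unfolding subspace_def
    by (intro conjI submodule.intro)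
      (auto simp: E.vectorspace_axioms E.module_axioms simp del: dual_space_simps)
  have N: "subspace K (lag_complement E) E"
    unfolding subspace_def
    by (intro conjI submodule.intro)
      (auto simp: E.vectorspace_axioms E.module_axioms simp del: dual_space_simps)
  show ?thesis
  proof unfold_locales
    show "lie_ideal K (lag_ideal E) E"
      unfolding lie_ideal_def
    proof (intro conjI ballI A)
      fix x a assume xa: "x \<in> carrier E" "a \<in> lag_ideal E"
      then have "bracket E x a \<in> carrier E" by (intro E.bracket_closed) auto
      then show "bracket E x a \<in> lag_ideal E"
        using xa by (auto simp: bracket_linear simp del: dual_space_simps)
    qed
    show "lagrangian K (lag_ideal E) E"
      unfolding lagrangian_def
    proof (intro conjI A equalityI subsetI)
      fix x assume "x \<in> form_orthogonal K E (lag_ideal E)"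
      then have "x \<in> carrier E" and orth: "\<And>w. w \<in> lag_ideal E \<Longrightarrow> form E x w = \<zero>\<^bsub>K\<^esub>"
        by (simp_all add: form_orthogonal_def del: extension_simps)
      then obtain \<xi> u where x: "x = (\<xi>, u)" "\<xi> \<in> carrier (dual_space K H)" "u \<in> carrier H"
        unfolding extension_simps by (elim SigmaE)
      have 0: "\<xi> \<zero>\<^bsub>H\<^esub> \<ominus>\<^bsub>K\<^esub> \<eta> u = \<zero>\<^bsub>K\<^esub>" if "\<eta> \<in> carrier (dual_space K H)" for \<eta>
        using orth[of "(\<eta>, \<zero>\<^bsub>H\<^esub>)"] that by (simp add: x(1) del: dual_space_simps)
      have "\<eta> u = \<zero>\<^bsub>K\<^esub>" if "\<eta> \<in> carrier (dual_space K H)" for \<eta>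
        using 0[OF that] that x by (simp add: functional_linear(4) functional_closed)
      then show "x \<in> lag_ideal E" using x dual_separates by simp
    next
      fix x assume "x \<in> lag_ideal E"
      then show "x \<in> form_orthogonal K E (lag_ideal E)"
        by (auto simp: form_orthogonal_def functional_linear(4) R.minus_eq)
    qed
    show "lagrangian K (lag_complement E) E"
      unfolding lagrangian_def
    proof (intro conjI N equalityI subsetI)
      fix x assume "x \<in> form_orthogonal K E (lag_complement E)"
      then have "x \<in> carrier E" and orth: "\<And>w. w \<in> lag_complement E \<Longrightarrow> form E x w = \<zero>\<^bsub>K\<^esub>"
        by (simp_all add: form_orthogonal_def del: extension_simps)
      then obtain \<xi> u where x: "x = (\<xi>, u)" "\<xi> \<in> carrier (dual_space K H)" "u \<in> carrier H"
        unfolding extension_simps by (elim SigmaE)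
      have 0: "\<xi> v \<ominus>\<^bsub>K\<^esub> \<zero>\<^bsub>K\<^esub> = \<zero>\<^bsub>K\<^esub>" if "v \<in> carrier H" for v
        using orth[of "(\<zero>\<^bsub>dual_space K H\<^esub>, v)"] that x(3) by (simp add: x(1))
      have "\<xi> v = \<zero>\<^bsub>K\<^esub>" if "v \<in> carrier H" for v
        using 0[OF that] that x by (simp add: functional_closed R.minus_eq)
      then have "\<xi> = \<zero>\<^bsub>dual_space K H\<^esub>" using x by (auto intro: extensionalityI)
      then show "x \<in> lag_complement E" using x by simp
    next
      fix x assume "x \<in> lag_complement E"
      then show "x \<in> form_orthogonal K E (lag_complement E)"
        by (auto simp: form_orthogonal_def zero_functional R.minus_eq)
    qed
    show "lag_ideal E <+>\<^bsub>E\<^esub> lag_complement E = carrier E"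
    proof
      show "carrier E \<subseteq> lag_ideal E <+>\<^bsub>E\<^esub> lag_complement E"
      proof
        fix x assume "x \<in> carrier E"
        then obtain \<xi> u where x: "x = (\<xi>, u)" "\<xi> \<in> carrier (dual_space K H)" "u \<in> carrier H"
          by auto
        then have "x = (\<xi>, \<zero>\<^bsub>H\<^esub>) \<oplus>\<^bsub>E\<^esub> (\<zero>\<^bsub>dual_space K H\<^esub>, u)"
          by (simp del: dual_space_simps)
        then show "x \<in> lag_ideal E <+>\<^bsub>E\<^esub> lag_complement E"
          using x unfolding set_add_def' extension_simps(7,8) by blast
      qed
      show "lag_ideal E <+>\<^bsub>E\<^esub> lag_complement E \<subseteq> carrier E"
        unfolding set_add_def' by (auto simp del: dual_space_simps)
    qed
    show "lag_ideal E \<inter> lag_complement E = {\<zero>\<^bsub>E\<^esub>}"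
      by (auto simp: zero_functional)
  qed
qed

end

text \<open>This is the source of surjectivity: every flat algebra with symplectic cocycle is a
  model of some polarized algebra.\<close>

lemma extension_model_symplectic_extension:
  fixes H :: "('k, 'b) flat_cocycle_alg"
  assumes "flat_with_symplectic_cocycle K H"
  shows "extension_model K (symplectic_extension K H) H (\<lambda>u. (\<zero>\<^bsub>dual_space K H\<^esub>, u))"
proof -
  interpret flat_with_symplectic_cocycle K H by fact
  interpret E: strongly_polarized K E by (rule extension_strongly_polarized)
  interpret D: vectorspace K "dual_space K H" by (rule dual_space_is_vs)
  \<comment> \<open>The bracket of (0, u) with an ideal element (\<xi>, 0) contains the value of the
    cocycle at u and 0.\<close>
  have zero: "cocycle H u \<zero>\<^bsub>H\<^esub> w = \<zero>\<^bsub>K\<^esub>" if "u \<in> carrier H" "w \<in> carrier H" for u w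
    using cocycle_linear(4)[of "\<zero>\<^bsub>K\<^esub>" u "\<zero>\<^bsub>H\<^esub>" w] that by (simp add: cocycle_closed)
  show ?thesis
  proof unfold_locales
    show "(\<lambda>u. (\<zero>\<^bsub>dual_space K H\<^esub>, u)) \<in> module_hom K H E"
      by (rule module_homI) (simp_all del: dual_space_simps)
    show "bij_betw (\<lambda>u. (\<zero>\<^bsub>dual_space K H\<^esub>, u)) (carrier H) (lag_complement E)"
      by (auto simp: bij_betw_def inj_on_def)
    show "cocycle H u v \<in> extensional (carrier H)" if "u \<in> carrier H" "v \<in> carrier H" for u v
      using cocycle_dual[OF that] by simp
  qed (auto simp: conn_closed cocycle_closed functional_closed functional_linear(4)
      functional_linear(4)[OF cocycle_hom] conn_linear bracket_linear zero R.minus_eq)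
qed

text \<open>Any model determines \<open>G\<close>, since the target is built from \<open>H\<close>
  alone. Bijectivity comes from the nondegenerate pairing, without counting dimensions.\<close>

lemma extension_model_imp_isomorphic:
  assumes "extension_model K G H l"
  shows "polarized_isomorphic K G (symplectic_extension K H)"
proof -
  interpret M: extension_model K G H l by fact
  interpret H: flat_with_symplectic_cocycle K H by (rule M.model_flat_with_symplectic_cocycle)
  let ?E = "symplectic_extension K H"
  interpret E: strongly_polarized K ?E by (rule H.extension_strongly_polarized)
  define \<Phi> where "\<Phi> x = ((\<lambda>u\<in>carrier H. form G x (l u)), M.proj x)" for x
  have dual: "(\<lambda>u\<in>carrier H. form G x (l u)) \<in> carrier (dual_space K H)" if "x \<in> carrier G" for x
    using that by (auto intro!: module_homI simp: M.l_closed M.l_linear M.form_linear)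
  have closed: "\<Phi> x \<in> carrier ?E" if "x \<in> carrier G" for x
    using that dual by (simp add: \<Phi>_def M.proj_closed del: M.H.dual_space_simps)
  have proj_sum: "M.proj (a \<oplus>\<^bsub>G\<^esub> l u) = u" if "a \<in> lag_ideal G" "u \<in> carrier H" for a u
    using that by (intro M.proj_eqI) (simp_all add: M.ideal_closed M.l_closed M.form_linear M.form_ideal_ideal)
  have hom: "\<Phi> \<in> module_hom K G ?E"
  proof (rule module_homI)
    show "\<Phi> (x \<oplus>\<^bsub>G\<^esub> y) = \<Phi> x \<oplus>\<^bsub>?E\<^esub> \<Phi> y" if "x \<in> carrier G" "y \<in> carrier G" for x y
      using that by (auto simp: \<Phi>_def module_hom_add[OF M.proj_hom] fun_eq_iff M.form_linear M.l_closed)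
    show "\<Phi> (c \<odot>\<^bsub>G\<^esub> x) = c \<odot>\<^bsub>?E\<^esub> \<Phi> x" if "c \<in> carrier K" "x \<in> carrier G" for c x
      using that by (auto simp: \<Phi>_def module_hom_smult[OF M.proj_hom] fun_eq_iff M.form_linear M.l_closed)
  qed (rule closed)
  have ev: "form G x (l u) = form G y (l u)" if "\<Phi> x = \<Phi> y" "u \<in> carrier H" for x y u
  proof -
    have "(\<lambda>u\<in>carrier H. form G x (l u)) = (\<lambda>u\<in>carrier H. form G y (l u))"
      using that(1) by (simp add: \<Phi>_def)
    from fun_cong[OF this, of u] show ?thesis using that(2) by simp
  qed
  have bij: "bij_betw \<Phi> (carrier G) (carrier ?E)"
    unfolding bij_betw_def
  proof (intro conjI inj_onI equalityI subsetI)
    fix x y assume xy: "x \<in> carrier G" "y \<in> carrier G" and eq: "\<Phi> x = \<Phi> y"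
    show "x = y"
    proof (rule M.form_eqI_polarized[OF xy])
      fix a assume a: "a \<in> lag_ideal G"
      have "M.proj x = M.proj y" using eq by (simp add: \<Phi>_def)
      then show "form G x a = form G y a" using M.form_proj[OF xy(1) a] M.form_proj[OF xy(2) a] by simp
    next
      fix n assume "n \<in> lag_complement G"
      then obtain u where "u \<in> carrier H" "n = l u" by (rule M.l_surj)
      then show "form G x n = form G y n" using ev[OF eq] by simp
    qed
  next
    fix y assume "y \<in> \<Phi> ` carrier G"
    then show "y \<in> carrier ?E" using closed by blast
  next
    fix y assume "y \<in> carrier ?E"
    then obtain \<xi> u where y: "y = (\<xi>, u)" "\<xi> \<in> carrier (dual_space K H)" "u \<in> carrier H"
      unfolding H.extension_simps by (elim SigmaE)
    \<comment> \<open>\<open>\<xi>\<close> is extended to \<open>G\<close> by zero on the ideal, so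
      that \<omega> can represent it.\<close>
    then have "\<xi> \<circ> M.proj \<in> module_hom K G (ground_space K)"
      by (intro module_hom_comp[OF M.proj_hom]) simp
    from M.form_represents[OF this]
    obtain x0 where x0: "x0 \<in> carrier G" "\<forall>z\<in>carrier G. form G x0 z = (\<xi> \<circ> M.proj) z"
      by blast
    \<comment> \<open>The component \<open>l u0\<close> pairs to zero with the complement; it is
      discarded in favour of \<open>l u\<close>, which gives the required second component.\<close>
    obtain a u0 where au: "a \<in> lag_ideal G" "u0 \<in> carrier H" "x0 = a \<oplus>\<^bsub>G\<^esub> l u0"
      using M.G_decomposition[OF x0(1)] .
    have "form G (a \<oplus>\<^bsub>G\<^esub> l u) (l w) = \<xi> w" if "w \<in> carrier H" for w
    proof -
      have "form G (a \<oplus>\<^bsub>G\<^esub> l u) (l w) = form G x0 (l w)"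
        using that au y by (simp add: M.form_linear M.ideal_closed M.l_closed M.form_l_l)
      then show ?thesis using that by (simp add: x0(2) M.l_closed M.proj_l)
    qed
    then have "(\<lambda>w\<in>carrier H. form G (a \<oplus>\<^bsub>G\<^esub> l u) (l w)) = \<xi>"
      using y(2) by (auto intro: extensionalityI)
    then have "\<Phi> (a \<oplus>\<^bsub>G\<^esub> l u) = y"
      using au y by (simp add: \<Phi>_def proj_sum)
    moreover have "a \<oplus>\<^bsub>G\<^esub> l u \<in> carrier G" using au y by (simp add: M.ideal_closed M.l_closed)
    ultimately show "y \<in> \<Phi> ` carrier G" by blast
  qed
  have iso: "\<Phi> \<in> lie_iso K G ?E"
  proof (rule lie_isoI[OF hom bij])
    fix x y assume xy: "x \<in> carrier G" "y \<in> carrier G"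
    obtain a u where x: "a \<in> lag_ideal G" "u \<in> carrier H" "x = a \<oplus>\<^bsub>G\<^esub> l u"
      using M.G_decomposition[OF xy(1)] .
    obtain b v where y: "b \<in> lag_ideal G" "v \<in> carrier H" "y = b \<oplus>\<^bsub>G\<^esub> l v"
      using M.G_decomposition[OF xy(2)] .
    note cl = x(1,2) y(1,2) M.ideal_closed M.l_closed
    have px: "M.proj x = u" and py: "M.proj y = v"
      using x y by (simp_all add: proj_sum)
    \<comment> \<open>Under the pairing the complement acts on the ideal by \<rho>.\<close>
    have action: "form G (bracket G (l p) c) (l w) = \<ominus>\<^bsub>K\<^esub> form G c (l (conn H p w))"
      if "p \<in> carrier H" "w \<in> carrier H" "c \<in> lag_ideal G" for p w c
      using that M.form_antisym[of "l w" "bracket G (l p) c"] M.form_antisym[of "l (conn H p w)" c]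
      by (simp add: M.model_closed M.model_conn)
    show "\<Phi> (bracket G x y) = bracket ?E (\<Phi> x) (\<Phi> y)"
    proof (rule H.extension_eqI)
      show "\<Phi> (bracket G x y) \<in> carrier ?E" "bracket ?E (\<Phi> x) (\<Phi> y) \<in> carrier ?E"
        using xy by (simp_all only: closed M.bracket_closed E.bracket_closed)
      show "snd (\<Phi> (bracket G x y)) = snd (bracket ?E (\<Phi> x) (\<Phi> y))"
      proof -
        have "M.proj (bracket G x y) = bracket H u v"
        proof (rule M.proj_eqI)
          fix c assume c: "c \<in> lag_ideal G"
          have "form G (bracket G x y) c = form G (bracket G (l u) (l v)) c"
            using c x y M.bracket_ideal_right[of "l u" b] M.bracket_ideal_left[of a "l v"]
            by (simp add: M.bracket_linear M.form_linear cl M.ideal_abelian M.form_ideal_ideal)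
          then show "form G (l (bracket H u v)) c = form G (bracket G x y) c"
            using c x y by (simp add: M.model_bracket)
        qed (use xy x y in \<open>simp_all add: M.model_closed\<close>)
        then show ?thesis by (simp add: \<Phi>_def px py)
      qed
      fix w assume w: "w \<in> carrier H"
      \<comment> \<open>The term with \<open>a\<close> and \<open>b\<close> vanishes because the
        ideal is abelian; the two mixed terms are values of \<rho>.\<close>
      have "form G (bracket G x y) (l w) = form G (bracket G a (l v)) (l w)
          \<oplus>\<^bsub>K\<^esub> form G (bracket G (l u) b) (l w) \<oplus>\<^bsub>K\<^esub> form G (bracket G (l u) (l v)) (l w)"
        using w by (simp add: x(3) y(3) M.bracket_linear M.form_linear cl M.ideal_abelian M.R.a_ac)
      also have "form G (bracket G a (l v)) (l w) = form G a (l (conn H v w))"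
        using w action[of v w a] by (simp add: M.bracket_antisym[of "l v" a] cl M.form_linear M.model_closed)
      also have "form G (bracket G (l u) b) (l w) = \<ominus>\<^bsub>K\<^esub> form G b (l (conn H u w))"
        using w cl by (intro action)
      \<comment> \<open>The first component of \<open>\<Phi>\<close> records pairings of
        \<open>x\<close> and \<open>y\<close> with the complement, where \<open>a\<close> may be
        replaced by \<open>x\<close> and \<open>b\<close> by \<open>y\<close>.\<close>
      also have "form G a (l (conn H v w)) = form G x (l (conn H v w))"
        using w by (simp add: x(3) M.form_linear cl M.model_closed M.form_l_l)
      also have "form G b (l (conn H u w)) = form G y (l (conn H u w))"
        using w by (simp add: y(3) M.form_linear cl M.model_closed M.form_l_l)
      finally show "fst (\<Phi> (bracket G x y)) w = fst (bracket ?E (\<Phi> x) (\<Phi> y)) w"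
        using w xy x(2) y(2)
        by (simp add: \<Phi>_def px py M.model_cocycle M.model_closed M.R.a_comm)
    qed
  qed
  have form: "form ?E (\<Phi> x) (\<Phi> y) = form G x y" if xy: "x \<in> carrier G" "y \<in> carrier G" for x y
  proof -
    obtain a u where x: "a \<in> lag_ideal G" "u \<in> carrier H" "x = a \<oplus>\<^bsub>G\<^esub> l u"
      using M.G_decomposition[OF xy(1)] .
    obtain b v where y: "b \<in> lag_ideal G" "v \<in> carrier H" "y = b \<oplus>\<^bsub>G\<^esub> l v"
      using M.G_decomposition[OF xy(2)] .
    note cl = x(1,2) y(1,2) M.ideal_closed M.l_closed
    have "form ?E (\<Phi> x) (\<Phi> y) = form G x (l v) \<ominus>\<^bsub>K\<^esub> form G y (l u)"
      using x y by (simp add: \<Phi>_def proj_sum)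
    also have "\<dots> = form G a (l v) \<oplus>\<^bsub>K\<^esub> form G (l u) b"
      by (simp add: x(3) y(3) M.form_linear cl M.form_l_l M.form_antisym[of "l u" b] M.R.minus_eq)
    also have "\<dots> = form G x y"
      by (simp add: x(3) y(3) M.form_linear cl M.form_l_l M.form_ideal_ideal M.R.a_comm)
    finally show ?thesis .
  qed
  have ideal: "\<Phi> x \<in> lag_ideal ?E \<longleftrightarrow> x \<in> lag_ideal G" if x: "x \<in> carrier G" for x
  proof -
    have "\<Phi> x \<in> lag_ideal ?E \<longleftrightarrow> M.proj x = \<zero>\<^bsub>H\<^esub>"
      using dual[OF x] by (simp add: \<Phi>_def del: M.H.dual_space_simps)
    also have "\<dots> \<longleftrightarrow> x \<in> lag_ideal G"
    proof
      assume 0: "M.proj x = \<zero>\<^bsub>H\<^esub>"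
      show "x \<in> lag_ideal G"
      proof (rule M.in_idealI[OF x])
        fix a assume "a \<in> lag_ideal G"
        with M.form_proj[OF x this] show "form G x a = \<zero>\<^bsub>K\<^esub>"
          by (simp add: 0 M.l_linear M.form_linear M.ideal_closed)
      qed
    next
      assume "x \<in> lag_ideal G"
      then show "M.proj x = \<zero>\<^bsub>H\<^esub>"
        using x by (intro M.proj_eqI) (simp_all add: M.l_linear M.form_linear M.ideal_closed M.form_ideal_ideal)
    qed
    finally show ?thesis .
  qed
  have complement: "\<Phi> x \<in> lag_complement ?E \<longleftrightarrow> x \<in> lag_complement G" if x: "x \<in> carrier G" for x
  proof -
    have "\<Phi> x \<in> lag_complement ?E \<longleftrightarrow> (\<forall>u\<in>carrier H. form G x (l u) = \<zero>\<^bsub>K\<^esub>)"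
      using x by (auto simp: \<Phi>_def fun_eq_iff M.proj_closed)
    also have "\<dots> \<longleftrightarrow> x \<in> lag_complement G"
    proof
      assume 0: "\<forall>u\<in>carrier H. form G x (l u) = \<zero>\<^bsub>K\<^esub>"
      show "x \<in> lag_complement G"
      proof (rule M.in_complementI[OF x])
        fix n assume "n \<in> lag_complement G"
        then obtain u where "u \<in> carrier H" "n = l u" by (rule M.l_surj)
        with 0 show "form G x n = \<zero>\<^bsub>K\<^esub>" by simp
      qed
    qed (simp add: M.form_complement_complement M.l_complement)
    finally show ?thesis .
  qed
  \<comment> \<open>Equivalences of membership become equations of images because
    \<open>\<Phi>\<close> is onto.\<close>
  have image: "\<Phi> ` A = B" if AB: "A \<subseteq> carrier G" "B \<subseteq> carrier ?E"
    "\<And>x. x \<in> carrier G \<Longrightarrow> \<Phi> x \<in> B \<longleftrightarrow> x \<in> A" for A B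
  proof
    show "B \<subseteq> \<Phi> ` A"
    proof
      fix y assume y: "y \<in> B"
      then obtain x where "x \<in> carrier G" "y = \<Phi> x" using AB(2) bij unfolding bij_betw_def by blast
      then show "y \<in> \<Phi> ` A" using AB(3) y by blast
    qed
  qed (use AB in blast)
  have "\<Phi> ` lag_ideal G = lag_ideal ?E"
    by (rule image[OF subsetI[OF M.ideal_closed] subsetI[OF E.ideal_closed] ideal])
  moreover have "\<Phi> ` lag_complement G = lag_complement ?E"
    by (rule image[OF subsetI[OF M.complement_closed] subsetI[OF E.complement_closed] complement])
  ultimately show ?thesis
    unfolding polarized_isomorphic_def using form by (intro bexI[OF _ iso]) simp
qed

section \<open>Transport along an injection\<close>

text \<open>This moves the symplectic extension, whose carrier is a set of pairs, into the universe
  type by copying all structure onto the image of \<open>f\<close>.\<close>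

lemma strongly_polarized_transport:
  fixes G :: "('k, 'a) polarized_alg" and f :: "'a \<Rightarrow> 'b"
  assumes "strongly_polarized K G" and inj: "inj_on f (carrier G)"
  shows "\<exists>G' :: ('k, 'b) polarized_alg. strongly_polarized K G' \<and> polarized_isomorphic K G G'"
proof -
  interpret G: strongly_polarized K G by fact
  define g where "g = inv_into (carrier G) f"
  define G' :: "('k, 'b) polarized_alg" where
    "G' = \<lparr>carrier = f ` carrier G, mult = (\<lambda>_ _. f \<zero>\<^bsub>G\<^esub>), one = f \<zero>\<^bsub>G\<^esub>, zero = f \<zero>\<^bsub>G\<^esub>,
      add = (\<lambda>x y. f (g x \<oplus>\<^bsub>G\<^esub> g y)), smult = (\<lambda>c x. f (c \<odot>\<^bsub>G\<^esub> g x)),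
      bracket = (\<lambda>x y. f (bracket G (g x) (g y))), form = (\<lambda>x y. form G (g x) (g y)),
      lag_ideal = f ` lag_ideal G, lag_complement = f ` lag_complement G\<rparr>"
  have gf: "g (f x) = x" if "x \<in> carrier G" for x
    using that inj by (simp add: g_def)
  have fs: "carrier G' = f ` carrier G" "\<zero>\<^bsub>G'\<^esub> = f \<zero>\<^bsub>G\<^esub>"
    "lag_ideal G' = f ` lag_ideal G" "lag_complement G' = f ` lag_complement G"
    by (simp_all add: G'_def)
  have ops: "f x \<oplus>\<^bsub>G'\<^esub> f y = f (x \<oplus>\<^bsub>G\<^esub> y)" "bracket G' (f x) (f y) = f (bracket G x y)"
    "form G' (f x) (f y) = form G x y" if "x \<in> carrier G" "y \<in> carrier G" for x y
    using that by (simp_all add: G'_def gf)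
  have sm: "c \<odot>\<^bsub>G'\<^esub> f x = f (c \<odot>\<^bsub>G\<^esub> x)" if "x \<in> carrier G" for c x
    using that by (simp add: G'_def gf)
  have AG: "lag_ideal G \<subseteq> carrier G" and NG: "lag_complement G \<subseteq> carrier G"
    using G.ideal_closed G.complement_closed by auto
  have hom: "f \<in> module_hom K G G'"
    by (rule module_homI) (simp_all add: fs ops sm)
  have bij: "bij_betw f (carrier G) (carrier G')"
    using inj by (simp add: bij_betw_def fs)
  have "vectorspace K G'"
    by (rule vectorspace_transport[OF G.vectorspace_axioms bij hom]) (simp add: fs)
  then interpret G': vectorspace K G' .
  have fd: "G'.fin_dim"
    by (rule fin_dim_image[OF G.vectorspace_axioms G.finite_dimensional G'.vectorspace_axioms hom])
      (simp add: fs)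
  have "lie_algebra K G'"
  proof unfold_locales
    show "bilinear_map K G' G' G' (bracket G')"
      by (rule bilinear_mapI) (auto simp: fs ops sm G.bracket_linear)
  qed (auto simp: fd fs ops G.bracket_alternating G.jacobi)
  then interpret G': lie_algebra K G' .
  have "symplectic_lie_algebra K G'"
  proof unfold_locales
    show "bilinear_map K G' G' (ground_space K) (form G')"
      by (rule bilinear_mapI) (auto simp: fs ops sm G.form_linear)
    show "x = \<zero>\<^bsub>G'\<^esub>" if x: "x \<in> carrier G'" and 0: "\<And>y. y \<in> carrier G' \<Longrightarrow> form G' x y = \<zero>\<^bsub>K\<^esub>" for x
    proof -
      obtain x' where x': "x' \<in> carrier G" "x = f x'" using x by (auto simp: fs)
      have "form G x' y = \<zero>\<^bsub>K\<^esub>" if "y \<in> carrier G" for y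
        using 0[of "f y"] that x' by (simp add: fs ops)
      then show ?thesis using G.form_nondegenerate[OF x'(1)] x' by (simp add: fs)
    qed
  qed (auto simp: fs ops G.form_alternating G.form_closed)
  then interpret G': symplectic_lie_algebra K G' .
  have sub: "subspace K (f ` S) G'" if "submodule K S G" for S
  proof -
    interpret S: submodule K S G by fact
    show ?thesis
      unfolding subspace_def using S.subset
      by (intro conjI submodule.intro)
        (auto simp: G'.vectorspace_axioms G'.module_axioms fs ops sm subset_iff)
  qed
  have lag: "lagrangian K (f ` S) G'" if S: "lagrangian K S G" for S
    unfolding lagrangian_def
  proof
    have SG: "S \<subseteq> carrier G" using S by (auto simp: lagrangian_def form_orthogonal_def)
    have "submodule K S G" using S by (simp add: lagrangian_def subspace_def)
    then show "subspace K (f ` S) G'" by (rule sub)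
    \<comment> \<open>Since \<open>f\<close> preserves the form, it commutes with taking
      orthogonals.\<close>
    have "form_orthogonal K G' (f ` S) = f ` form_orthogonal K G S"
      using SG by (auto simp: form_orthogonal_def fs ops subset_iff)
    then show "form_orthogonal K G' (f ` S) = f ` S" using S by (simp add: lagrangian_def)
  qed
  have "strongly_polarized K G'"
  proof unfold_locales
    show "lie_ideal K (lag_ideal G') G'"
      unfolding lie_ideal_def
    proof (intro conjI ballI)
      show "subspace K (lag_ideal G') G'" using sub[OF G.submodule_lag_ideal] by (simp add: fs)
      show "bracket G' x a \<in> lag_ideal G'" if "x \<in> carrier G'" "a \<in> lag_ideal G'" for x a
        using that AG G.bracket_ideal_right by (auto simp: fs ops subset_iff)
    qed
    show "lagrangian K (lag_ideal G') G'" using lag[OF G.ideal_lagrangian] by (simp add: fs)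
    show "lagrangian K (lag_complement G') G'" using lag[OF G.complement_lagrangian] by (simp add: fs)
    have "lag_ideal G' <+>\<^bsub>G'\<^esub> lag_complement G' = f ` (lag_ideal G <+>\<^bsub>G\<^esub> lag_complement G)"
      unfolding set_add_def' using AG NG by (auto simp: fs ops subset_iff image_iff)
    then show "lag_ideal G' <+>\<^bsub>G'\<^esub> lag_complement G' = carrier G'"
      by (simp add: G.sum_carrier fs)
    show "lag_ideal G' \<inter> lag_complement G' = {\<zero>\<^bsub>G'\<^esub>}"
      using inj_on_image_Int[OF inj AG NG] by (simp add: fs G.sum_direct)
  qed
  moreover have "polarized_isomorphic K G G'"
    unfolding polarized_isomorphic_def
    by (intro bexI[OF _ lie_isoI[OF hom bij]]) (simp_all add: fs ops)
  ultimately show ?thesis by blast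
qed

section \<open>The correspondence of isomorphism classes\<close>

text \<open>A relation \<open>P\<close> takes the place of a map because the extension triple lies
  outside the type of the target. \<open>iff\<close> makes the induced map on classes both well
  defined and injective, and \<open>right\<close> makes its values full classes.\<close>

lemma bij_betw_quotients:
  assumes r: "equiv A r" and s: "equiv B s"
    and total: "\<And>x. x \<in> A \<Longrightarrow> \<exists>y\<in>B. P x y" and onto: "\<And>y. y \<in> B \<Longrightarrow> \<exists>x\<in>A. P x y"
    and iff: "\<And>x x' y y'. \<lbrakk>x \<in> A; x' \<in> A; y \<in> B; y' \<in> B; P x y; P x' y'\<rbrakk> \<Longrightarrow>
      (x, x') \<in> r \<longleftrightarrow> (y, y') \<in> s"
    and right: "\<And>x y y'. \<lbrakk>x \<in> A; P x y; (y, y') \<in> s\<rbrakk> \<Longrightarrow> P x y'"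
  shows "bij_betw (\<lambda>C. {y \<in> B. \<exists>x\<in>C. P x y}) (A // r) (B // s)"
proof -
  define F where "F C = {y \<in> B. \<exists>x\<in>C. P x y}" for C
  have rA: "r \<subseteq> A \<times> A" and sB: "s \<subseteq> B \<times> B"
    using r s by (auto simp: equiv_def refl_on_def)
  have F: "F (r `` {x}) = s `` {y}" if xy: "x \<in> A" "y \<in> B" "P x y" for x y
  proof (intro equalityI subsetI)
    fix y' assume "y' \<in> F (r `` {x})"
    then obtain x' where x': "y' \<in> B" "(x, x') \<in> r" "P x' y'" by (auto simp: F_def)
    then have "x' \<in> A" using rA by blast
    then show "y' \<in> s `` {y}" using iff[OF xy(1) _ xy(2) x'(1) xy(3) x'(3)] x' by simp
  next
    fix y' assume "y' \<in> s `` {y}"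
    then have y': "(y, y') \<in> s" "y' \<in> B" using sB by auto
    have "(x, x) \<in> r" using r xy(1) by (simp add: equiv_class_self[OF r, simplified])
    then show "y' \<in> F (r `` {x})" using right[OF xy(1) xy(3) y'(1)] y'(2) by (auto simp: F_def)
  qed
  have "bij_betw F (A // r) (B // s)"
    unfolding bij_betw_def
  proof
    show "inj_on F (A // r)"
    proof (rule inj_onI)
      fix C D assume "C \<in> A // r" "D \<in> A // r" and eq: "F C = F D"
      then obtain x x' where x: "x \<in> A" "C = r `` {x}" and x': "x' \<in> A" "D = r `` {x'}"
        by (auto elim!: quotientE)
      obtain y y' where y: "y \<in> B" "P x y" and y': "y' \<in> B" "P x' y'"
        using total x(1) x'(1) by meson
      have "s `` {y} = s `` {y'}" using eq F[OF x(1) y] F[OF x'(1) y'] x x' by simp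
      then have "(y, y') \<in> s" using eq_equiv_class[OF _ s y'(1)] by blast
      then have "(x, x') \<in> r" using iff[OF x(1) x'(1) y(1) y'(1) y(2) y'(2)] by simp
      then show "C = D" unfolding x(2) x'(2) by (rule equiv_class_eq[OF r])
    qed
    show "F ` (A // r) = B // s"
    proof (intro equalityI subsetI)
      fix D assume "D \<in> F ` (A // r)"
      then obtain x where x: "x \<in> A" "D = F (r `` {x})" by (auto elim!: quotientE)
      obtain y where "y \<in> B" "P x y" using total x(1) by blast
      then show "D \<in> B // s" using F[OF x(1)] x(2) by (simp add: quotientI)
    next
      fix D assume "D \<in> B // s"
      then obtain y where y: "y \<in> B" "D = s `` {y}" by (auto elim!: quotientE)
      obtain x where "x \<in> A" "P x y" using onto y(1) by blast
      then show "D \<in> F ` (A // r)" using F y by (metis imageI quotientI)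
    qed
  qed
  then show ?thesis unfolding F_def[abs_def] .
qed

text \<open>From left to right, \<open>H\<close> becomes a model of \<open>G'\<close>, and models
  are unique. From right to left, \<open>H\<close> again becomes a model of \<open>G'\<close>, so
  both \<open>G\<close> and \<open>G'\<close> are isomorphic to
  \<open>symplectic_extension K H\<close>.\<close>

lemma polarized_isomorphic_iff:
  assumes "extension_model K G H l" "extension_model K G' H' l'"
  shows "polarized_isomorphic K G G' \<longleftrightarrow> flat_cocycle_isomorphic K H H'"
proof
  interpret M: extension_model K G H l by fact
  interpret M': extension_model K G' H' l' by fact
  {
    assume "polarized_isomorphic K G G'"
    from extension_model_postcomp[OF assms(1) M'.strongly_polarized_axioms this]
    obtain m where "extension_model K G' H m" by blast
    then show "flat_cocycle_isomorphic K H H'" using assms(2) by (rule extension_model_unique)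
  next
    assume "flat_cocycle_isomorphic K H H'"
    from extension_model_precomp[OF assms(2) M.model_flat_with_symplectic_cocycle this]
    obtain m where "extension_model K G' H m" by blast
    then have "polarized_isomorphic K G' (symplectic_extension K H)"
      by (rule extension_model_imp_isomorphic)
    then have "polarized_isomorphic K (symplectic_extension K H) G'"
      by (rule polarized_isomorphic_sym[OF M'.strongly_polarized_axioms])
    with extension_model_imp_isomorphic[OF assms(1)] show "polarized_isomorphic K G G'"
      by (rule polarized_isomorphic_trans)
  }
qed

theorem corollary5p9:
  fixes K :: "('k, 'm) ring_scheme"
  assumes field: "field_char_zero K"
    and universe: "\<exists>f :: 'k \<Rightarrow> 'u. inj_on f (carrier K)"
  shows "(\<forall>G \<in> (polarized_algs K :: ('k, 'u) polarized_alg set).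
            extension_triple K G \<in> flat_cocycle_algs K) \<and>
         (\<forall>G \<in> (polarized_algs K :: ('k, 'u) polarized_alg set). \<forall>G' \<in> polarized_algs K.
            polarized_isomorphic K G G' \<longrightarrow>
            flat_cocycle_isomorphic K (extension_triple K G) (extension_triple K (G' :: ('k, 'u) polarized_alg))) \<and>
         equiv (polarized_algs K :: ('k, 'u) polarized_alg set) (polarized_iso_rel K) \<and>
         equiv (flat_cocycle_algs K :: ('k, 'u) flat_cocycle_alg set) (flat_cocycle_iso_rel K) \<and>
         bij_betw
           (\<lambda>C. {H \<in> flat_cocycle_algs K. \<exists>G\<in>C. flat_cocycle_isomorphic K (extension_triple K G) H})
           ((polarized_algs K :: ('k, 'u) polarized_alg set) // polarized_iso_rel K)
           ((flat_cocycle_algs K :: ('k, 'u) flat_cocycle_alg set) // flat_cocycle_iso_rel K)"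
proof -
  let ?A = "polarized_algs K :: ('k, 'u) polarized_alg set"
  let ?B = "flat_cocycle_algs K :: ('k, 'u) flat_cocycle_alg set"
  let ?P = "\<lambda>(G :: ('k, 'u) polarized_alg) (H :: ('k, 'u) flat_cocycle_alg).
    flat_cocycle_isomorphic K (extension_triple K G) H"
  have model: "extension_model K G (extension_triple K G) (lift G)" if "G \<in> ?A" for G
    using that by (simp add: polarized_algs_def extension_model_extension_triple)
  have flat: "flat_with_symplectic_cocycle K (extension_triple K G)" if "G \<in> ?A" for G
    using extension_model.model_flat_with_symplectic_cocycle[OF model[OF that]] .
  \<comment> \<open>The relation in the theorem is the existence of a model, a statement that no
    longer mentions cosets.\<close>
  have P: "?P G H \<longleftrightarrow> (\<exists>l. extension_model K G H l)" if G: "G \<in> ?A" and H: "H \<in> ?B" for G H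
  proof
    assume "?P G H"
    then have "flat_cocycle_isomorphic K H (extension_triple K G)"
      by (rule flat_cocycle_isomorphic_sym[OF flat[OF G]])
    then show "\<exists>l. extension_model K G H l"
      using H by (intro extension_model_precomp[OF model[OF G]]) (simp_all add: flat_cocycle_algs_def)
  qed (use extension_model_unique[OF model[OF G]] in blast)
  have classes: "bij_betw (\<lambda>C. {H \<in> ?B. \<exists>G\<in>C. ?P G H}) (?A // polarized_iso_rel K) (?B // flat_cocycle_iso_rel K)"
  proof (rule bij_betw_quotients[OF equiv_polarized_iso_rel equiv_flat_cocycle_iso_rel])
    \<comment> \<open>Totality: the triple lives in \<open>'u set\<close>, so the model on the
      complement provides a representative in \<open>'u\<close>.\<close>
    fix G assume G: "G \<in> ?A"
    then obtain H :: "('k, 'u) flat_cocycle_alg" where H: "extension_model K G H id"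
      using extension_model_in_complement[of K G] by (auto simp: polarized_algs_def)
    then have "H \<in> ?B"
      by (simp add: flat_cocycle_algs_def extension_model.model_flat_with_symplectic_cocycle)
    then show "\<exists>H\<in>?B. ?P G H" using H P[OF G] by blast
  next
    fix H assume HB: "H \<in> ?B"
    then have H: "flat_with_symplectic_cocycle K H" by (simp add: flat_cocycle_algs_def)
    let ?E = "symplectic_extension K H"
    have E: "strongly_polarized K ?E"
      by (rule flat_with_symplectic_cocycle.extension_strongly_polarized[OF H])
    interpret E: strongly_polarized K ?E by (rule E)
    \<comment> \<open>The carrier of \<open>?E\<close> injects into \<open>K\<close>, infinite by
      characteristic zero, and from there into \<open>'u\<close>.\<close>
    obtain f where f: "inj_on f (carrier ?E)" "f ` carrier ?E \<subseteq> carrier K"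
      using E.carrier_embeds[OF E.finite_dimensional field_char_zero.infinite_carrier[OF field]] by blast
    obtain i :: "'k \<Rightarrow> 'u" where i: "inj_on i (carrier K)" using universe by blast
    have "inj_on (i \<circ> f) (carrier ?E)"
      using f(1) inj_on_subset[OF i f(2)] by (rule comp_inj_on)
    from strongly_polarized_transport[OF E this]
    obtain G :: "('k, 'u) polarized_alg" where G: "strongly_polarized K G" "polarized_isomorphic K ?E G"
      by blast
    have "\<exists>l. extension_model K G H l"
      by (rule extension_model_postcomp[OF extension_model_symplectic_extension[OF H] G])
    moreover have "G \<in> ?A" using G by (simp add: polarized_algs_def)
    ultimately show "\<exists>G\<in>?A. ?P G H" using P HB by blast
  next
    fix G G' H H' assume mem: "G \<in> ?A" "G' \<in> ?A" "H \<in> ?B" "H' \<in> ?B" and "?P G H" "?P G' H'"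
    then obtain l l' where "extension_model K G H l" "extension_model K G' H' l'"
      using P by blast
    from polarized_isomorphic_iff[OF this] mem
    show "(G, G') \<in> polarized_iso_rel K \<longleftrightarrow> (H, H') \<in> flat_cocycle_iso_rel K"
      by (simp add: polarized_iso_rel_def flat_cocycle_iso_rel_def)
  next
    fix G H H' assume "?P G H" "(H, H') \<in> flat_cocycle_iso_rel K"
    then show "?P G H'"
      using flat_cocycle_isomorphic_trans by (auto simp: flat_cocycle_iso_rel_def)
  qed
  have invariant: "\<forall>G \<in> ?A. \<forall>G' \<in> ?A. polarized_isomorphic K G G' \<longrightarrow>
      flat_cocycle_isomorphic K (extension_triple K G) (extension_triple K G')"
    using polarized_isomorphic_iff[OF model model] by blast
  have "\<forall>G \<in> ?A. extension_triple K G \<in> flat_cocycle_algs K"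
    using flat by (simp add: flat_cocycle_algs_def)
  with invariant show ?thesis
    by (intro conjI equiv_polarized_iso_rel equiv_flat_cocycle_iso_rel classes)
qed

end
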